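(* Fix an integer $g\ge1$. For each $n$, let $\boldsymbol F^0_n$ be a uniform random element of $\mathcal F^0_n$ (a uniform random minimal factorization of $(1\,\cdots\,n)$) and let $\boldsymbol F^g_n$ be a uniform random element of $\mathcal F^g_n$. Let $\Lambda^g$ denote the $g$-fold iteration of the random map $\Lambda$ described in the context (with independent randomness at each iteration). Then \[\lim_{n\to\infty}d_{TV}\big[\Lambda^g(\boldsymbol F^0_n),\boldsymbol F^g_n\big]=0,\] where $d_{TV}$ is the total variation distance between laws.
   Context: Permutations are composed from left to right: $\sigma\tau$ means $\sigma$ is applied first, then $\tau$. $\mathbb T_n$ is the set of transpositions of the symmetric group $S_n$. For $n\ge1$, $h\ge0$, \[\mathcal F^h_n=\{(t_1,\dots,t_{n-1+2h})\in\mathbb T_n^{\,n-1+2h}:\ t_1\cdots t_{n-1+2h}=(1\,2\,\cdots\,n)\}.\] Random map $\Lambda$: for each $h\ge1$ it maps $\mathcal F^{h-1}_n\uplus\{\dag\}$ to $\mathcal F^h_n\uplus\{\dag\}$, where $\dag$ is a formal failure symbol. Let $F=(t_1,\dots,t_{n-1+2(h-1)})\in\mathcal F^{h-1}_n$. Pick a uniform random pair of integers $v<w$ in $[1,n-1+2h]$ and a uniform random triple of integers $a<b<c$ in $[1,n]$, independently of each other and of $F$. Step (i). Define \[\overline F_1=(t_1,\dots,t_{v-1},(a\,c),t_v,\dots,t_{w-2},(a\,b),t_{w-1},\dots,t_{n-1+2(h-1)}),\] \[\overline F_2=(t_1,\dots,t_{v-1},(a\,b),t_v,\dots,t_{w-2},(a\,c),t_{w-1},\dots,t_{n-1+2(h-1)}).\]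 If the product of all transpositions in $\overline F_1$ is a single cycle $\zeta$ of length $n$, set $\overline F=\overline F_1$. Otherwise, if the product of all transpositions in $\overline F_2$ is a single cycle $\zeta$ of length $n$, set $\overline F=\overline F_2$. Otherwise set $\overline F=\dag$. Step (ii). If $\overline F\ne\dag$, let $\sigma$ be the unique permutation of $\{1,\dots,n\}$ with $\sigma(1)=1$ and $\sigma^{-1}\zeta\sigma=(1\,\cdots\,n)$, and let $\Lambda(F)\in\mathcal F^h_n$ be obtained from $\overline F$ by replacing each transposition $(i\,j)$ by $\sigma^{-1}(i\,j)\sigma=(\sigma(i)\,\sigma(j))$. If $\overline F=\dag$, set $\Lambda(F)=\dag$. By convention $\Lambda(\dag)=\dag$. *)

theory Defs
  imports "HOL-Probability.Probability" "HOL-Combinatorics.Combinatorics"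
begin

(* Elements of S_n are functions on nat that permute {1..n} and fix everything else. *)

definition transpositions :: "nat \<Rightarrow> (nat \<Rightarrow> nat) set" where
  "transpositions n = {Transposition.transpose i j | i j. i \<in> {1..n} \<and> j \<in> {1..n} \<and> i \<noteq> j}"

(* The product t_1 t_2 ... t_k is read from left to right, i.e. t_1 is applied first;
   as a function it is t_k o ... o t_1. *)
fun perm_prod :: "(nat \<Rightarrow> nat) list \<Rightarrow> nat \<Rightarrow> nat" where
  "perm_prod [] = id"
| "perm_prod (t # ts) = perm_prod ts \<circ> t"

definition full_cycle :: "nat \<Rightarrow> nat \<Rightarrow> nat" where
  "full_cycle n = cycle_of_list [1..<Suc n]"

definition is_full_cycle :: "nat \<Rightarrow> (nat \<Rightarrow> nat) \<Rightarrow> bool" where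
  "is_full_cycle n \<zeta> \<longleftrightarrow> (\<exists>cs. distinct cs \<and> set cs = {1..n} \<and> \<zeta> = cycle_of_list cs)"

definition factorizations :: "nat \<Rightarrow> nat \<Rightarrow> (nat \<Rightarrow> nat) list set" where
  "factorizations n h =
     {ts. length ts = n - 1 + 2 * h \<and> set ts \<subseteq> transpositions n \<and> perm_prod ts = full_cycle n}"

(* The list (t_1,...,t_{v-1}, x, t_v,...,t_{w-2}, y, t_{w-1},...): x and y are at
   positions v < w (counted from 1) of the new list. *)
definition insert_two ::
  "nat \<Rightarrow> nat \<Rightarrow> 'a \<Rightarrow> 'a \<Rightarrow> 'a list \<Rightarrow> 'a list" where
  "insert_two v w x y ts =
     take (v - 1) ts @ [x] @ take (w - 1 - v) (drop (v - 1) ts) @ [y] @ drop (w - 2) ts"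

(* Step (i); None is the failure symbol. *)
definition add_transpositions ::
  "nat \<Rightarrow> nat \<times> nat \<Rightarrow> nat \<times> nat \<times> nat \<Rightarrow> (nat \<Rightarrow> nat) list \<Rightarrow> (nat \<Rightarrow> nat) list option" where
  "add_transpositions n = (\<lambda>(v, w) (a, b, c) ts.
     let F1 = insert_two v w (Transposition.transpose a c) (Transposition.transpose a b) ts;
         F2 = insert_two v w (Transposition.transpose a b) (Transposition.transpose a c) ts
     in if is_full_cycle n (perm_prod F1) then Some F1
        else if is_full_cycle n (perm_prod F2) then Some F2
        else None)"

(* In left-to-right notation sigma^{-1} zeta sigma is the function
   sigma o zeta o inv sigma. *)
definition relabelling :: "nat \<Rightarrow> (nat \<Rightarrow> nat) \<Rightarrow> nat \<Rightarrow> nat" where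
  "relabelling n \<zeta> =
     (THE \<sigma>. \<sigma> permutes {1..n} \<and> \<sigma> 1 = 1 \<and> \<sigma> \<circ> \<zeta> \<circ> inv \<sigma> = full_cycle n)"

definition relabel :: "nat \<Rightarrow> (nat \<Rightarrow> nat) list \<Rightarrow> (nat \<Rightarrow> nat) list" where
  "relabel n ts = (let \<sigma> = relabelling n (perm_prod ts) in map (\<lambda>t. \<sigma> \<circ> t \<circ> inv \<sigma>) ts)"

definition pairs :: "nat \<Rightarrow> (nat \<times> nat) set" where
  "pairs m = {(v, w). 1 \<le> v \<and> v < w \<and> w \<le> m}"

definition triples :: "nat \<Rightarrow> (nat \<times> nat \<times> nat) set" where
  "triples n = {(a, b, c). 1 \<le> a \<and> a < b \<and> b < c \<and> c \<le> n}"

(* The random map from genus h - 1 to genus h, as a Markov kernel. For n < 3 there is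
   no triple to choose and the value of pmf_of_set is unspecified; only large n matter. *)
definition \<Lambda> :: "nat \<Rightarrow> nat \<Rightarrow> (nat \<Rightarrow> nat) list option \<Rightarrow> (nat \<Rightarrow> nat) list option pmf" where
  "\<Lambda> n h F = (case F of
       None \<Rightarrow> return_pmf None
     | Some ts \<Rightarrow>
         map_pmf (\<lambda>(vw, abc). map_option (relabel n) (add_transpositions n vw abc ts))
           (pair_pmf (pmf_of_set (pairs (n - 1 + 2 * h))) (pmf_of_set (triples n))))"

(* Law after g independent iterations (from genus 0 to genus g), started from law p. *)
primrec \<Lambda>_iter ::
  "nat \<Rightarrow> nat \<Rightarrow> (nat \<Rightarrow> nat) list option pmf \<Rightarrow> (nat \<Rightarrow> nat) list option pmf" where
  "\<Lambda>_iter n 0 p = p"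
| "\<Lambda>_iter n (Suc g) p = bind_pmf (\<Lambda>_iter n g p) (\<Lambda> n (Suc g))"

(* For n \<le> 1 and h > 0 the set is empty and the law is unspecified. *)
definition uniform_factorization :: "nat \<Rightarrow> nat \<Rightarrow> (nat \<Rightarrow> nat) list option pmf" where
  "uniform_factorization n h = map_pmf Some (pmf_of_set (factorizations n h))"

definition d_TV :: "'a pmf \<Rightarrow> 'a pmf \<Rightarrow> real" where
  "d_TV p q = (SUP A. \<bar>measure_pmf.prob p A - measure_pmf.prob q A\<bar>)"

end

theory Submission
  imports Defs
begin

text \<open>For a factorization of the \<open>n\<close>-cycle, let \<open>pos s x\<close> be the point carried to \<open>x\<close> by the first
  \<open>s\<close> factors. Each factor swaps two values of \<open>pos\<close>, so it creates one descent, and every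
  \<open>x \<noteq> 1\<close> must descend at least once since it travels from \<open>x\<close> to \<open>x - 1\<close>; a factorization of
  genus \<open>h\<close> therefore has at most \<open>2h\<close> special vertices, those with a further descent (an analogue
  of Chapuy's trisections). When \<open>a\<close>, \<open>b\<close>, \<open>c\<close> are far apart and their positions vary little in
  time, exactly one of the two insertions of \<open>\<Lambda>\<close> gives an \<open>n\<close>-cycle, \<open>a\<close> becomes special, and the
  input can be read off the output together with \<open>a\<close>. So, up to a negligible proportion of the
  inputs, \<open>\<Lambda>\<close> is at most \<open>2h\<close>-to-one. As the number of inputs is asymptotically \<open>2h |F^h|\<close>, its
  image is asymptotically uniform.

  The number of factorizations is found from the characteristic polynomials
  \<open>det (1 - x P\<^sub>\<sigma>) / (1 - x)\<close>: multiplying \<open>\<sigma>\<close> by a random transposition acts on them by a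
  differential operator whose eigenvectors are the monomials, and the value at \<open>x = 1\<close> detects
  \<open>n\<close>-cycles. That positions vary little is proved in genus 0 by cutting the factorization at a
  vertex into two minimal factorizations, and is propagated to higher genus by \<open>\<Lambda>\<close> itself.\<close>

section \<open>Products, positions and relabelling\<close>

text \<open>No lower bound on fibres is proved. If all but a fraction \<epsilon> of the inputs are
  mapped at most m-to-one into V, and m |V| is at most (1 + \<epsilon>) times the number of inputs,
  then every event receives at most its uniform mass plus 2 \<epsilon>; passing to complements makes
  this two-sided. Hence the count of factorizations must be known with its exact leading constant,
  and that constant must match the bound 2h on special vertices. The obstacle is to find the two
  inserted factors in the output. The gaps between a, b, c exceed twice the allowed displacement L
  of positions: an ordinary ascent of a then has length at most 2L, while the inserted one is
  longer. Such gaps are frequent only if L is a small fraction of n, which is why positions are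
  controlled at scale n/k for every fixed k. \<open>char_det\<close> vanishes at 1 for every
  permutation, so n-cycles are visible only after division by 1 - x; the same division turns the
  averaging operator into a diagonal one.\<close>

abbreviation tr :: "nat \<Rightarrow> nat \<Rightarrow> nat \<Rightarrow> nat" where
  "tr \<equiv> Transposition.transpose"

definition transp_on :: "nat set \<Rightarrow> (nat \<Rightarrow> nat) set" where
  "transp_on S = {tr i j | i j. i \<in> S \<and> j \<in> S \<and> i \<noteq> j}"

lemma transpositions_eq: "transpositions n = transp_on {1..n}"
  by (simp add: transpositions_def transp_on_def)

lemma transp_onE:
  assumes "t \<in> transp_on S"
  obtains i j where "i \<in> S" "j \<in> S" "i \<noteq> j" "t = tr i j"
  using assms by (auto simp: transp_on_def)

lemma transp_onI: "i \<in> S \<Longrightarrow> j \<in> S \<Longrightarrow> i \<noteq> j \<Longrightarrow> tr i j \<in> transp_on S"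
  by (auto simp: transp_on_def)

lemma transp_on_permutes: "t \<in> transp_on S \<Longrightarrow> t permutes S"
  by (auto simp: transp_on_def intro: permutes_swap_id)

lemma finite_transp_on [simp]: "finite S \<Longrightarrow> finite (transp_on S)"
proof -
  assume "finite S"
  moreover have "transp_on S \<subseteq> (\<lambda>(i, j). tr i j) ` (S \<times> S)"
    by (auto simp: transp_on_def)
  ultimately show ?thesis
    using finite_subset by fastforce
qed

text \<open>The inverse of \<open>perm_prod\<close> on lists of involutions. Having its own
  recursion, it gives \<open>pos_Suc\<close> for arbitrary lists.\<close>

fun inv_prod :: "(nat \<Rightarrow> nat) list \<Rightarrow> nat \<Rightarrow> nat" where
  "inv_prod [] = id"
| "inv_prod (t # ts) = t \<circ> inv_prod ts"

text \<open>\<open>pos ts s x\<close> is the point that the first \<open>s\<close> factors carry to \<open>x\<close>: the position,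
  along the face of the map, of the corner of \<open>x\<close> between times \<open>s\<close> and \<open>s + 1\<close>.\<close>

definition pos :: "(nat \<Rightarrow> nat) list \<Rightarrow> nat \<Rightarrow> nat \<Rightarrow> nat" where
  "pos ts s = inv_prod (take s ts)"

lemma perm_prod_append: "perm_prod (xs @ ys) = perm_prod ys \<circ> perm_prod xs"
  by (induction xs) auto

lemma inv_prod_append: "inv_prod (xs @ ys) = inv_prod xs \<circ> inv_prod ys"
  by (induction xs) auto

lemma perm_prod_permutes: "set ts \<subseteq> transp_on S \<Longrightarrow> perm_prod ts permutes S"
  by (induction ts) (auto intro: permutes_compose[OF transp_on_permutes])

lemma inv_prod_permutes: "set ts \<subseteq> transp_on S \<Longrightarrow> inv_prod ts permutes S"
  by (induction ts) (auto intro: permutes_compose[OF _ transp_on_permutes])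

lemma transp_on_invol: "t \<in> transp_on S \<Longrightarrow> t (t x) = x"
  by (auto elim!: transp_onE)

lemma inv_prod_perm_prod: "set ts \<subseteq> transp_on S \<Longrightarrow> inv_prod ts (perm_prod ts x) = x"
  by (induction ts arbitrary: x) (auto simp: transp_on_invol)

lemma perm_prod_inv_prod: "set ts \<subseteq> transp_on S \<Longrightarrow> perm_prod ts (inv_prod ts x) = x"
  by (induction ts arbitrary: x) (auto simp: transp_on_invol)

lemma pos_0 [simp]: "pos ts 0 = id"
  by (simp add: pos_def)

lemma pos_Suc: "s < length ts \<Longrightarrow> pos ts (Suc s) x = pos ts s ((ts ! s) x)"
  by (simp add: pos_def take_Suc_conv_app_nth inv_prod_append)

lemma pos_permutes: "set ts \<subseteq> transp_on S \<Longrightarrow> pos ts s permutes S"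
  unfolding pos_def by (meson inv_prod_permutes order_trans set_take_subset)

lemma pos_ge_length: "length ts \<le> s \<Longrightarrow> pos ts s = inv_prod ts"
  by (simp add: pos_def)

lemma full_cycle_simps:
  assumes "1 \<le> n"
  shows "1 \<le> i \<Longrightarrow> i < n \<Longrightarrow> full_cycle n i = Suc i" "full_cycle n n = 1"
    "i = 0 \<or> i > n \<Longrightarrow> full_cycle n i = i"
proof -
  define cs where "cs = [1..<Suc n]"
  have d: "distinct cs" by (simp add: cs_def)
  have nz: "length cs = n" by (simp add: cs_def)
  have m: "map (cycle_of_list cs) cs = rotate1 cs"
    using cyclic_rotation[OF d, of 1] by simp
  have cs_nth: "k < n \<Longrightarrow> cs ! k = Suc k" for k by (simp add: cs_def del: upt_Suc)
  have nth: "cycle_of_list cs (Suc k) = cs ! (Suc k mod n)" if "k < n" for k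
  proof -
    have "cycle_of_list cs (cs ! k) = map (cycle_of_list cs) cs ! k" using that nz by simp
    also have "\<dots> = cs ! (Suc k mod n)" unfolding m using that nz by (simp add: nth_rotate1)
    finally show ?thesis using cs_nth that by simp
  qed
  show "full_cycle n i = Suc i" if "1 \<le> i" "i < n"
    using nth[of "i - 1"] cs_nth[of i] that by (simp add: full_cycle_def cs_def)
  show "full_cycle n n = 1"
    using nth[of "n - 1"] cs_nth[of 0] assms by (simp add: full_cycle_def cs_def)
  show "full_cycle n i = i" if "i = 0 \<or> i > n"
    unfolding full_cycle_def by (rule id_outside_supp) (use that in auto)
qed

lemma full_cycle_permutes: "full_cycle n permutes {1..n}"
  using cycle_permutes[of "[1..<Suc n]"] unfolding full_cycle_def
  by (simp add: atLeastLessThanSuc_atLeastAtMost del: upt_Suc)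

lemma full_cycle_funpow: "1 \<le> n \<Longrightarrow> k < n \<Longrightarrow> (full_cycle n ^^ k) 1 = Suc k"
  by (induction k) (auto simp: full_cycle_simps)

definition conj_by :: "(nat \<Rightarrow> nat) \<Rightarrow> (nat \<Rightarrow> nat) \<Rightarrow> nat \<Rightarrow> nat" where
  "conj_by \<sigma> t = \<sigma> \<circ> t \<circ> inv \<sigma>"

lemma conj_by_transpose: "bij \<sigma> \<Longrightarrow> conj_by \<sigma> (tr i j) = tr (\<sigma> i) (\<sigma> j)"
  by (rule ext) (auto simp: conj_by_def Transposition.transpose_def bij_inv_eq_iff bij_is_inj inv_f_f bij_betw_def surj_f_inv_f)

lemma conj_by_comp: "bij \<sigma> \<Longrightarrow> conj_by \<sigma> (f \<circ> g) = conj_by \<sigma> f \<circ> conj_by \<sigma> g"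
  by (auto simp: conj_by_def fun_eq_iff bij_is_inj)

lemma conj_by_id [simp]: "bij \<sigma> \<Longrightarrow> conj_by \<sigma> id = id"
  by (simp add: conj_by_def bij_is_surj fun_eq_iff surj_f_inv_f)

lemma conj_by_apply: "bij \<sigma> \<Longrightarrow> conj_by \<sigma> f (\<sigma> x) = \<sigma> (f x)"
  by (simp add: conj_by_def bij_is_inj)

lemma conj_by_eqI: "bij \<sigma> \<Longrightarrow> (\<And>x. g (\<sigma> x) = \<sigma> (f x)) \<Longrightarrow> conj_by \<sigma> f = g"
  by (rule ext) (metis bij_is_surj conj_by_apply surj_f_inv_f)

lemma conj_by_conj_by: "bij \<sigma> \<Longrightarrow> bij \<rho> \<Longrightarrow> conj_by \<sigma> (conj_by \<rho> f) = conj_by (\<sigma> \<circ> \<rho>) f"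
  by (simp add: conj_by_def o_inv_distrib comp_assoc)

lemma conj_by_inv_cancel: "bij \<sigma> \<Longrightarrow> conj_by (inv \<sigma>) (conj_by \<sigma> f) = f"
  by (simp add: conj_by_def fun_eq_iff bij_is_inj inv_inv_eq)

lemma conj_by_inv_cancel': "bij \<sigma> \<Longrightarrow> conj_by \<sigma> (conj_by (inv \<sigma>) f) = f"
  by (simp add: conj_by_def fun_eq_iff bij_is_surj surj_f_inv_f inv_inv_eq)

lemma conj_by_inj: "bij \<sigma> \<Longrightarrow> conj_by \<sigma> f = conj_by \<sigma> g \<Longrightarrow> f = g"
  by (metis conj_by_inv_cancel)

lemma conj_by_transp_on: "bij \<sigma> \<Longrightarrow> t \<in> transp_on S \<Longrightarrow> conj_by \<sigma> t \<in> transp_on (\<sigma> ` S)"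
  by (auto elim!: transp_onE simp: conj_by_transpose bij_is_inj inj_eq intro!: transp_onI)

lemma perm_prod_conj: "bij \<sigma> \<Longrightarrow> perm_prod (map (conj_by \<sigma>) ts) = conj_by \<sigma> (perm_prod ts)"
  by (induction ts) (auto simp: conj_by_comp)

lemma inv_prod_conj: "bij \<sigma> \<Longrightarrow> inv_prod (map (conj_by \<sigma>) ts) = conj_by \<sigma> (inv_prod ts)"
  by (induction ts) (auto simp: conj_by_comp)

lemma pos_conj: "bij \<sigma> \<Longrightarrow> pos (map (conj_by \<sigma>) ts) s (\<sigma> x) = \<sigma> (pos ts s x)"
  by (simp add: pos_def take_map inv_prod_conj conj_by_apply)

lemma map_conj_inv_cancel: "bij \<sigma> \<Longrightarrow> map (conj_by (inv \<sigma>)) (map (conj_by \<sigma>) ts) = ts"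
  by (simp add: conj_by_inv_cancel o_def)

lemma map_conj_inv_cancel': "bij \<sigma> \<Longrightarrow> map (conj_by \<sigma>) (map (conj_by (inv \<sigma>)) ts) = ts"
  by (simp add: conj_by_inv_cancel' o_def)

text \<open>A conjugator fixing 1 must send the k-th iterate of 1 under \<zeta> to k + 1, and by
  surjectivity these iterates exhaust {1..n}.\<close>

lemma relabelling_unique:
  assumes n: "1 \<le> n" and s: "\<sigma> permutes {1..n}" "\<sigma> 1 = 1" "conj_by \<sigma> \<zeta> = full_cycle n"
    and s': "\<sigma>' permutes {1..n}" "\<sigma>' 1 = 1" "conj_by \<sigma>' \<zeta> = full_cycle n"
  shows "\<sigma> = \<sigma>'"
proof -
  have b: "bij \<sigma>" "bij \<sigma>'" using s s' by (simp_all add: permutes_bij)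
  have key: "\<rho> ((\<zeta> ^^ k) 1) = Suc k"
    if "bij \<rho>" "\<rho> 1 = 1" "conj_by \<rho> \<zeta> = full_cycle n" "k < n" for \<rho> k
    using that(4)
  proof (induction k)
    case (Suc k)
    have "\<rho> (\<zeta> ((\<zeta> ^^ k) 1)) = full_cycle n (\<rho> ((\<zeta> ^^ k) 1))"
      using conj_by_apply[OF that(1)] that(3) by metis
    also have "\<dots> = Suc (Suc k)" using Suc full_cycle_simps(1)[OF n] by auto
    finally show ?case by simp
  qed (use that in auto)
  have eq: "\<sigma> y = \<sigma>' y" if "y \<in> {1..n}" for y
  proof -
    have "\<sigma> y \<in> {1..n}" using permutes_in_image[OF s(1)] that by blast
    then obtain k where k: "\<sigma> y = Suc k" "k < n" by (cases "\<sigma> y") auto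
    then have "\<sigma> y = \<sigma> ((\<zeta> ^^ k) 1)" using key[OF b(1) s(2,3)] by auto
    then have "y = (\<zeta> ^^ k) 1" using b by (metis bij_is_inj injD)
    then show ?thesis using key[OF b(1) s(2,3) k(2)] key[OF b(2) s'(2,3) k(2)] by simp
  qed
  show ?thesis using eq s s' by (metis ext permutes_not_in)
qed

lemma relabelling_eq:
  assumes "1 \<le> n" "\<sigma> permutes {1..n}" "\<sigma> 1 = 1" "conj_by \<sigma> \<zeta> = full_cycle n"
  shows "relabelling n \<zeta> = \<sigma>"
  unfolding relabelling_def
  by (rule the_equality) (use assms relabelling_unique in \<open>auto simp: conj_by_def\<close>)

lemma cycle_of_list_conj: "bij \<sigma> \<Longrightarrow> distinct cs \<Longrightarrow> conj_by \<sigma> (cycle_of_list cs) = cycle_of_list (map \<sigma> cs)"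
  by (simp add: conj_by_def conjugation_of_cycle)

lemma is_full_cycleI:
  assumes "\<sigma> permutes {1..n}" "conj_by \<sigma> \<zeta> = full_cycle n"
  shows "is_full_cycle n \<zeta>"
proof -
  have b: "bij \<sigma>" using assms permutes_bij by blast
  have "\<zeta> = conj_by (inv \<sigma>) (full_cycle n)" using assms b conj_by_inv_cancel by metis
  also have "\<dots> = cycle_of_list (map (inv \<sigma>) [1..<Suc n])"
    unfolding full_cycle_def using b by (intro cycle_of_list_conj) (auto simp: bij_imp_bij_inv)
  finally have eq: "\<zeta> = cycle_of_list (map (inv \<sigma>) [1..<Suc n])" .
  have "set (map (inv \<sigma>) [1..<Suc n]) = {1..n}"
    using permutes_image[OF permutes_inv[OF assms(1)]]
    by (simp only: set_map set_upt atLeastLessThanSuc_atLeastAtMost)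
  moreover have "distinct (map (inv \<sigma>) [1..<Suc n])"
    using permutes_inj_on[OF permutes_inv[OF assms(1)]] by (simp add: distinct_map del: upt_Suc)
  ultimately show ?thesis unfolding is_full_cycle_def using eq by blast
qed

lemma is_full_cycle_conj_ex:
  assumes "is_full_cycle n \<zeta>"
  obtains \<sigma> where "\<sigma> permutes {1..n}" "conj_by \<sigma> \<zeta> = full_cycle n"
proof -
  obtain cs where cs: "distinct cs" "set cs = {1..n}" "\<zeta> = cycle_of_list cs"
    using assms by (auto simp: is_full_cycle_def)
  have len: "length cs = n" using cs by (metis card_atLeastAtMost diff_Suc_1 distinct_card)
  define f where "f k = (if k \<in> {1..n} then cs ! (k - 1) else k)" for k
  have "bij_betw (\<lambda>k. cs ! (k - 1)) {1..n} {1..n}"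
  proof -
    have "bij_betw (\<lambda>k. k - 1) {1..n} {..<n}"
      by (rule bij_betw_byWitness[where f' = Suc]) auto
    moreover have "bij_betw ((!) cs) {..<n} {1..n}"
      using bij_betw_nth[OF cs(1), of "{..<n}" "{1..n}"] cs len by simp
    ultimately show ?thesis using bij_betw_trans[of "\<lambda>k. k - 1" _ _ "(!) cs"] by (simp add: o_def)
  qed
  then have "bij_betw f {1..n} {1..n}" using bij_betw_cong[of "{1..n}" f "\<lambda>k. cs ! (k - 1)"] by (simp add: f_def)
  then have f: "f permutes {1..n}" by (rule bij_imp_permutes) (auto simp: f_def)
  have "map f [1..<Suc n] = cs"
    by (rule nth_equalityI) (auto simp: f_def len simp del: upt_Suc)
  then have "conj_by f (full_cycle n) = \<zeta>"
    using f cs cycle_of_list_conj[of f "[1..<Suc n]"] by (simp add: full_cycle_def permutes_bij del: upt_Suc)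
  then have "conj_by (inv f) \<zeta> = full_cycle n" using conj_by_inv_cancel f permutes_bij by blast
  then show ?thesis using that f permutes_inv by blast
qed

lemma full_cycle_closed:
  assumes "1 \<le> n" "S \<subseteq> {1..n}" "S \<noteq> {}" "\<And>i. i \<in> S \<Longrightarrow> full_cycle n i \<in> S"
  shows "S = {1..n}"
proof -
  have up: "j \<in> S" if "i \<in> S" "i \<le> j" "j \<le> n" for i j
    using that(2,3)
  proof (induction j rule: dec_induct)
    case (step j)
    then show ?case using full_cycle_simps(1)[OF assms(1), of j] assms(2) assms(4)[of j] that(1) by fastforce
  qed (use that in auto)
  obtain i where i: "i \<in> S" using assms by auto
  then have "n \<in> S" using up[of i n] assms(2) by auto
  then have "1 \<in> S" using full_cycle_simps(2)[OF assms(1)] assms(4) by metis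
  then show ?thesis using up[of 1] assms(2) by auto
qed

text \<open>Transitivity as invariant sets. It refutes that a product is an n-cycle by exhibiting a
  proper invariant interval, and links n-cycles to the determinant criteria.\<close>

lemma is_full_cycle_closed:
  assumes "is_full_cycle n \<zeta>" "1 \<le> n" "S \<subseteq> {1..n}" "S \<noteq> {}" "\<And>i. i \<in> S \<Longrightarrow> \<zeta> i \<in> S"
  shows "S = {1..n}"
proof -
  obtain \<sigma> where s: "\<sigma> permutes {1..n}" "conj_by \<sigma> \<zeta> = full_cycle n"
    using is_full_cycle_conj_ex[OF assms(1)] .
  have "\<sigma> ` S \<subseteq> {1..n}" using assms(3) permutes_image[OF s(1)] by blast
  moreover have "full_cycle n i \<in> \<sigma> ` S" if "i \<in> \<sigma> ` S" for i
    using that assms(5) conj_by_apply[of \<sigma> \<zeta>] permutes_bij[OF s(1)] s(2) by auto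
  ultimately have "\<sigma> ` S = {1..n}"
    using full_cycle_closed[OF assms(2), of "\<sigma> ` S"] assms(4) by blast
  then show ?thesis
    by (metis inj_image_eq_iff permutes_image permutes_inj s(1))
qed

text \<open>Rotating the cycle makes any conjugation fix the point 1.\<close>

lemma is_full_cycle_relabelling:
  assumes "is_full_cycle n \<zeta>" "1 \<le> n"
  shows "relabelling n \<zeta> permutes {1..n}" "relabelling n \<zeta> 1 = 1"
    "conj_by (relabelling n \<zeta>) \<zeta> = full_cycle n"
proof -
  obtain \<sigma> where s: "\<sigma> permutes {1..n}" "conj_by \<sigma> \<zeta> = full_cycle n"
    using is_full_cycle_conj_ex[OF assms(1)] .
  have "\<sigma> 1 \<in> {1..n}" using permutes_in_image[OF s(1)] assms(2) by simp
  then obtain k where k: "\<sigma> 1 = Suc k" "k < n" by (cases "\<sigma> 1") auto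
  define \<rho> where "\<rho> = full_cycle n ^^ k"
  have rp: "\<rho> permutes {1..n}" unfolding \<rho>_def using full_cycle_permutes permutes_funpow by blast
  have r1: "\<rho> 1 = \<sigma> 1" using full_cycle_funpow[OF assms(2) k(2)] k by (simp add: \<rho>_def)
  have rc: "conj_by (inv \<rho>) (full_cycle n) = full_cycle n"
  proof -
    have "conj_by \<rho> (full_cycle n) = full_cycle n"
      using conj_by_eqI[OF permutes_bij[OF rp], of "full_cycle n" "full_cycle n"]
      by (simp add: \<rho>_def funpow_swap1)
    then show ?thesis using conj_by_inv_cancel rp permutes_bij by metis
  qed
  define \<tau> where "\<tau> = inv \<rho> \<circ> \<sigma>"
  have t: "\<tau> permutes {1..n}" "\<tau> 1 = 1" "conj_by \<tau> \<zeta> = full_cycle n"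
    unfolding \<tau>_def using permutes_compose[OF s(1) permutes_inv[OF rp]] r1 permutes_inv_eq[OF rp] rc s
      conj_by_conj_by[of "inv \<rho>" \<sigma> \<zeta>] permutes_bij[OF s(1)] permutes_bij[OF permutes_inv[OF rp]]
    by auto
  then have "relabelling n \<zeta> = \<tau>" using relabelling_eq assms(2) by blast
  then show "relabelling n \<zeta> permutes {1..n}" "relabelling n \<zeta> 1 = 1"
    "conj_by (relabelling n \<zeta>) \<zeta> = full_cycle n" using t by auto
qed

lemma relabel_eq: "relabel n ts = map (conj_by (relabelling n (perm_prod ts))) ts"
  by (simp add: relabel_def Let_def conj_by_def[abs_def])

lemma factorizations_inv_prod:
  assumes "ts \<in> factorizations n h" "2 \<le> x" "x \<le> n"
  shows "pos ts (length ts) x = x - 1"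
proof -
  have ts: "set ts \<subseteq> transp_on {1..n}" "perm_prod ts = full_cycle n"
    using assms by (auto simp: factorizations_def transpositions_eq)
  have "full_cycle n (x - 1) = x" using full_cycle_simps(1)[of n "x - 1"] assms by auto
  then have "inv_prod ts x = x - 1" using inv_prod_perm_prod[OF ts(1), of "x - 1"] ts(2) by simp
  then show ?thesis by (simp add: pos_ge_length)
qed

lemma finite_factorizations [simp]: "finite (factorizations n h)"
proof -
  have "factorizations n h \<subseteq> {ts. set ts \<subseteq> transp_on {1..n} \<and> length ts = n - 1 + 2 * h}"
    by (auto simp: factorizations_def transpositions_eq)
  then show ?thesis by (rule finite_subset) (simp add: finite_lists_length_eq)
qed

section \<open>Descents of positions\<close>

definition descents :: "(nat \<Rightarrow> nat) list \<Rightarrow> nat \<Rightarrow> nat set" where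
  "descents ts x = {s. s < length ts \<and> pos ts (Suc s) x < pos ts s x}"

text \<open>Vertex 1 is left out: it ends at position n, so no descent is forced on it.\<close>

definition special :: "nat \<Rightarrow> (nat \<Rightarrow> nat) list \<Rightarrow> nat set" where
  "special n ts = {x \<in> {2..n}. 2 \<le> card (descents ts x)}"

text \<open>The two additive inequalities express a displacement above L without truncated
  subtraction. Since 1 ends at position n, it is bad whenever n > L + 1.\<close>

definition bad :: "nat \<Rightarrow> nat \<Rightarrow> (nat \<Rightarrow> nat) list \<Rightarrow> nat set" where
  "bad n L ts = {x \<in> {1..n}. \<exists>s\<le>length ts. pos ts s x > x + L \<or> x > pos ts s x + L}"

lemma finite_descents [simp]: "finite (descents ts x)"
  by (simp add: descents_def)

lemma sum_card_descents:
  assumes "set ts \<subseteq> transp_on {1..n}"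
  shows "(\<Sum>x\<in>{1..n}. card (descents ts x)) = length ts"
proof -
  have one: "card {x \<in> {1..n}. pos ts (Suc s) x < pos ts s x} = 1" if s: "s < length ts" for s
  proof -
    have "ts ! s \<in> transp_on {1..n}" using s assms by (meson nth_mem subsetD)
    then obtain i j where ij: "i \<in> {1..n}" "j \<in> {1..n}" "i \<noteq> j" "ts ! s = tr i j"
      by (rule transp_onE)
    have ne: "pos ts s i \<noteq> pos ts s j"
      using permutes_inj[OF pos_permutes[OF assms]] ij(3) by (metis injD)
    have "{x \<in> {1..n}. pos ts (Suc s) x < pos ts s x} = {if pos ts s i < pos ts s j then j else i}"
      using ij ne s by (auto simp: pos_Suc Transposition.transpose_def split: if_splits)
    then show ?thesis by simp
  qed
  have "(\<Sum>x\<in>{1..n}. card (descents ts x)) =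
      (\<Sum>x\<in>{1..n}. \<Sum>s<length ts. if pos ts (Suc s) x < pos ts s x then 1 else 0)"
    by (intro sum.cong refl) (auto simp: descents_def sum.If_cases intro: arg_cong[of _ _ card])
  also have "\<dots> = (\<Sum>s<length ts. \<Sum>x\<in>{1..n}. if pos ts (Suc s) x < pos ts s x then 1 else 0)"
    by (rule sum.swap)
  also have "\<dots> = (\<Sum>s<length ts. card {x \<in> {1..n}. pos ts (Suc s) x < pos ts s x})"
    by (intro sum.cong refl) (auto simp: sum.If_cases Int_def intro: arg_cong[of _ _ card])
  also have "\<dots> = length ts" using one by simp
  finally show ?thesis .
qed

lemma step_mono:
  fixes f :: "nat \<Rightarrow> nat"
  assumes "\<And>s. l \<le> s \<Longrightarrow> s < u \<Longrightarrow> f s \<le> f (Suc s)" "l \<le> s" "s \<le> s'" "s' \<le> u"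
  shows "f s \<le> f s'"
  using assms(3,4)
proof (induction s' rule: dec_induct)
  case (step k)
  then show ?case using assms(1)[of k] assms(2) by fastforce
qed simp

lemma descents_nonempty:
  assumes "ts \<in> factorizations n h" "x \<in> {2..n}"
  shows "descents ts x \<noteq> {}"
proof
  assume e: "descents ts x = {}"
  have "pos ts 0 x \<le> pos ts (length ts) x"
    by (rule step_mono[of 0 "length ts" "\<lambda>s. pos ts s x"]) (use e in \<open>auto simp: descents_def\<close>)
  then show False using factorizations_inv_prod[OF assms(1), of x] assms(2) by auto
qed

text \<open>Every step produces exactly one descent, and each vertex other than 1 needs one to move from
  \<open>x\<close> to \<open>x - 1\<close>; the excess is the analogue of the number of trisections of a unicellular map.\<close>

lemma card_special:
  assumes "ts \<in> factorizations n h" "1 \<le> n"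
  shows "card (special n ts) \<le> 2 * h"
proof -
  have ts: "set ts \<subseteq> transp_on {1..n}" "length ts = n - 1 + 2 * h"
    using assms by (auto simp: factorizations_def transpositions_eq)
  have "n - 1 + card (special n ts) = (\<Sum>x\<in>{2..n}. 1 + (if x \<in> special n ts then 1 else 0))"
    by (simp only: sum.distrib) (auto simp: sum.If_cases special_def intro: arg_cong[of _ _ card])
  also have "\<dots> \<le> (\<Sum>x\<in>{2..n}. card (descents ts x))"
  proof (rule sum_mono)
    fix x assume x: "x \<in> {2..n}"
    have "1 \<le> card (descents ts x)" using descents_nonempty[OF assms(1) x] by (simp add: Suc_le_eq card_gt_0_iff)
    then show "1 + (if x \<in> special n ts then 1 else 0) \<le> card (descents ts x)"
      by (auto simp: special_def)
  qed
  also have "\<dots> \<le> (\<Sum>x\<in>{1..n}. card (descents ts x))"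
    by (rule sum_mono2) auto
  also have "\<dots> = n - 1 + 2 * h" using sum_card_descents ts by simp
  finally show ?thesis by simp
qed

text \<open>The trajectory of a vertex that is not special consists of two nondecreasing runs.
  \<open>signature\<close> follows such a trajectory through the insertion;
  \<open>special_res\<close> shows that this shape is lost afterwards.\<close>

lemma one_descent:
  assumes "ts \<in> factorizations n h" "x \<in> {2..n}" "x \<notin> special n ts"
  obtains d where "d < length ts"
    "\<And>s s'. s \<le> s' \<Longrightarrow> s' \<le> d \<Longrightarrow> pos ts s x \<le> pos ts s' x"
    "\<And>s s'. d < s \<Longrightarrow> s \<le> s' \<Longrightarrow> s' \<le> length ts \<Longrightarrow> pos ts s x \<le> pos ts s' x"
proof -
  have "1 \<le> card (descents ts x)" using descents_nonempty[OF assms(1,2)] by (simp add: Suc_le_eq card_gt_0_iff)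
  then have "card (descents ts x) = 1" using assms by (auto simp: special_def)
  then obtain d where d: "descents ts x = {d}" by (auto simp: card_1_singleton_iff)
  have dl: "d < length ts" using d by (auto simp: descents_def)
  have st: "pos ts s x \<le> pos ts (Suc s) x" if "s < length ts" "s \<noteq> d" for s
    using d that by (force simp: descents_def)
  show ?thesis
  proof (rule that[OF dl])
    show "pos ts s x \<le> pos ts s' x" if "s \<le> s'" "s' \<le> d" for s s'
      by (rule step_mono[of 0 d "\<lambda>s. pos ts s x"]) (use st dl that in auto)
    show "pos ts s x \<le> pos ts s' x" if "d < s" "s \<le> s'" "s' \<le> length ts" for s s'
      by (rule step_mono[of "Suc d" "length ts" "\<lambda>s. pos ts s x"]) (use st dl that in auto)
  qed
qed

section \<open>Positions after the insertion of two transpositions\<close>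

lemma transpose_conj_perm: "inj f \<Longrightarrow> f (tr i j x) = tr (f i) (f j) (f x)"
  by (auto simp: Transposition.transpose_def inj_eq)

text \<open>Moved to the left through the position map, an inserted transposition becomes a chord
  joining the current positions of its endpoints. Here e = v - 1 and r = w - 2 are the numbers of
  old factors preceding the two new ones.\<close>

lemma pos_insert_two:
  fixes e r :: nat
  assumes ts: "set ts \<subseteq> transp_on S" and er: "e \<le> r" "r \<le> length ts"
  shows "pos (insert_two (Suc e) (r + 2) (tr a y) (tr a z) ts) s x =
    (if s \<le> e then pos ts s x
     else if s \<le> Suc r then tr (pos ts e a) (pos ts e y) (pos ts (s - 1) x)
     else tr (pos ts e a) (pos ts e y)
           (tr (pos ts r a) (pos ts r z) (pos ts (s - 2) x)))"
proof -
  let ?X = "tr a y" and ?Y = "tr a z"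
  have F: "insert_two (Suc e) (r + 2) ?X ?Y ts = take e ts @ [?X] @ take (r - e) (drop e ts) @ [?Y] @ drop r ts"
    by (simp add: insert_two_def)
  have inj: "inj (pos ts k)" for k using permutes_inj[OF pos_permutes[OF ts]] .
  have split: "pos ts (k + l) u = pos ts k (inv_prod (take l (drop k ts)) u)" for k l u
    by (simp add: pos_def take_add inv_prod_append)
  consider "s \<le> e" | "e < s" "s \<le> Suc r" | "Suc r < s" by linarith
  then show ?thesis
  proof cases
    case 1
    then have "take s (take e ts @ [?X] @ take (r - e) (drop e ts) @ [?Y] @ drop r ts) = take s ts"
      using er by simp
    then show ?thesis using 1 unfolding F pos_def by simp
  next
    case 2
    define k where "k = s - 1 - e"
    have k: "s = Suc e + k" "k \<le> r - e" using 2 by (simp_all add: k_def)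
    have "e \<le> length ts" "k + e \<le> length ts" "k \<le> r - e" using k er by simp_all
    then have le: "take s (take e ts) = take e ts" "s - length (take e ts) = Suc k"
      "k - length (take (r - e) (drop e ts)) = 0" "take k (take (r - e) (drop e ts)) = take k (drop e ts)"
      by (simp_all add: k(1))
    have "take s (take e ts @ [?X] @ take (r - e) (drop e ts) @ [?Y] @ drop r ts) =
        take e ts @ [?X] @ take (s - 1 - e) (drop e ts)"
      by (simp only: take_append le append_Cons append_Nil take_Suc_Cons take_0 append_Nil2 k_def[symmetric])
    then have "pos (insert_two (Suc e) (r + 2) ?X ?Y ts) s x =
        pos ts e (?X (inv_prod (take (s - 1 - e) (drop e ts)) x))"
      by (simp only: F pos_def) (simp only: inv_prod_append inv_prod.simps comp_apply id_apply)
    also have "\<dots> = tr (pos ts e a) (pos ts e y) (pos ts (s - 1) x)"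
      using split[of e "s - 1 - e" x] 2 by (simp add: transpose_conj_perm[OF inj])
    finally show ?thesis using 2 by simp
  next
    case 3
    then obtain k where k: "s = r + 2 + k" by (metis Suc_leI add_2_eq_Suc' add_Suc_right le_Suc_ex)
    have sr: "pos ts e (inv_prod (take (r - e) (drop e ts)) u) = pos ts r u" for u
      using split[of e "r - e" u] er by simp
    let ?P = "take e ts @ [?X] @ take (r - e) (drop e ts) @ [?Y]"
    have len: "length ?P = r + 2" using er by simp
    have "take s ?P = ?P" by (rule take_all) (simp only: len k)
    moreover have "s - length ?P = k" by (simp only: len k add_diff_cancel_left')
    ultimately have "take s (?P @ drop r ts) = ?P @ take k (drop r ts)"
      by (simp only: take_append[of s ?P "drop r ts"])
    then have "take s (take e ts @ [?X] @ take (r - e) (drop e ts) @ [?Y] @ drop r ts) =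
        take e ts @ [?X] @ take (r - e) (drop e ts) @ [?Y] @ take k (drop r ts)"
      by (simp only: append.assoc)
    then have "pos (insert_two (Suc e) (r + 2) ?X ?Y ts) s x =
        pos ts e (?X (inv_prod (take (r - e) (drop e ts)) (?Y (inv_prod (take k (drop r ts)) x))))"
      by (simp only: F pos_def) (simp only: inv_prod_append inv_prod.simps comp_apply id_apply)
    also have "\<dots> = tr (pos ts e a) (pos ts e y)
        (pos ts r (?Y (inv_prod (take k (drop r ts)) x)))"
      by (simp only: transpose_conj_perm[OF inj] sr)
    also have "\<dots> = tr (pos ts e a) (pos ts e y)
           (tr (pos ts r a) (pos ts r z) (pos ts (r + k) x))"
      using split[of r k x] by (simp add: transpose_conj_perm[OF inj])
    finally show ?thesis using 3 k er by simp
  qed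
qed

lemma length_insert_two: "e \<le> r \<Longrightarrow> r \<le> length ts \<Longrightarrow> length (insert_two (Suc e) (r + 2) x y ts) = length ts + 2"
  by (simp add: insert_two_def)

lemma set_insert_two: "e \<le> r \<Longrightarrow> r \<le> length ts \<Longrightarrow> set (insert_two (Suc e) (r + 2) x y ts) \<subseteq> {x, y} \<union> set ts"
  by (auto simp: insert_two_def dest: in_set_takeD in_set_dropD)

text \<open>\<open>pos_insert_two\<close> at the final time gives the inverse of this product; the
  chords are involutions, so inverting reverses their order.\<close>

lemma perm_prod_insert_two:
  assumes ts: "set ts \<subseteq> transp_on S" and er: "e \<le> r" "r \<le> length ts" and S: "a \<in> S" "y \<in> S" "z \<in> S" "a \<noteq> y" "a \<noteq> z"
  shows "perm_prod (insert_two (Suc e) (r + 2) (tr a y) (tr a z) ts) =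
    perm_prod ts \<circ> tr (pos ts r a) (pos ts r z) \<circ> tr (pos ts e a) (pos ts e y)"
    (is "perm_prod ?F = ?R")
proof
  fix u
  have F: "set ?F \<subseteq> transp_on S"
    using set_insert_two[OF er] ts S by (blast intro: transp_onI)
  have "perm_prod ?F (pos ?F (length ?F) (perm_prod ts v)) = perm_prod ts v" for v
    by (simp only: pos_ge_length[OF order_refl] perm_prod_inv_prod[OF F])
  then have "perm_prod ?F (tr (pos ts e a) (pos ts e y)
      (tr (pos ts r a) (pos ts r z) v)) = perm_prod ts v" for v
  proof -
    have "pos ?F (length ?F) (perm_prod ts v) = tr (pos ts e a) (pos ts e y)
      (tr (pos ts r a) (pos ts r z) v)" for v
      using er unfolding length_insert_two[OF er] pos_insert_two[OF ts er]
      by (simp add: pos_ge_length inv_prod_perm_prod[OF ts])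
    with \<open>\<And>v. perm_prod ?F (pos ?F (length ?F) (perm_prod ts v)) = perm_prod ts v\<close>
    show ?thesis by metis
  qed
  from this[of "tr (pos ts r a) (pos ts r z) (tr (pos ts e a) (pos ts e y) u)"]
  show "perm_prod ?F u = ?R u" by simp
qed

text \<open>With chords at the cut points \<open>x1 \<le> x2 < x3 < x4\<close>, the new cycle runs through the arcs
  \<open>[1, x1]\<close>, \<open>(x3, x4]\<close>, \<open>(x2, x3]\<close>, \<open>(x1, x2]\<close>, \<open>(x4, n]\<close> in this order; \<open>block_swap\<close> is the
  resulting relabelling.\<close>

definition block_swap :: "nat \<Rightarrow> nat \<Rightarrow> nat \<Rightarrow> nat \<Rightarrow> nat \<Rightarrow> nat" where
  "block_swap x1 x2 x3 x4 i =
     (if i \<le> x1 \<or> x4 < i then i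
      else if i \<le> x2 then i + (x4 - x2)
      else if i \<le> x3 then i - x2 + (x1 + (x4 - x3))
      else i - x3 + x1)"

lemma block_swap_simps:
  assumes "x1 \<le> x2" "x2 \<le> x3" "x3 \<le> x4"
  shows "i \<le> x1 \<Longrightarrow> block_swap x1 x2 x3 x4 i = i"
    "x1 < i \<Longrightarrow> i \<le> x2 \<Longrightarrow> block_swap x1 x2 x3 x4 i + x2 = i + x4"
    "x2 < i \<Longrightarrow> i \<le> x3 \<Longrightarrow> block_swap x1 x2 x3 x4 i + x2 + x3 = i + x1 + x4"
    "x3 < i \<Longrightarrow> i \<le> x4 \<Longrightarrow> block_swap x1 x2 x3 x4 i + x3 = i + x1"
    "x4 < i \<Longrightarrow> block_swap x1 x2 x3 x4 i = i"
  using assms by (auto simp: block_swap_def)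

lemma block_swap_cases:
  assumes "x1 \<le> x2" "x2 \<le> x3" "x3 \<le> x4"
  obtains "i \<le> x1" "block_swap x1 x2 x3 x4 i = i"
  | "x1 < i" "i \<le> x2" "block_swap x1 x2 x3 x4 i + x2 = i + x4"
  | "x2 < i" "i \<le> x3" "block_swap x1 x2 x3 x4 i + x2 + x3 = i + x1 + x4"
  | "x3 < i" "i \<le> x4" "block_swap x1 x2 x3 x4 i + x3 = i + x1"
  | "x4 < i" "block_swap x1 x2 x3 x4 i = i"
proof -
  consider "i \<le> x1" | "x1 < i" "i \<le> x2" | "x2 < i" "i \<le> x3" | "x3 < i" "i \<le> x4" | "x4 < i"
    by linarith
  then show ?thesis by cases (use that block_swap_simps[OF assms, of i] in blast)+
qed

lemma block_swap_permutes:
  assumes "1 \<le> x1" "x1 \<le> x2" "x2 \<le> x3" "x3 \<le> x4" "x4 \<le> n"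
  shows "block_swap x1 x2 x3 x4 permutes {1..n}"
proof (rule inj_imp_permutes)
  show "inj_on (block_swap x1 x2 x3 x4) {1..n}"
  proof (rule inj_onI)
    fix i j assume eq: "block_swap x1 x2 x3 x4 i = block_swap x1 x2 x3 x4 j"
    show "i = j"
      by (rule block_swap_cases[OF assms(2-4), of i]; rule block_swap_cases[OF assms(2-4), of j])
        (use eq assms in linarith)+
  qed
  fix i assume "i \<in> {1..n}"
  then show "block_swap x1 x2 x3 x4 i \<in> {1..n}"
    by (rule_tac block_swap_cases[OF assms(2-4), of i]) (use assms in auto)
next
  fix i assume "i \<notin> {1..n}"
  then show "block_swap x1 x2 x3 x4 i = i" using assms by (auto simp: block_swap_def)
qed simp

text \<open>Away from the four cut points both chords act trivially and \<open>block_swap\<close> is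
  a translation on each arc, so only the passages from one arc to the next need checking.\<close>

lemma block_swap_conj:
  assumes x: "1 \<le> x1" "x1 \<le> x2" "x2 < x3" "x3 < x4" "x4 \<le> n"
  shows "conj_by (block_swap x1 x2 x3 x4)
     (full_cycle n \<circ> tr x2 x4 \<circ> tr x1 x3) = full_cycle n"
proof (rule conj_by_eqI)
  show "bij (block_swap x1 x2 x3 x4)"
    using block_swap_permutes[of x1 x2 x3 x4 n] x permutes_bij by auto
  fix i
  let ?s = "block_swap x1 x2 x3 x4"
  let ?z = "tr x2 x4 (tr x1 x3 i)"
  have n: "1 \<le> n" using x by simp
  note fc = full_cycle_simps[OF n]
  note le = x(2) less_imp_le[OF x(3)] less_imp_le[OF x(4)]
  note bs = block_swap_simps[OF le]
  have fc': "full_cycle n k = (if 1 \<le> k \<and> k < n then Suc k else if k = n then 1 else k)" for k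
    using fc by (auto simp: not_less)
  consider "i = x1" | "i = x2" "x1 < x2" | "i = x3" | "i = x4" | "i \<notin> {x1, x2, x3, x4}" using x by force
  then have "full_cycle n (?s i) = ?s (full_cycle n ?z)"
  proof cases
    case 1
    then have z: "?z = x3" using x by (auto simp: Transposition.transpose_def)
    show ?thesis unfolding z using 1 bs(1)[of x1] bs(4)[of "Suc x3"] x by (auto simp: fc')
  next
    case 2
    then have z: "?z = x4" using x by (auto simp: Transposition.transpose_def)
    have s2: "?s i = x4" using 2 bs(2)[of x2] by simp
    show ?thesis unfolding z s2 using 2 bs(5)[of "Suc x4"] bs(1)[of 1] x by (auto simp: fc')
  next
    case 3
    show ?thesis
    \<comment> \<open>If x1 = x2, the arc (x1, x2] is empty, the chords share an endpoint, and x3 is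
      sent on to x4.\<close>
    proof (cases "x1 = x2")
      case True
      then have z: "?z = x4" using 3 x by (auto simp: Transposition.transpose_def)
      have s2: "?s i = x4" using 3 bs(3)[of x3] x True by simp
      show ?thesis unfolding z s2 using bs(5)[of "Suc x4"] bs(1)[of 1] x by (auto simp: fc')
    next
      case False
      then have z: "?z = x1" using 3 x by (auto simp: Transposition.transpose_def)
      show ?thesis unfolding z using 3 bs(3)[of x3] bs(2)[of "Suc x1"] x False by (auto simp: fc')
    qed
  next
    case 4
    then have z: "?z = x2" using x by (auto simp: Transposition.transpose_def)
    show ?thesis unfolding z using 4 bs(4)[of x4] bs(3)[of "Suc x2"] x by (auto simp: fc')
  next
    case 5
    then have z: "?z = i" by (auto simp: Transposition.transpose_def)
    show ?thesis
    proof (cases "1 \<le> i \<and> i < n")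
      case True
      have i: "full_cycle n i = Suc i" using True by (simp add: fc')
      have "?s (Suc i) = Suc (?s i)"
        by (rule block_swap_cases[OF le, of i]; rule block_swap_cases[OF le, of "Suc i"])
          (use 5 x in auto)
      moreover have "1 \<le> ?s i \<and> ?s i < n"
        by (rule block_swap_cases[OF le, of i]) (use 5 x True in auto)
      ultimately show ?thesis unfolding z i by (simp add: fc')
    next
      case False
      then have "?s i = i" "i = n \<or> i = 0 \<or> i > n" using x 5 bs(5)[of i] bs(1)[of i] by auto
      then show ?thesis unfolding z using bs(1)[of 1] bs(5)[of i] bs(1)[of i] x 5 by (auto simp: fc')
    qed
  qed
  then show "full_cycle n (?s i) = ?s ((full_cycle n \<circ> tr x2 x4 \<circ> tr x1 x3) i)"
    by simp
qed

section \<open>Clean insertions\<close>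

text \<open>e and r count the old factors before the two insertions. Positions of a, b, c stay
  within L of these vertices, so gaps above 2L keep them in the order a, b, c even when compared at
  different times.\<close>

locale clean_insertion =
  fixes n h L e r a b c :: nat and ts :: "(nat \<Rightarrow> nat) list"
  assumes fact: "ts \<in> factorizations n h"
    and er: "e \<le> r" "r \<le> length ts"
    and abc: "1 \<le> a" "a + 2 * L < b" "b + 2 * L < c" "c \<le> n"
    and good: "a \<notin> bad n L ts" "b \<notin> bad n L ts" "c \<notin> bad n L ts"
    and nonspecial: "a \<notin> special n ts"
begin

text \<open>Which insertion succeeds depends on whether a lies lower at the second insertion time
  than at the first. If so, (a c) is inserted first, otherwise (a b).\<close>

definition swapped :: bool where "swapped \<longleftrightarrow> pos ts r a < pos ts e a"

definition y1 :: nat where "y1 = (if swapped then c else b)"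
definition y2 :: nat where "y2 = (if swapped then b else c)"
text \<open>The cut points in increasing order: two positions of a, one of b, one of c. In both
  cases the chords join x1 to x3 and x2 to x4.\<close>

definition x1 :: nat where "x1 = min (pos ts e a) (pos ts r a)"
definition x2 :: nat where "x2 = max (pos ts e a) (pos ts r a)"
definition x3 :: nat where "x3 = (if swapped then pos ts r b else pos ts e b)"
definition x4 :: nat where "x4 = (if swapped then pos ts e c else pos ts r c)"

definition ins :: "(nat \<Rightarrow> nat) list" where
  "ins = insert_two (Suc e) (r + 2) (tr a y1) (tr a y2) ts"

definition sg :: "nat \<Rightarrow> nat" where "sg = block_swap x1 x2 x3 x4"

definition res :: "(nat \<Rightarrow> nat) list" where "res = map (conj_by sg) ins"

lemma ts: "set ts \<subseteq> transp_on {1..n}" "length ts = n - 1 + 2 * h" "perm_prod ts = full_cycle n"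
  using fact by (auto simp: factorizations_def transpositions_eq)

lemma n_pos: "1 \<le> n" using abc by simp

lemma near:
  assumes "y \<notin> bad n L ts" "1 \<le> y" "y \<le> n" "s \<le> length ts"
  shows "y \<le> pos ts s y + L" "pos ts s y \<le> y + L"
  using assms by (auto simp: bad_def)

lemma near_abc:
  assumes "s \<le> length ts"
  shows "a \<le> pos ts s a + L" "pos ts s a \<le> a + L" "b \<le> pos ts s b + L" "pos ts s b \<le> b + L"
    "c \<le> pos ts s c + L" "pos ts s c \<le> c + L"
  using near[OF good(1)] near[OF good(2)] near[OF good(3)] abc assms by auto

lemma pos_range: "1 \<le> y \<Longrightarrow> y \<le> n \<Longrightarrow> 1 \<le> pos ts s y \<and> pos ts s y \<le> n"
  using permutes_in_image[OF pos_permutes[OF ts(1)], of s y] by simp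

lemma e_le: "e \<le> length ts" using er by simp

lemma x_order: "1 \<le> x1" "x1 \<le> x2" "x2 < x3" "x3 < x4" "x4 \<le> n" "x2 + 2 * L < x4"
proof -
  note na = near_abc[OF e_le] near_abc[OF er(2)]
  show "1 \<le> x1" using pos_range[of a] abc by (auto simp: x1_def)
  show "x1 \<le> x2" by (simp add: x1_def x2_def)
  show "x2 < x3" "x3 < x4" "x2 + 2 * L < x4" using na abc by (auto simp: x2_def x3_def x4_def)
  show "x4 \<le> n" using pos_range[of c] abc by (auto simp: x4_def)
qed

lemmas sgs = block_swap_simps[OF x_order(2) less_imp_le[OF x_order(3)] less_imp_le[OF x_order(4)], folded sg_def]

text \<open>Vertex 1 ends at position n, which lies beyond c and hence more than L above a, so a = 1
  would be bad.\<close>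

lemma a_ge: "2 \<le> a"
proof (rule ccontr)
  assume "\<not> 2 \<le> a"
  then have a: "a = 1" using abc by simp
  have "full_cycle n n = 1" using full_cycle_simps(2) n_pos by blast
  then have "inv_prod ts 1 = n" using inv_prod_perm_prod[OF ts(1), of n] ts(3) by simp
  then have "pos ts (length ts) a = n" by (simp add: a pos_ge_length)
  then show False using near_abc(2)[of "length ts"] abc by simp
qed

lemma sg_permutes: "sg permutes {1..n}"
  unfolding sg_def using block_swap_permutes x_order by simp

lemma sg_bij: "bij sg" using sg_permutes permutes_bij by blast

lemma sg_1: "sg 1 = 1" using sgs(1)[of 1] x_order by simp

lemma y_props: "y1 \<in> {1..n}" "y2 \<in> {1..n}" "a \<in> {1..n}" "a \<noteq> y1" "a \<noteq> y2"
  using abc by (auto simp: y1_def y2_def)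

lemma perm_prod_ins: "perm_prod ins = full_cycle n \<circ> tr x2 x4 \<circ> tr x1 x3"
proof -
  have pp: "perm_prod ins = full_cycle n \<circ> tr (pos ts r a) (pos ts r y2)
      \<circ> tr (pos ts e a) (pos ts e y1)"
    unfolding ins_def ts(3)[symmetric] by (rule perm_prod_insert_two[OF ts(1) er]) (use y_props in auto)
  show ?thesis
  proof (cases swapped)
    case True
    then have eq: "pos ts r a = x1" "pos ts r y2 = x3" "pos ts e a = x2" "pos ts e y1 = x4" and lt: "x1 < x2"
      by (auto simp: swapped_def x1_def x2_def x3_def x4_def y1_def y2_def)
    \<comment> \<open>Here the chords come in the opposite order. They are disjoint because x1 < x2,
      hence they commute.\<close>
    show ?thesis unfolding pp eq using lt x_order by (auto simp: fun_eq_iff Transposition.transpose_def)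
  next
    case False
    then have eq: "pos ts r a = x2" "pos ts r y2 = x4" "pos ts e a = x1" "pos ts e y1 = x3"
      by (auto simp: swapped_def x1_def x2_def x3_def x4_def y1_def y2_def)
    show ?thesis unfolding pp eq by simp
  qed
qed

lemma conj_sg: "conj_by sg (perm_prod ins) = full_cycle n"
  unfolding perm_prod_ins sg_def by (rule block_swap_conj) (use x_order in auto)

lemma is_full_cycle_ins: "is_full_cycle n (perm_prod ins)"
  using is_full_cycleI[OF sg_permutes conj_sg] .

lemma relabelling_ins: "relabelling n (perm_prod ins) = sg"
  using relabelling_eq[OF n_pos sg_permutes sg_1 conj_sg] .

text \<open>The two chords cross in exactly one of the two orders of insertion.\<close>

lemma add_transpositions_eq:
  "add_transpositions n (Suc e, r + 2) (a, b, c) ts = Some ins"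
proof (cases swapped)
  case True
  then have "ins = insert_two (Suc e) (r + 2) (tr a c) (tr a b) ts"
    by (simp add: ins_def y1_def y2_def)
  then show ?thesis using is_full_cycle_ins by (simp add: add_transpositions_def Let_def del: add_2_eq_Suc')
next
  case False
  let ?F1 = "insert_two (Suc e) (r + 2) (tr a c) (tr a b) ts"
  have F2: "ins = insert_two (Suc e) (r + 2) (tr a b) (tr a c) ts"
    using False by (simp add: ins_def y1_def y2_def)
  define A1 A2 k1 k2 where "A1 = pos ts e a" "A2 = pos ts r a" "k1 = pos ts e c" "k2 = pos ts r b"
  note defs = A1_A2_k1_k2_def
  have ord: "1 \<le> A1" "A1 \<le> A2" "A2 < k2" "k2 < k1" "k1 \<le> n"
    using False near_abc[OF e_le] near_abc[OF er(2)] abc pos_range[of a e] pos_range[of c e]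
    unfolding defs swapped_def by auto
  have pp: "perm_prod ?F1 = full_cycle n \<circ> tr A2 k2 \<circ> tr A1 k1"
    unfolding ts(3)[symmetric] defs by (rule perm_prod_insert_two[OF ts(1) er]) (use abc in auto)
  have "\<not> is_full_cycle n (perm_prod ?F1)"
  proof
    assume fc: "is_full_cycle n (perm_prod ?F1)"
    \<comment> \<open>The chords of the other insertion are nested, A1 \<le> A2 < k2 < k1, so the
      interval (A2, k2] is invariant; it does not contain 1.\<close>
    have "{Suc A2..k2} = {1..n}"
    proof (rule is_full_cycle_closed[OF fc n_pos])
      fix i assume i: "i \<in> {Suc A2..k2}"
      show "perm_prod ?F1 i \<in> {Suc A2..k2}"
      proof (cases "i = k2")
        case True
        then have "tr A2 k2 (tr A1 k1 i) = A2"
          using ord by (auto simp: Transposition.transpose_def)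
        then show ?thesis unfolding pp using full_cycle_simps(1)[OF n_pos, of A2] ord by simp
      next
        case False
        then have "tr A2 k2 (tr A1 k1 i) = i"
          using ord i by (auto simp: Transposition.transpose_def)
        then show ?thesis unfolding pp using full_cycle_simps(1)[OF n_pos, of i] ord False i by simp
      qed
    qed (use ord in auto)
    then have "1 \<in> {Suc A2..k2}" using n_pos by simp
    then show False using ord by simp
  qed
  then show ?thesis using is_full_cycle_ins F2 by (simp add: add_transpositions_def Let_def del: add_2_eq_Suc')
qed

lemma relabel_ins: "relabel n ins = res"
  by (simp add: relabel_eq relabelling_ins res_def)

lemma ins_transp: "set ins \<subseteq> transp_on {1..n}" "length ins = length ts + 2"
proof -
  have "{tr a y1, tr a y2} \<subseteq> transp_on {1..n}"
    using y_props by (auto intro: transp_onI)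
  then show "set ins \<subseteq> transp_on {1..n}" using set_insert_two[OF er] ts(1) unfolding ins_def by blast
  show "length ins = length ts + 2" unfolding ins_def by (rule length_insert_two[OF er])
qed

lemma res_factorization: "res \<in> factorizations n (Suc h)"
proof -
  have "set res \<subseteq> transp_on {1..n}"
    using ins_transp(1) conj_by_transp_on[OF sg_bij, of _ "{1..n}"] permutes_image[OF sg_permutes]
    by (auto simp: res_def)
  then show ?thesis
    using conj_sg ins_transp(2) ts(2)
    by (simp add: factorizations_def transpositions_eq res_def perm_prod_conj[OF sg_bij])
qed

lemma length_res: "length res = length ts + 2"
  by (simp add: res_def ins_transp)

lemma pos_res: "pos res s (sg x) = sg (pos ins s x)"
  unfolding res_def by (rule pos_conj[OF sg_bij])

lemma pos_ins: "pos ins s x =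
    (if s \<le> e then pos ts s x
     else if s \<le> Suc r then tr (pos ts e a) (pos ts e y1) (pos ts (s - 1) x)
     else tr (pos ts e a) (pos ts e y1)
           (tr (pos ts r a) (pos ts r y2) (pos ts (s - 2) x)))"
  unfolding ins_def by (rule pos_insert_two[OF ts(1) er])

text \<open>A vertex farther than L from every cut point and not bad lies in the same arc as all its
  positions; there \<open>sg\<close> is a translation and preserves displacements. New bad vertices
  thus come from four windows of 2L + 1 points.\<close>

lemma card_bad_res: "card (bad n L res) \<le> card (bad n L ts) + 4 * (2 * L + 1)"
proof -
  let ?I = "\<lambda>x::nat. {x - L..x + L}"
  let ?B = "bad n L ts \<union> ?I x1 \<union> ?I x2 \<union> ?I x3 \<union> ?I x4"
  have cut: "{pos ts e a, pos ts e y1, pos ts r a, pos ts r y2} = {x1, x2, x3, x4}"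
    by (auto simp: x1_def x2_def x3_def x4_def y1_def y2_def swapped_def)
  have "bad n L res \<subseteq> sg ` ?B"
  proof
    fix y assume y: "y \<in> bad n L res"
    then obtain s where yn: "y \<in> {1..n}" and s: "s \<le> length res" "pos res s y > y + L \<or> y > pos res s y + L"
      by (auto simp: bad_def)
    obtain x where x: "y = sg x" using sg_bij by (metis bij_pointE)
    have xn: "x \<in> {1..n}" using yn permutes_in_image[OF sg_permutes] x by blast
    have "x \<in> ?B"
    proof (rule ccontr)
      assume nb: "x \<notin> ?B"
      have far: "x < x1 - L \<or> x1 + L < x" "x < x2 - L \<or> x2 + L < x" "x < x3 - L \<or> x3 + L < x" "x < x4 - L \<or> x4 + L < x"
        using nb by auto
      have nr: "x \<le> pos ts k x + L" "pos ts k x \<le> x + L" if "k \<le> length ts" for k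
        using near[of x k] nb xn that by auto
      have ne: "pos ts k x \<notin> {x1, x2, x3, x4}" if "k \<le> length ts" for k
        using nr[OF that] far by auto
      define k where "k = (if s \<le> e then s else if s \<le> Suc r then s - 1 else s - 2)"
      have k: "k \<le> length ts" using s er length_res by (auto simp: k_def)
      have "pos ins s x = pos ts k x"
        using ne[OF k] unfolding cut[symmetric] pos_ins k_def by (auto split: if_splits)
      then have ps: "pos res s y = sg (pos ts k x)" by (simp add: x pos_res)
      define q where "q = pos ts k x"
      have nq: "x \<le> q + L" "q \<le> x + L" using nr[OF k] by (simp_all add: q_def)
      have side: "x \<le> x1 \<longleftrightarrow> q \<le> x1" "x \<le> x2 \<longleftrightarrow> q \<le> x2" "x \<le> x3 \<longleftrightarrow> q \<le> x3" "x \<le> x4 \<longleftrightarrow> q \<le> x4"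
        using nq far by auto
      consider "x \<le> x1" | "x1 < x" "x \<le> x2" | "x2 < x" "x \<le> x3" | "x3 < x" "x \<le> x4" | "x4 < x"
        by linarith
      then have "sg q + x = sg x + q"
      proof cases
        case 1
        then show ?thesis using sgs(1)[of x] sgs(1)[of q] side by simp
      next
        case 2
        then show ?thesis using sgs(2)[of x] sgs(2)[of q] side by simp
      next
        case 3
        then show ?thesis using sgs(3)[of x] sgs(3)[of q] side by simp
      next
        case 4
        then show ?thesis using sgs(4)[of x] sgs(4)[of q] side by simp
      next
        case 5
        then show ?thesis using sgs(5)[of x] sgs(5)[of q] side by simp
      qed
      then have "sg (pos ts k x) + x = sg x + pos ts k x" by (simp add: q_def)
      then show False using s(2) nr[OF k] ps x by linarith
    qed
    then show "y \<in> sg ` ?B" using x by blast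
  qed
  moreover have fb: "finite (bad n L ts)" by (simp add: bad_def)
  ultimately have "card (bad n L res) \<le> card (sg ` ?B)" by (intro card_mono) auto
  also have "\<dots> \<le> card ?B" by (rule card_image_le) (use fb in simp)
  also have "\<dots> \<le> card (bad n L ts) + card (?I x1) + card (?I x2) + card (?I x3) + card (?I x4)"
    by (meson card_Un_le add_le_mono1 order_trans)
  also have "\<dots> \<le> card (bad n L ts) + 4 * (2 * L + 1)" by simp
  finally show ?thesis .
qed

text \<open>The times e and r + 1 of the inserted factors in \<open>res\<close>, named after the
  direction in which they move \<open>sg a\<close>.\<close>

definition up :: nat where "up = (if swapped then Suc r else e)"
definition down :: nat where "down = (if swapped then e else Suc r)"

text \<open>At \<open>up\<close> the vertex jumps from x1 = sg x1 to sg x3, a rise of x4 - x2 > 2L;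
  at \<open>down\<close> it falls from x4 to sg x4. Every other ascent is an old one, of length at
  most 2L. The old descent of a starts below sg x3 = x1 + x4 - x2, because a always stays below
  x3.\<close>

lemma signature:
  "pos res up (sg a) = x1" "pos res (Suc up) (sg a) + x2 = x1 + x4"
  "pos res down (sg a) = x4" "pos res (Suc down) (sg a) + x3 = x1 + x4"
  "\<And>s. s < length res \<Longrightarrow> s \<noteq> up \<Longrightarrow> s \<noteq> down \<Longrightarrow>
     pos res s (sg a) \<le> pos res (Suc s) (sg a) \<and> pos res (Suc s) (sg a) \<le> pos res s (sg a) + 2 * L
   \<or> pos res (Suc s) (sg a) < pos res s (sg a) \<and> pos res s (sg a) + x2 < x1 + x4"
proof -
  obtain d where d: "d < length ts"
    and m1: "\<And>s s'. s \<le> s' \<Longrightarrow> s' \<le> d \<Longrightarrow> pos ts s a \<le> pos ts s' a"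
    and m2: "\<And>s s'. d < s \<Longrightarrow> s \<le> s' \<Longrightarrow> s' \<le> length ts \<Longrightarrow> pos ts s a \<le> pos ts s' a"
    using one_descent[OF fact _ nonspecial] a_ge abc by auto
  \<comment> \<open>a starts at position a and ends at a - 1, so it is at or above a up to its only
    descent and below a afterwards.\<close>
  have ph1: "a \<le> pos ts s a" if "s \<le> d" for s using m1[of 0 s] that by simp
  have ph2: "pos ts s a < a" if "d < s" "s \<le> length ts" for s
    using m2[of s "length ts"] that factorizations_inv_prod[OF fact a_ge] abc a_ge by auto
  have lo: "a \<le> pos ts s a + L" "pos ts s a \<le> a + L" if "s \<le> length ts" for s
    using near_abc that by auto
  define p where "p s = pos ts s a" for s
  define P where "P s = pos res s (sg a)" for s
  define k1 k2 where "k1 = pos ts e y1" "k2 = pos ts r y2"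
  note kd = k1_k2_def
  have sw: "p r = x1 \<and> p e = x2 \<and> x1 < x2 \<and> k2 = x3 \<and> k1 = x4" if swapped
    using that by (auto simp: kd p_def swapped_def x1_def x2_def x3_def x4_def y1_def y2_def)
  have ns: "p e = x1 \<and> p r = x2 \<and> k1 = x3 \<and> k2 = x4" if "\<not> swapped"
    using that by (auto simp: kd p_def swapped_def x1_def x2_def x3_def x4_def y1_def y2_def)
  have px3: "p s < x3" if "s \<le> length ts" for s
    using near_abc[OF that] near_abc[OF e_le] near_abc[OF er(2)] abc by (auto simp: p_def x3_def)
  have Pe: "P s = sg (p s)" if "s \<le> e" for s
    using that by (simp add: P_def p_def pos_res pos_ins)
  \<comment> \<open>The chord inserted at time e displaces a only when its old position equals p e.
    The other endpoint k1 is x3 or x4, which a never reaches.\<close>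
  have Pm: "P (Suc s) = sg (if p s = p e then k1 else p s)" if "e \<le> s" "s \<le> r" for s
  proof -
    have "p s \<noteq> k1" using px3[of s] that er sw ns x_order by (cases swapped) auto
    then show ?thesis using that by (auto simp: P_def p_def pos_res pos_ins kd)
  qed
  have Pr: "P (Suc (Suc s)) = sg (if p s = p r then k2 else if p s = p e then k1 else p s)"
    if "r \<le> s" "s \<le> length ts" for s
  proof -
    have "p s \<noteq> k1" "p s \<noteq> k2" "k2 \<noteq> p e" "k2 \<noteq> k1" 
      using px3[of s] px3[of e] that er sw ns x_order by (cases swapped; auto)+
    then show ?thesis using that er by (auto simp: P_def p_def pos_res pos_ins kd)
  qed
  have sgk: "sg x3 + x2 = x1 + x4" "sg x4 + x3 = x1 + x4" "x1 < x2 \<Longrightarrow> sg x2 = x4" "x1 = x2 \<Longrightarrow> sg x3 = x4" "sg x1 = x1"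
    using sgs(3)[of x3] sgs(4)[of x4] sgs(2)[of x2] sgs(1)[of x1] x_order by auto
  note xo = x_order
  have seg1: "(if s \<le> d then a \<le> p s else p s < a)" if "s \<le> length ts" for s
    using ph1 ph2 that by (auto simp: p_def)
  have st: "p s \<le> p s'" if "s \<le> s'" "s' \<le> length ts" "s' \<le> d \<or> d < s" for s s'
    using m1 m2 that by (auto simp: p_def)
  have near': "p s' \<le> p s + 2 * L" if "s \<le> length ts" "s' \<le> length ts" for s s'
    using lo[of s] lo[of s'] that by (auto simp: p_def)
  let ?Q = "\<lambda>u w. u \<le> w \<and> w \<le> u + 2 * L \<or> w < u \<and> u + x2 < x1 + x4"
  have goal: "P up = x1 \<and> P (Suc up) + x2 = x1 + x4 \<and> P down = x4 \<and> P (Suc down) + x3 = x1 + x4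
     \<and> (\<forall>s. s < length res \<longrightarrow> s \<noteq> up \<longrightarrow> s \<noteq> down \<longrightarrow> ?Q (P s) (P (Suc s)))"
  proof (cases swapped)
    case True
    note s = sw[OF True]
    \<comment> \<open>A lower position at time r than at time e forces the only descent to lie
      between them.\<close>
    have d': "e \<le> d" "d < r"
      using seg1[of e] seg1[of r] st[of e r] er s by (auto split: if_splits)
    have A: "P s + x2 = p s + x4" if "s \<le> e" for s
      using Pe[of s] st[of s e] seg1[of s] seg1[of r] sgs(2)[of "p s"] that d' s er by (auto split: if_splits)
    have B: "P (Suc s) + x2 + x3 = p s + x1 + x4" if "e \<le> s" "s \<le> d" for s
      using Pm[of s] st[of e s] px3[of s] sgs(3)[of "p s"] that d' s er sgk xo by (auto split: if_splits)
    have C: "P (Suc s) = p s" "p s \<le> x1" if "d < s" "s \<le> r" for s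
      using Pm[of s] st[of s r] sgs(1)[of "p s"] that d' s er by (auto split: if_splits)
    have D: "P (Suc (Suc s)) + x2 = p s + x4" if "r \<le> s" "s \<le> length ts" for s
      using Pr[of s] st[of r s] seg1[of s] seg1[of e] sgs(2)[of "p s"] that d' s er sgk by (auto split: if_splits)
    have "?Q (P k) (P (Suc k))" if k: "k < length res" "k \<noteq> up" "k \<noteq> down" for k
    proof -
      have k': "k \<noteq> e" "k \<noteq> Suc r" using k True by (auto simp: up_def down_def)
      consider "k < e" | s where "k = Suc s" "e \<le> s" "Suc s \<le> d" | "k = Suc d" 
        | s where "k = Suc s" "d < s" "Suc s \<le> r" | s where "k = Suc (Suc s)" "r \<le> s" "Suc s \<le> length ts"
      proof -
        have "k < e \<or> (k = Suc (k - 1) \<and> e \<le> k - 1 \<and> Suc (k - 1) \<le> d) \<or> k = Suc d \<or> (k = Suc (k - 1) \<and> d < k - 1 \<and> Suc (k - 1) \<le> r)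
          \<or> (k = Suc (Suc (k - 2)) \<and> r \<le> k - 2 \<and> Suc (k - 2) \<le> length ts)"
          using k(1) k' length_res by linarith
        then show ?thesis using that by blast
      qed
      then show ?thesis
      proof cases
        case 1
        then show ?thesis using A[of k] A[of "Suc k"] st[of k "Suc k"] near'[of k "Suc k"] d' er by auto
      next
        case (2 s)
        then show ?thesis using B[of s] B[of "Suc s"] st[of s "Suc s"] near'[of s "Suc s"] d' er by auto
      next
        case 3
        then show ?thesis using B[of d] C[of "Suc d"] px3[of d] st[of e d] s d' er xo by auto
      next
        case (4 s)
        then show ?thesis using C[of s] C[of "Suc s"] st[of s "Suc s"] near'[of s "Suc s"] d' er by auto
      next
        case (5 s)
        then show ?thesis using D[of s] D[of "Suc s"] st[of s "Suc s"] near'[of s "Suc s"] d' er by auto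
      qed
    qed
    moreover have "P up = x1" "P (Suc up) + x2 = x1 + x4" "P down = x4" "P (Suc down) + x3 = x1 + x4"
      using True A[of e] B[of e] C[of r] D[of r] d' er s by (auto simp: up_def down_def)
    ultimately show ?thesis by blast
  next
    case False
    note s = ns[OF False]
    \<comment> \<open>A descent between e and r would put p e at or above a and p r below a,
      contrary to p e \<le> p r.\<close>
    have d': "d < e \<or> r \<le> d"
      using seg1[of e] seg1[of r] st[of e r] er s x_order by (auto split: if_splits)
    have B: "P (Suc s) + x2 = p s + x4" if "e \<le> s" "s \<le> r" for s
      using Pm[of s] st[of e s] st[of s r] sgs(2)[of "p s"] that d' s er sgk by (auto split: if_splits)
    have A1: "P s = p s" if "s \<le> e" "r \<le> d \<or> d < s" for s
      using Pe[of s] st[of s e] sgs(1)[of "p s"] that d' s er by auto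
    have A2: "P s + x2 + x3 = p s + x1 + x4" "x2 < p s" if "s \<le> e" "d < e" "s \<le> d" for s
      using Pe[of s] seg1[of s] seg1[of r] sgs(3)[of "p s"] px3[of s] that d' s er by (auto split: if_splits)
    have C1: "P (Suc (Suc s)) + x2 + x3 = p s + x1 + x4" if "r \<le> s" "s \<le> length ts" "d < e \<or> s \<le> d" for s
      using Pr[of s] st[of r s] sgs(3)[of "p s"] px3[of s] that d' s er sgk xo by (auto split: if_splits)
    have C2: "P (Suc (Suc s)) = p s" "p s < x1" if "r \<le> s" "s \<le> length ts" "r \<le> d" "d < s" for s
      using Pr[of s] seg1[of s] seg1[of e] sgs(1)[of "p s"] that d' s er xo by (auto split: if_splits)
    have "?Q (P k) (P (Suc k))" if k: "k < length res" "k \<noteq> up" "k \<noteq> down" for k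
    proof -
      have k': "k \<noteq> e" "k \<noteq> Suc r" using k False by (auto simp: up_def down_def)
      consider "k < e" | s where "k = Suc s" "e \<le> s" "Suc s \<le> r" | s where "k = Suc (Suc s)" "r \<le> s" "Suc s \<le> length ts"
      proof -
        have "k < e \<or> (k = Suc (k - 1) \<and> e \<le> k - 1 \<and> Suc (k - 1) \<le> r)
          \<or> (k = Suc (Suc (k - 2)) \<and> r \<le> k - 2 \<and> Suc (k - 2) \<le> length ts)"
          using k(1) k' length_res by linarith
        then show ?thesis using that by blast
      qed
      then show ?thesis
      proof cases
        case 1
        consider "r \<le> d \<or> d < k" | "d < e" "Suc k \<le> d" | "d < e" "k = d" using d' 1 by linarith
        then show ?thesis
        proof cases
          case 1
          then show ?thesis using A1[of k] A1[of "Suc k"] st[of k "Suc k"] near'[of k "Suc k"] \<open>k < e\<close> er by auto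
        next
          case 2
          then show ?thesis using A2[of k] A2[of "Suc k"] st[of k "Suc k"] near'[of k "Suc k"] \<open>k < e\<close> er by auto
        next
          case 3
          then show ?thesis using A2[of k] A1[of "Suc k"] seg1[of k] seg1[of "Suc k"] st[of "Suc k" e] px3[of k] s \<open>k < e\<close> er xo by auto
        qed
      next
        case (2 s)
        then show ?thesis using B[of s] B[of "Suc s"] st[of s "Suc s"] near'[of s "Suc s"] d' er by auto
      next
        case (3 t)
        consider "d < e \<or> Suc t \<le> d" | "r \<le> d" "d < t" | "r \<le> d" "t = d" using d' by linarith
        then show ?thesis
        proof cases
          case 1
          then show ?thesis using C1[of t] C1[of "Suc t"] st[of t "Suc t"] near'[of t "Suc t"] 3 er by auto
        next
          case 2
          then show ?thesis using C2[of t] C2[of "Suc t"] st[of t "Suc t"] near'[of t "Suc t"] 3 er by auto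
        next
          case c3: 3
          then show ?thesis using C1[of t] C2[of "Suc t"] st[of r t] px3[of t] 3 s er xo by auto
        qed
      qed
    qed
    moreover have "P up = x1"
      using False A1[of e] d' er s by (auto simp: up_def)
    moreover have "P (Suc up) + x2 = x1 + x4" "P down = x4" "P (Suc down) + x3 = x1 + x4"
      using False B[of e] B[of r] C1[of r] d' er s by (auto simp: up_def down_def)
    ultimately show ?thesis by blast
  qed
  then show "pos res up (sg a) = x1" "pos res (Suc up) (sg a) + x2 = x1 + x4"
    "pos res down (sg a) = x4" "pos res (Suc down) (sg a) + x3 = x1 + x4"
    "\<And>s. s < length res \<Longrightarrow> s \<noteq> up \<Longrightarrow> s \<noteq> down \<Longrightarrow> ?Q (pos res s (sg a)) (pos res (Suc s) (sg a))"
    unfolding P_def by blast+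
qed

lemma up_down: "up < length res" "down < length res" "(up = e \<and> down = Suc r) \<or> (up = Suc r \<and> down = e)"
  using er length_res by (auto simp: up_def down_def)

text \<open>This criterion and the next one mention only \<open>res\<close>, \<open>sg a\<close>, L
  and, for \<open>down\<close>, the time already found. So the insertion times can be read off
  without knowing the cut points.\<close>

lemma up_iff:
  assumes "s < length res"
  shows "pos res s (sg a) + 2 * L < pos res (Suc s) (sg a) \<longleftrightarrow> s = up"
  using signature(1-4) signature(5)[OF assms] x_order by (cases "s = up"; cases "s = down") auto

lemma down_iff:
  assumes "s < length res"
  shows "pos res (Suc s) (sg a) < pos res s (sg a) \<and> pos res (Suc up) (sg a) \<le> pos res s (sg a) \<longleftrightarrow> s = down"
  using signature(1-4) signature(5)[OF assms] x_order by (cases "s = up"; cases "s = down") auto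

text \<open>Otherwise \<open>down\<close> is the only descent. If \<open>up\<close> comes first,
  \<open>sg a\<close> is at most x1, which is below the position right after \<open>down\<close> and
  hence below the final position, although that is sg a - 1. If \<open>down\<close> comes first, the
  trajectory must fall to x1 again before \<open>up\<close>.\<close>

lemma special_res: "sg a \<in> special n res"
proof (rule ccontr)
  assume ns: "sg a \<notin> special n res"
  have "sg a \<in> {1..n}" using permutes_in_image[OF sg_permutes, of a] abc by simp
  moreover have "sg a \<noteq> 1" using sg_1 a_ge sg_bij by (metis bij_is_inj injD numeral_le_one_iff semiring_norm(69))
  ultimately have y: "sg a \<in> {2..n}" by auto
  obtain d where d: "d < length res"
    and m1: "\<And>s s'. s \<le> s' \<Longrightarrow> s' \<le> d \<Longrightarrow> pos res s (sg a) \<le> pos res s' (sg a)"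
    and m2: "\<And>s s'. d < s \<Longrightarrow> s \<le> s' \<Longrightarrow> s' \<le> length res \<Longrightarrow> pos res s (sg a) \<le> pos res s' (sg a)"
    using one_descent[OF res_factorization y ns] by blast
  have lt: "pos res up (sg a) < pos res (Suc down) (sg a)" "pos res (Suc down) (sg a) < pos res down (sg a)"
    using signature(1-4) x_order by auto
  have dd: "d = down"
    using m1[of down "Suc down"] m2[of down "Suc down"] lt(2) up_down(2) by (cases d down rule: linorder_cases) auto
  show False
  proof (cases "up < down")
    case True
    then show False
      using m1[of 0 up] m2[of "Suc down" "length res"] lt dd up_down(2) y
        factorizations_inv_prod[OF res_factorization, of "sg a"] by auto
  next
    case False
    then have "down < up" using up_down(3) er(1) by auto
    then show False using m2[of "Suc down" up] lt dd up_down(1) by auto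
  qed
qed

lemma recover:
  "map (conj_by sg) ts = take e res @ take (r - e) (drop (Suc e) res) @ drop (r + 2) res"
  "res ! e = conj_by sg (tr a y1)"
  "res ! Suc r = conj_by sg (tr a y2)"
proof -
  define A B C where "A = take e ts" "B = take (r - e) (drop e ts)" "C = drop r ts"
  have len: "length A = e" "length B = r - e" using er by (auto simp: A_B_C_def)
  have t: "ts = A @ B @ C"
    unfolding A_B_C_def using er by (metis append_take_drop_id drop_drop le_add_diff_inverse2)
  have i: "ins = A @ [tr a y1] @ B @ [tr a y2] @ C"
    by (simp add: ins_def insert_two_def A_B_C_def)
  define A' B' C' where "A' = map (conj_by sg) A" "B' = map (conj_by sg) B" "C' = map (conj_by sg) C"
  have len': "length A' = e" "length B' = r - e" using len by (simp_all add: A'_B'_C'_def)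
  have t': "map (conj_by sg) ts = A' @ B' @ C'"
    using arg_cong[OF t, of "map (conj_by sg)"] by (simp add: A'_B'_C'_def)
  have r': "res = A' @ [conj_by sg (tr a y1)] @ B' @ [conj_by sg (tr a y2)] @ C'"
    by (simp add: res_def i A'_B'_C'_def)
  have r: "Suc r = length A' + Suc (length B')" "r + 2 = length A' + Suc (Suc (length B'))" using len' er by auto
  show "map (conj_by sg) ts = take e res @ take (r - e) (drop (Suc e) res) @ drop (r + 2) res"
    unfolding t' r' r(2) using len' by simp
  show "res ! e = conj_by sg (tr a y1)"
    unfolding r' using len' by (simp add: nth_append)
  show "res ! Suc r = conj_by sg (tr a y2)"
    unfolding r' r(1) by (simp add: nth_append)
qed

text \<open>Deleting the inserted factors from \<open>res\<close> leaves the input relabelled by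
  \<open>sg\<close>. Normalising its product determines \<open>inv sg\<close>, so \<open>sg\<close>
  is recovered along with the input.\<close>

lemma relabelling_recover:
  "relabelling n (perm_prod (map (conj_by sg) ts)) = inv sg"
proof (rule relabelling_eq[OF n_pos])
  show "inv sg permutes {1..n}" using permutes_inv[OF sg_permutes] .
  show "inv sg 1 = 1" using sg_1 permutes_inv_eq[OF sg_permutes] by simp
  show "conj_by (inv sg) (perm_prod (map (conj_by sg) ts)) = full_cycle n"
    by (simp add: perm_prod_conj[OF sg_bij] conj_by_inv_cancel[OF sg_bij] ts(3))
qed

end

text \<open>The result and the relabelled vertex \<open>a\<close> determine the insertion times: they are the only
  large ascent of \<open>a\<close> and the only descent of \<open>a\<close> starting above the end of that ascent.\<close>

lemma clean_insertion_inj: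
  assumes A: "clean_insertion n h L e r a b c ts" and B: "clean_insertion n h L e' r' a' b' c' ts'"
    and res: "clean_insertion.res e r a b c ts = clean_insertion.res e' r' a' b' c' ts'"
    and sg: "clean_insertion.sg e r a b c ts a = clean_insertion.sg e' r' a' b' c' ts' a'"
  shows "e = e' \<and> r = r' \<and> a = a' \<and> b = b' \<and> c = c' \<and> ts = ts'"
proof -
  interpret A: clean_insertion n h L e r a b c ts by (rule A)
  interpret B: clean_insertion n h L e' r' a' b' c' ts' by (rule B)
  have up: "A.up = B.up"
    using A.up_iff[OF A.up_down(1)] B.up_iff[of A.up] A.up_down(1) unfolding res sg by blast
  have down: "A.down = B.down"
    using A.down_iff[OF A.up_down(2)] B.down_iff[of A.down] A.up_down(2) unfolding res sg up by blast
  have er: "e = e'" "r = r'"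
    using A.up_down(3) B.up_down(3) A.er B.er unfolding up down by auto
  have m: "map (conj_by A.sg) ts = map (conj_by B.sg) ts'"
    using A.recover(1)[unfolded res] B.recover(1) er by simp
  have inv: "inv A.sg = inv B.sg"
    using A.relabelling_recover B.relabelling_recover m by simp
  have s: "A.sg = B.sg" using inv by (metis A.sg_bij B.sg_bij inv_inv_eq)
  have a: "a = a'" using sg s A.sg_bij by (metis bij_is_inj injD)
  have ts: "ts = ts'"
    using m s map_conj_inv_cancel[OF A.sg_bij, of ts] map_conj_inv_cancel[OF A.sg_bij, of ts'] by simp
  have "tr a A.y1 = tr a B.y1"
  proof (rule conj_by_inj[OF A.sg_bij])
    have "conj_by A.sg (tr a A.y1) = conj_by B.sg (tr a' B.y1)"
      using A.recover(2)[unfolded res] B.recover(2) er by simp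
    then show "conj_by A.sg (tr a A.y1) = conj_by A.sg (tr a B.y1)"
      using s a by metis
  qed
  then have "A.y1 = B.y1" by (metis transpose_apply_first)
  moreover have "tr a A.y2 = tr a B.y2"
  proof (rule conj_by_inj[OF A.sg_bij])
    have "conj_by A.sg (tr a A.y2) = conj_by B.sg (tr a' B.y2)"
      using A.recover(3)[unfolded res] B.recover(3) er by simp
    then show "conj_by A.sg (tr a A.y2) = conj_by A.sg (tr a B.y2)"
      using s a by metis
  qed
  then have "A.y2 = B.y2" by (metis transpose_apply_first)
  moreover have "A.swapped = B.swapped" by (simp add: A.swapped_def B.swapped_def er a ts)
  ultimately have "b = b'" "c = c'" by (auto simp: A.y1_def A.y2_def B.y1_def B.y2_def split: if_splits)
  then show ?thesis using er a ts by simp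
qed

section \<open>Counting products of transpositions that are full cycles\<close>

text \<open>The Leibniz determinant with rows and columns indexed by a set of naturals. Matrices are
  functions of their row index, so replacing row k is the update \<open>A(k := u)\<close>.\<close>

definition ldet :: "nat set \<Rightarrow> (nat \<Rightarrow> nat \<Rightarrow> 'a) \<Rightarrow> 'a::comm_ring_1" where
  "ldet S A = (\<Sum>\<pi> | \<pi> permutes S. of_int (sign \<pi>) * (\<Prod>i\<in>S. A i (\<pi> i)))"

lemma ldet_row:
  assumes "finite S" "k \<in> S"
  shows "ldet S (A(k := u)) = (\<Sum>\<pi> | \<pi> permutes S. of_int (sign \<pi>) * (u (\<pi> k) * (\<Prod>i\<in>S - {k}. A i (\<pi> i))))"
proof -
  have "(\<Prod>i\<in>S. (A(k := u)) i (\<pi> i)) = u (\<pi> k) * (\<Prod>i\<in>S - {k}. A i (\<pi> i))" for \<pi> :: "nat \<Rightarrow> nat"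
  proof -
    have "(\<Prod>i\<in>S. (A(k := u)) i (\<pi> i)) = (A(k := u)) k (\<pi> k) * (\<Prod>i\<in>S - {k}. (A(k := u)) i (\<pi> i))"
      by (rule prod.remove[OF assms])
    also have "(\<Prod>i\<in>S - {k}. (A(k := u)) i (\<pi> i)) = (\<Prod>i\<in>S - {k}. A i (\<pi> i))"
      by (rule prod.cong) auto
    finally show ?thesis by simp
  qed
  then show ?thesis by (simp add: ldet_def)
qed

lemma ldet_row_sum:
  assumes "finite S" "k \<in> S"
  shows "ldet S (A(k := \<lambda>j. \<Sum>l\<in>I. u l j)) = (\<Sum>l\<in>I. ldet S (A(k := u l)))"
  unfolding ldet_row[OF assms] by (subst sum.swap) (simp add: sum_distrib_left sum_distrib_right)

lemma ldet_row_add: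
  assumes "finite S" "k \<in> S"
  shows "ldet S (A(k := \<lambda>j. u j + w j)) = ldet S (A(k := u)) + ldet S (A(k := w))"
  unfolding ldet_row[OF assms] by (simp add: algebra_simps sum.distrib)

lemma ldet_row_scale:
  assumes "finite S" "k \<in> S"
  shows "ldet S (A(k := \<lambda>j. c * u j)) = c * ldet S (A(k := u))"
  unfolding ldet_row[OF assms] by (simp add: algebra_simps sum_distrib_left)

lemma ldet_row_cong:
  assumes "finite S" "k \<in> S" "\<And>j. j \<in> S \<Longrightarrow> u j = w j"
  shows "ldet S (A(k := u)) = ldet S (A(k := w))"
  unfolding ldet_row[OF assms(1,2)] using assms(2,3) by (intro sum.cong refl) (simp add: permutes_in_image)

text \<open>Composing with the transposition of the two rows is a sign-reversing bijection of the
  summands, so the determinant equals its own negative; characteristic 0 finishes.\<close>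

lemma ldet_rows_eq:
  fixes A :: "nat \<Rightarrow> nat \<Rightarrow> 'a::{idom,ring_char_0}"
  assumes "finite S" "k \<in> S" "l \<in> S" "k \<noteq> l" "A k = A l"
  shows "ldet S A = 0"
proof -
  let ?t = "tr k l"
  have t: "?t permutes S" using assms by (simp add: permutes_swap_id)
  have "ldet S A = (\<Sum>\<pi> | \<pi> permutes S. of_int (sign (\<pi> \<circ> ?t)) * (\<Prod>i\<in>S. A i ((\<pi> \<circ> ?t) i)))"
    unfolding ldet_def by (rule sum.reindex_bij_witness[of _ "\<lambda>\<pi>. \<pi> \<circ> ?t" "\<lambda>\<pi>. \<pi> \<circ> ?t"])
      (auto simp: comp_assoc intro: permutes_compose[OF t])
  also have "\<dots> = (\<Sum>\<pi> | \<pi> permutes S. - (of_int (sign \<pi>) * (\<Prod>i\<in>S. A i (\<pi> i))))"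
  proof (rule sum.cong[OF refl])
    fix \<pi> assume "\<pi> \<in> {\<pi>. \<pi> permutes S}"
    then have s: "sign (\<pi> \<circ> ?t) = - sign \<pi>"
      using assms(1,4) t by (subst sign_compose) (auto simp: permutes_imp_permutation sign_swap_id)
    have "(\<Prod>i\<in>S. A i ((\<pi> \<circ> ?t) i)) = (\<Prod>i\<in>S. A (?t i) (\<pi> (?t i)))"
      using assms(5) by (intro prod.cong refl) (auto simp: Transposition.transpose_def)
    also have "\<dots> = (\<Prod>i\<in>S. A i (\<pi> i))"
      using prod.permute[OF t, of "\<lambda>i. A i (\<pi> i)"] by (simp add: o_def)
    finally show "of_int (sign (\<pi> \<circ> ?t)) * (\<Prod>i\<in>S. A i ((\<pi> \<circ> ?t) i)) = - (of_int (sign \<pi>) * (\<Prod>i\<in>S. A i (\<pi> i)))"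
      using s by simp
  qed
  also have "\<dots> = - ldet S A" by (simp add: ldet_def sum_negf)
  finally show ?thesis by (simp add: eq_neg_iff_add_eq_0 flip: mult_2)
qed

lemma pderiv_sum: "pderiv (\<Sum>i\<in>I. f i) = (\<Sum>i\<in>I. pderiv (f i))"
  by (induction I rule: infinite_finite_induct) (auto simp: pderiv_add)

lemma pderiv_of_int_mult: "pderiv (of_int c * p) = of_int c * pderiv (p :: real poly)"
  by (simp add: of_int_poly pderiv_smult)

lemma pderiv_ldet:
  fixes A :: "nat \<Rightarrow> nat \<Rightarrow> real poly"
  assumes "finite S"
  shows "pderiv (ldet S A) = (\<Sum>k\<in>S. ldet S (A(k := \<lambda>j. pderiv (A k j))))"
proof -
  have "pderiv (ldet S A) = (\<Sum>\<pi> | \<pi> permutes S. of_int (sign \<pi>) * (\<Sum>k\<in>S. (\<Prod>i\<in>S - {k}. A i (\<pi> i)) * pderiv (A k (\<pi> k))))"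
    by (simp only: ldet_def pderiv_sum pderiv_of_int_mult pderiv_prod)
  also have "\<dots> = (\<Sum>k\<in>S. \<Sum>\<pi> | \<pi> permutes S. of_int (sign \<pi>) * (pderiv (A k (\<pi> k)) * (\<Prod>i\<in>S - {k}. A i (\<pi> i))))"
    by (subst sum.swap) (simp add: sum_distrib_left mult.commute)
  also have "\<dots> = (\<Sum>k\<in>S. ldet S (A(k := \<lambda>j. pderiv (A k j))))"
    by (intro sum.cong refl) (simp add: ldet_row[OF assms])
  finally show ?thesis .
qed

lemma poly_ldet:
  fixes A :: "nat \<Rightarrow> nat \<Rightarrow> real poly"
  shows "poly (ldet S A) x = ldet S (\<lambda>i j. poly (A i j) x)"
  by (simp add: ldet_def poly_sum poly_prod)

definition unit_row :: "nat \<Rightarrow> nat \<Rightarrow> 'a::comm_ring_1" where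
  "unit_row v j = (if j = v then 1 else 0)"

definition char_row :: "(nat \<Rightarrow> nat) \<Rightarrow> nat \<Rightarrow> nat \<Rightarrow> real poly" where
  "char_row \<sigma> l j = unit_row l j - [:0, 1:] * unit_row (\<sigma> l) j"

text \<open>\<open>char_det S \<sigma>\<close> is \<open>det (1 - x P)\<close> for the permutation matrix \<open>P\<close> of \<open>\<sigma>\<close>, and
  \<open>red_det\<close> is its quotient by \<open>1 - x\<close>, the characteristic polynomial on the standard
  representation.\<close>

definition char_det :: "nat set \<Rightarrow> (nat \<Rightarrow> nat) \<Rightarrow> real poly" where
  "char_det S \<sigma> = ldet S (char_row \<sigma>)"

definition red_det :: "nat set \<Rightarrow> (nat \<Rightarrow> nat) \<Rightarrow> real poly" where
  "red_det S \<sigma> = ldet S ((char_row \<sigma>)((SOME i. i \<in> S) := \<lambda>_. 1))"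

lemma sum_char_row:
  assumes "finite S" "\<sigma> permutes S" "j \<in> S"
  shows "(\<Sum>l\<in>S. char_row \<sigma> l j) = [:1, -1:]"
proof -
  have "(\<Sum>l\<in>S. char_row \<sigma> l j) = (\<Sum>l\<in>S. unit_row l j) - [:0, 1:] * (\<Sum>l\<in>S. unit_row (\<sigma> l) j)"
    by (simp only: char_row_def sum_subtractf sum_distrib_left)
  also have "(\<Sum>l\<in>S. unit_row (\<sigma> l) j) = (\<Sum>l\<in>S. unit_row l j :: real poly)"
    using sum.permute[OF assms(2), of "\<lambda>l. unit_row l j :: real poly"] by (simp add: o_def)
  also have "(\<Sum>l\<in>S. unit_row l j :: real poly) = 1"
    using assms by (simp add: unit_row_def)
  finally show ?thesis by (simp add: one_pCons)
qed

text \<open>Adding all other rows to row i turns it into 1 - x times the all-ones row. In particular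
  the quotient does not depend on the row that is replaced.\<close>

lemma char_det_eq:
  assumes "finite S" "\<sigma> permutes S" "i \<in> S"
  shows "char_det S \<sigma> = [:1, -1:] * ldet S ((char_row \<sigma>)(i := \<lambda>_. 1))"
proof -
  have "[:1, -1:] * ldet S ((char_row \<sigma>)(i := \<lambda>_. 1)) = ldet S ((char_row \<sigma>)(i := \<lambda>j. \<Sum>l\<in>S. char_row \<sigma> l j))"
    unfolding ldet_row_scale[OF assms(1,3), symmetric]
    by (rule ldet_row_cong[OF assms(1,3)]) (simp add: sum_char_row[OF assms(1,2)])
  also have "\<dots> = (\<Sum>l\<in>S. ldet S ((char_row \<sigma>)(i := char_row \<sigma> l)))"
    by (rule ldet_row_sum[OF assms(1,3)])
  also have "\<dots> = (\<Sum>l\<in>S. if l = i then char_det S \<sigma> else 0)"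
  proof (intro sum.cong refl)
    fix l assume "l \<in> S"
    then show "ldet S ((char_row \<sigma>)(i := char_row \<sigma> l)) = (if l = i then char_det S \<sigma> else 0)"
      using ldet_rows_eq[of S i l "(char_row \<sigma>)(i := char_row \<sigma> l)"] assms by (simp add: char_det_def)
  qed
  also have "\<dots> = char_det S \<sigma>" using assms by simp
  finally show ?thesis by simp
qed

lemma red_det:
  assumes "finite S" "\<sigma> permutes S" "S \<noteq> {}"
  shows "char_det S \<sigma> = [:1, -1:] * red_det S \<sigma>"
  unfolding red_det_def using assms by (intro char_det_eq) (auto simp: some_in_eq)

text \<open>Composition with (i j) adds y = x (e_{\<sigma> i} - e_{\<sigma> j}) to row i and
  subtracts it from row j. By multilinearity only first-order terms survive: the mixed term has two
  proportional rows.\<close>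

lemma char_det_swap:
  assumes S: "finite S" "i \<in> S" "j \<in> S"
  shows "char_det S (\<sigma> \<circ> tr i j) = char_det S \<sigma> +
    [:0, 1:] * (ldet S ((char_row \<sigma>)(i := unit_row (\<sigma> i))) - ldet S ((char_row \<sigma>)(i := unit_row (\<sigma> j)))
     - ldet S ((char_row \<sigma>)(j := unit_row (\<sigma> i))) + ldet S ((char_row \<sigma>)(j := unit_row (\<sigma> j))))"
proof (cases "i = j")
  case False
  let ?C = "char_row \<sigma>"
  let ?X = "[:0, 1:] :: real poly"
  define y where "y v = ?X * (unit_row (\<sigma> i) v - unit_row (\<sigma> j) v)" for v
  have y: "ldet S (A(k := y)) = ?X * (ldet S (A(k := unit_row (\<sigma> i))) - ldet S (A(k := unit_row (\<sigma> j))))"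
    if "k \<in> S" for A k
  proof -
    have "ldet S (A(k := y)) = ?X * ldet S (A(k := \<lambda>v. unit_row (\<sigma> i) v + (-1) * unit_row (\<sigma> j) v))"
      unfolding y_def[abs_def] ldet_row_scale[OF S(1) that, symmetric] by simp
    also have "\<dots> = ?X * (ldet S (A(k := unit_row (\<sigma> i))) + (-1) * ldet S (A(k := unit_row (\<sigma> j))))"
      by (simp only: ldet_row_add[OF S(1) that] ldet_row_scale[OF S(1) that])
    finally show ?thesis by simp
  qed
  have "char_row (\<sigma> \<circ> tr i j) = ?C(i := \<lambda>v. ?C i v + y v, j := \<lambda>v. ?C j v + (-1) * y v)"
    using False by (auto simp: fun_eq_iff char_row_def y_def Transposition.transpose_def algebra_simps)
  then have "char_det S (\<sigma> \<circ> tr i j) =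
      ldet S (?C(i := \<lambda>v. ?C i v + y v, j := ?C j)) + (-1) * ldet S (?C(i := \<lambda>v. ?C i v + y v, j := y))"
    unfolding char_det_def by (simp only: ldet_row_add[OF S(1,3)] ldet_row_scale[OF S(1,3)])
  also have "ldet S (?C(i := \<lambda>v. ?C i v + y v, j := ?C j)) = char_det S \<sigma> + ldet S (?C(i := y))"
  proof -
    have "?C(i := \<lambda>v. ?C i v + y v, j := ?C j) = ?C(i := \<lambda>v. ?C i v + y v)"
      using False by (simp add: fun_upd_idem)
    then show ?thesis using ldet_row_add[OF S(1,2), of ?C "?C i" y] by (simp add: char_det_def)
  qed
  also have "ldet S (?C(i := \<lambda>v. ?C i v + y v, j := y)) = ldet S (?C(j := y))"
  proof -
    have tw: "?C(i := u, j := y) = (?C(j := y))(i := u)" for u using False by (simp add: fun_upd_twist)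
    have "ldet S (?C(i := \<lambda>v. ?C i v + y v, j := y)) = ldet S ((?C(j := y))(i := ?C i)) + ldet S ((?C(j := y))(i := y))"
      unfolding tw by (rule ldet_row_add[OF S(1,2)])
    moreover have "(?C(j := y))(i := ?C i) = ?C(j := y)" using False by (simp add: fun_upd_idem)
    moreover have "ldet S ((?C(j := y))(i := y)) = 0"
      using False S by (intro ldet_rows_eq[of S i j]) auto
    ultimately show ?thesis by simp
  qed
  finally show ?thesis unfolding y[OF S(2)] y[OF S(3)] by (simp add: algebra_simps o_def)
qed simp

text \<open>Sums over ordered pairs are the convenient ones for \<open>char_det_swap\<close>; they
  meet each transposition twice and the identity once per diagonal pair.\<close>

lemma sum_transp_on:
  fixes f :: "(nat \<Rightarrow> nat) \<Rightarrow> 'a::comm_ring_1"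
  assumes "finite S"
  shows "(\<Sum>i\<in>S. \<Sum>j\<in>S. f (tr i j)) = of_nat (card S) * f id + 2 * (\<Sum>t\<in>transp_on S. f t)"
proof -
  let ?T = "\<lambda>(i, j). tr i j :: nat \<Rightarrow> nat"
  let ?L = "{(i, j) \<in> S \<times> S. i < j}" and ?G = "{(i, j) \<in> S \<times> S. j < i}" and ?E = "{(i, j) \<in> S \<times> S. i = j}"
  have fin: "finite ?L" "finite ?G" "finite ?E" using assms by (auto intro: finite_subset[of _ "S \<times> S"])
  have inj: "inj_on ?T ?L"
  proof (rule inj_onI, clarsimp)
    fix i j k l :: nat assume "i < j" "k < l" and eq: "tr i j = tr k l"
    then show "i = k \<and> j = l"
      using fun_cong[OF eq, of i, symmetric] unfolding transpose_apply_first transpose_eq_iff by auto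
  qed
  have im: "?T ` ?L = transp_on S"
  proof
    show "transp_on S \<subseteq> ?T ` ?L"
    proof
      fix t assume "t \<in> transp_on S"
      then obtain i j where "i \<in> S" "j \<in> S" "i \<noteq> j" "t = tr i j" by (rule transp_onE)
      then have "(i, j) \<in> ?L \<and> t = ?T (i, j) \<or> (j, i) \<in> ?L \<and> t = ?T (j, i)"
        by (auto simp: transpose_commute)
      then show "t \<in> ?T ` ?L" by blast
    qed
  qed (auto intro: transp_onI)
  have L: "(\<Sum>q\<in>?L. f (?T q)) = (\<Sum>t\<in>transp_on S. f t)"
    using sum.reindex[OF inj, of f] im by (simp add: o_def)
  have G: "(\<Sum>q\<in>?G. f (?T q)) = (\<Sum>q\<in>?L. f (?T q))"
    by (rule sum.reindex_bij_witness[of _ prod.swap prod.swap]) (auto simp: transpose_commute)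
  have E: "(\<Sum>q\<in>?E. f (?T q)) = of_nat (card S) * f id"
  proof -
    have "?E = (\<lambda>i. (i, i)) ` S" by auto
    then have "card ?E = card S" by (simp add: card_image inj_on_def)
    moreover have "(\<Sum>q\<in>?E. f (?T q)) = (\<Sum>q\<in>?E. f id)" by (rule sum.cong) auto
    ultimately show ?thesis by simp
  qed
  have "(\<Sum>i\<in>S. \<Sum>j\<in>S. f (tr i j)) = (\<Sum>q\<in>S \<times> S. f (?T q))"
    by (simp add: sum.cartesian_product case_prod_unfold)
  also have "S \<times> S = ?E \<union> (?L \<union> ?G)" by auto
  also have "(\<Sum>q\<in>?E \<union> (?L \<union> ?G). f (?T q)) = (\<Sum>q\<in>?E. f (?T q)) + ((\<Sum>q\<in>?L. f (?T q)) + (\<Sum>q\<in>?G. f (?T q)))"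
    using fin by (subst sum.union_disjoint, auto)+
  finally show ?thesis using L G E by simp
qed

lemma pderiv_char_det:
  assumes "finite S"
  shows "pderiv (char_det S \<sigma>) = - (\<Sum>i\<in>S. ldet S ((char_row \<sigma>)(i := unit_row (\<sigma> i))))"
proof -
  have "pderiv (char_row \<sigma> k j) = (-1) * unit_row (\<sigma> k) j" for k j
    by (simp add: char_row_def unit_row_def pderiv_diff pderiv_mult pderiv_pCons one_pCons)
  then have "pderiv (char_det S \<sigma>) = (\<Sum>k\<in>S. ldet S ((char_row \<sigma>)(k := \<lambda>j. (-1) * unit_row (\<sigma> k) j)))"
    unfolding char_det_def pderiv_ldet[OF assms] by presburger
  also have "\<dots> = (\<Sum>k\<in>S. (-1) * ldet S ((char_row \<sigma>)(k := unit_row (\<sigma> k))))"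
    by (intro sum.cong refl ldet_row_scale assms)
  also have "\<dots> = - (\<Sum>i\<in>S. ldet S ((char_row \<sigma>)(i := unit_row (\<sigma> i))))" by (simp add: sum_negf)
  finally show ?thesis .
qed

text \<open>In the sum of \<open>char_det_swap\<close> over all pairs, the terms with row i replaced
  by its own target add up to minus the derivative. In the cross terms, summing over targets gives
  the all-ones row, hence \<open>red_det\<close> again. For \<open>char_det\<close> these cross
  terms would carry a denominator 1 - x.\<close>

lemma sum_red_det_swap:
  assumes S: "finite S" "S \<noteq> {}" and \<sigma>: "\<sigma> permutes S"
  defines "N \<equiv> of_nat (card S) :: real poly"
  shows "2 * (\<Sum>t\<in>transp_on S. red_det S (\<sigma> \<circ> t)) =
    (N^2 - N) * red_det S \<sigma> - 2 * N * [:0, 1:] * pderiv (red_det S \<sigma>)"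
proof -
  let ?X = "[:0, 1:] :: real poly" and ?Y = "[:1, -1:] :: real poly"
  let ?C = "char_row \<sigma>"
  define R where "R i v = ldet S (?C(i := unit_row v))" for i v
  define Tr where "Tr = (\<Sum>i\<in>S. R i (\<sigma> i))"
  define W where "W = (\<Sum>i\<in>S. \<Sum>j\<in>S. R i (\<sigma> j))"
  define D where "D = char_det S \<sigma>"
  define P where "P = red_det S \<sigma>"
  have D: "D = ?Y * P" unfolding D_def P_def by (rule red_det[OF S(1) \<sigma> S(2)])
  have D': "pderiv D = - Tr" unfolding D_def Tr_def R_def by (rule pderiv_char_det[OF S(1)])
  have W: "?Y * W = N * D"
  proof -
    have "?Y * (\<Sum>j\<in>S. R i (\<sigma> j)) = D" if i: "i \<in> S" for i
    proof -
      have "(\<Sum>j\<in>S. R i (\<sigma> j)) = (\<Sum>j\<in>S. R i j)"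
        using sum.permute[OF \<sigma>, of "R i"] by (simp add: o_def)
      also have "\<dots> = ldet S (?C(i := \<lambda>v. \<Sum>j\<in>S. unit_row j v))"
        unfolding R_def by (rule ldet_row_sum[OF S(1) i, symmetric])
      also have "\<dots> = ldet S (?C(i := \<lambda>_. 1))"
        by (rule ldet_row_cong[OF S(1) i]) (use S in \<open>simp add: unit_row_def\<close>)
      finally show ?thesis using char_det_eq[OF S(1) \<sigma> i] by (simp add: D_def)
    qed
    then have "?Y * W = (\<Sum>i\<in>S. D)" unfolding W_def sum_distrib_left[of ?Y] by (rule sum.cong[OF refl])
    then show ?thesis by (simp add: N_def)
  qed
  have "(\<Sum>i\<in>S. \<Sum>j\<in>S. char_det S (\<sigma> \<circ> tr i j)) =
    (\<Sum>i\<in>S. \<Sum>j\<in>S. D + ?X * (R i (\<sigma> i) - R i (\<sigma> j) - R j (\<sigma> i) + R j (\<sigma> j)))"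
    unfolding D_def R_def by (intro sum.cong refl char_det_swap S(1))
  also have "\<dots> = N * N * D + ?X * (N * Tr - W - W + N * Tr)"
  proof -
    have "(\<Sum>i\<in>S. \<Sum>j\<in>S. R j (\<sigma> i)) = W" unfolding W_def by (rule sum.swap)
    then have "(\<Sum>i\<in>S. \<Sum>j\<in>S. (R i (\<sigma> i) - R i (\<sigma> j) - R j (\<sigma> i) + R j (\<sigma> j))) = N * Tr - W - W + N * Tr"
      by (simp add: sum.distrib sum_subtractf W_def[symmetric] Tr_def[symmetric] N_def sum_distrib_left[symmetric])
    then show ?thesis
      by (simp only: sum.distrib sum_distrib_left[symmetric] sum_constant N_def mult.assoc)
  qed
  finally have A: "N * D + 2 * (\<Sum>t\<in>transp_on S. char_det S (\<sigma> \<circ> t)) = N * N * D + ?X * (N * Tr - W - W + N * Tr)"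
    using sum_transp_on[OF S(1), of "\<lambda>t. char_det S (\<sigma> \<circ> t)"] by (simp add: N_def D_def)
  define T where "T = (\<Sum>t\<in>transp_on S. red_det S (\<sigma> \<circ> t))"
  have "(\<Sum>t\<in>transp_on S. char_det S (\<sigma> \<circ> t)) = ?Y * T"
    unfolding T_def sum_distrib_left
    by (intro sum.cong refl red_det S permutes_compose[OF transp_on_permutes \<sigma>])
  with A have A': "N * D + 2 * (?Y * T) = N * N * D + ?X * (N * Tr - W - W + N * Tr)" by simp
  have Y: "?Y \<noteq> 0" by simp
  have "?Y * W = ?Y * (N * P)" using W D by (simp only: mult.assoc mult.left_commute)
  then have W': "W = N * P" using Y mult_left_cancel by blast
  have "pderiv D = ?Y * pderiv P - P"
    unfolding D pderiv_mult by (simp add: pderiv_pCons one_pCons)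
  then have Tr': "Tr = P - ?Y * pderiv P" using D' by (simp add: algebra_simps)
  have "?Y * (2 * T) = ?Y * ((N^2 - N) * P - 2 * N * ?X * pderiv P)"
    using A' unfolding W' Tr' D by algebra
  then show ?thesis using Y mult_left_cancel unfolding T_def P_def by blast
qed

lemma ldet_dependent:
  fixes A :: "nat \<Rightarrow> nat \<Rightarrow> 'a::{idom,ring_char_0}"
  assumes "finite S" "B \<subseteq> S" "B \<noteq> {}" and zero: "\<And>j. j \<in> S \<Longrightarrow> (\<Sum>l\<in>B. A l j) = 0"
  shows "ldet S A = 0"
proof -
  obtain k where k: "k \<in> B" using assms by auto
  then have kS: "k \<in> S" using assms by auto
  have fB: "finite B" using assms finite_subset by blast
  have "ldet S (A(k := \<lambda>j. \<Sum>l\<in>B. A l j)) = ldet S (A(k := \<lambda>j. 0 * A k j))"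
    by (rule ldet_row_cong[OF assms(1) kS]) (simp add: zero)
  then have "0 = (\<Sum>l\<in>B. ldet S (A(k := A l)))"
    unfolding ldet_row_scale[OF assms(1) kS] ldet_row_sum[OF assms(1) kS] by simp
  also have "\<dots> = (\<Sum>l\<in>B. if l = k then ldet S A else 0)"
  proof (intro sum.cong refl)
    fix l assume "l \<in> B"
    then show "ldet S (A(k := A l)) = (if l = k then ldet S A else 0)"
      using ldet_rows_eq[of S k l "A(k := A l)"] assms kS by auto
  qed
  finally show ?thesis using k fB by simp
qed

lemma red_det_1:
  assumes "finite S" "\<sigma> permutes S" "S \<noteq> {}"
  shows "poly (red_det S \<sigma>) 1 = - poly (pderiv (char_det S \<sigma>)) 1"
  unfolding red_det[OF assms] pderiv_mult by (simp add: pderiv_pCons one_pCons)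

text \<open>At x = 1 the rows indexed by an invariant set sum to zero. In each determinant of the
  derivative formula one row is replaced, and either B or its complement avoids that row.\<close>

lemma red_det_1_closed:
  assumes S: "finite S" "\<sigma> permutes S" and B: "B \<subseteq> S" "B \<noteq> {}" "B \<noteq> S" and cl: "\<sigma> ` B \<subseteq> B"
  shows "poly (red_det S \<sigma>) 1 = 0"
proof -
  have zero: "poly (ldet S ((char_row \<sigma>)(i := unit_row (\<sigma> i)))) 1 = 0"
    if C: "C \<subseteq> S" "C \<noteq> {}" "\<sigma> ` C \<subseteq> C" "i \<notin> C" for C i
    unfolding poly_ldet
  proof (rule ldet_dependent[OF S(1) C(1,2)])
    fix j assume "j \<in> S"
    have fC: "finite C" using C S finite_subset by blast
    have bij: "bij_betw \<sigma> C C"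
      using C(3) fC permutes_inj_on[OF S(2)] by (simp add: bij_betw_def endo_inj_surj)
    have "(\<Sum>l\<in>C. poly (((char_row \<sigma>)(i := unit_row (\<sigma> i))) l j) 1) = (\<Sum>l\<in>C. unit_row l j - unit_row (\<sigma> l) j :: real)"
      using C(4) by (intro sum.cong refl) (auto simp: char_row_def unit_row_def)
    also have "\<dots> = 0"
      using sum.reindex_bij_betw[OF bij, of "\<lambda>l. unit_row l j :: real"] by (simp add: sum_subtractf)
    finally show "(\<Sum>l\<in>C. poly (((char_row \<sigma>)(i := unit_row (\<sigma> i))) l j) 1) = 0" .
  qed
  have fB: "finite B" using B S finite_subset by blast
  have "\<sigma> ` B = B" using cl fB permutes_inj_on[OF S(2)] by (simp add: endo_inj_surj)
  then have cl': "\<sigma> ` (S - B) \<subseteq> S - B"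
    using permutes_image[OF S(2)] permutes_inj[OF S(2)] by (simp add: image_set_diff)
  have "poly (ldet S ((char_row \<sigma>)(i := unit_row (\<sigma> i)))) 1 = 0" if "i \<in> S" for i
    using zero[of B i] zero[of "S - B" i] B cl cl' by (cases "i \<in> B") auto
  then show ?thesis
    using red_det_1[OF S] B(1,2) by (auto simp: pderiv_char_det[OF S(1)] poly_sum)
qed

text \<open>A nonzero Leibniz term has \<pi> i equal to i or \<sigma> i everywhere. By injectivity
  of \<pi> the set where it agrees with \<sigma> is \<sigma>-invariant, so only the identity and
  \<sigma> contribute.\<close>

lemma char_det_cycle:
  assumes S: "finite S" "\<sigma> permutes S" "2 \<le> card S"
    and cyc: "\<And>B. B \<subseteq> S \<Longrightarrow> B \<noteq> {} \<Longrightarrow> \<sigma> ` B \<subseteq> B \<Longrightarrow> B = S"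
  shows "char_det S \<sigma> = 1 + of_int (sign \<sigma>) * (- [:0, 1:]) ^ card S"
proof -
  have nofix: "\<sigma> l \<noteq> l" if "l \<in> S" for l
  proof
    assume "\<sigma> l = l"
    then have "{l} = S" using that by (intro cyc) auto
    then show False using S(3) by auto
  qed
  let ?f = "\<lambda>\<pi>. of_int (sign \<pi>) * (\<Prod>i\<in>S. char_row \<sigma> i (\<pi> i))"
  have z: "?f \<pi> = 0" if p: "\<pi> permutes S" "\<pi> \<noteq> id" "\<pi> \<noteq> \<sigma>" for \<pi>
  proof (rule ccontr)
    assume nz: "?f \<pi> \<noteq> 0"
    then have "\<forall>i\<in>S. char_row \<sigma> i (\<pi> i) \<noteq> 0" using S(1) by auto
    then have two: "\<pi> i = i \<or> \<pi> i = \<sigma> i" if "i \<in> S" for i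
      using that by (auto simp: char_row_def unit_row_def split: if_splits)
    let ?B = "{i \<in> S. \<pi> i = \<sigma> i}"
    have "\<sigma> ` ?B \<subseteq> ?B"
    proof
      fix m assume "m \<in> \<sigma> ` ?B"
      then obtain l where l: "l \<in> S" "\<pi> l = \<sigma> l" "m = \<sigma> l" by auto
      have mS: "m \<in> S" using l permutes_in_image[OF S(2)] by simp
      have "\<pi> m \<noteq> m" using l nofix[of l] permutes_inj[OF p(1)] by (metis injD)
      then show "m \<in> ?B" using two[OF mS] mS by simp
    qed
    then have "?B = {} \<or> ?B = S" using cyc[of ?B] by blast
    then show False
    proof
      assume "?B = {}"
      then have "\<pi> i = i" for i using two[of i] permutes_not_in[OF p(1), of i] by blast
      then show False using p(2) by auto
    next
      assume "?B = S"
      then have "\<pi> i = \<sigma> i" for i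
        using permutes_not_in[OF p(1), of i] permutes_not_in[OF S(2), of i] by (cases "i \<in> S") auto
      then show False using p(3) by auto
    qed
  qed
  obtain l where l: "l \<in> S" using S(3) by fastforce
  have ne: "id \<noteq> \<sigma>" using nofix[OF l] by auto
  have "char_det S \<sigma> = (\<Sum>\<pi>\<in>{id, \<sigma>}. ?f \<pi>)"
    unfolding char_det_def ldet_def
    by (rule sum.mono_neutral_right) (use S z in \<open>auto simp: finite_permutations permutes_id\<close>)
  also have "\<dots> = ?f id + ?f \<sigma>" using ne by simp
  also have "?f id = 1"
  proof -
    have "char_row \<sigma> i i = 1" if "i \<in> S" for i
      using nofix[OF that, symmetric] by (simp add: char_row_def unit_row_def)
    then show ?thesis by simp
  qed
  also have "(\<Prod>i\<in>S. char_row \<sigma> i (\<sigma> i)) = (\<Prod>i\<in>S. - [:0, 1:])"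
    using nofix by (intro prod.cong refl) (auto simp: char_row_def unit_row_def)
  finally show ?thesis by simp
qed

text \<open>The sign condition makes \<open>char_det\<close> equal to 1 - x^N with N the size of S,
  and minus its derivative at 1 is N.\<close>

lemma red_det_1_cycle:
  assumes S: "finite S" "\<sigma> permutes S" "2 \<le> card S"
    and cyc: "\<And>B. B \<subseteq> S \<Longrightarrow> B \<noteq> {} \<Longrightarrow> \<sigma> ` B \<subseteq> B \<Longrightarrow> B = S"
    and sgn: "sign \<sigma> = (-1) ^ (card S - 1)"
  shows "poly (red_det S \<sigma>) 1 = real (card S)"
proof -
  let ?X = "[:0, 1:] :: real poly"
  obtain m where m: "card S = Suc m" using S(3) by (cases "card S") auto
  have "char_det S \<sigma> = 1 - ?X ^ card S"
  proof -
    have "of_int ((-1) ^ m) * (- Y) ^ Suc m = - (Y ^ Suc m)" for Y :: "real poly"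
      by (cases "even m") simp_all
    then have e: "1 + of_int ((-1) ^ m) * (- ?X) ^ Suc m = 1 - ?X ^ Suc m" by (metis uminus_add_conv_diff add.commute)
    have "card S - 1 = m" using m by simp
    then have "char_det S \<sigma> = 1 + of_int ((-1) ^ m) * (- ?X) ^ Suc m"
      using char_det_cycle[OF S cyc] sgn unfolding m by metis
    then show ?thesis unfolding e m .
  qed
  then have "pderiv (char_det S \<sigma>) = - smult (real (card S)) (?X ^ m)"
    unfolding m by (simp add: pderiv_diff pderiv_power_Suc pderiv_pCons one_pCons del: power_Suc of_nat_Suc)
  moreover have "S \<noteq> {}" using S(3) by auto
  ultimately show ?thesis using red_det_1[OF S(1,2)] by (simp add: poly_monom)
qed

lemma red_det_id:
  assumes "finite S" "S \<noteq> {}"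
  shows "red_det S id = [:1, -1:] ^ (card S - 1)"
proof -
  have "(\<Prod>i\<in>S. char_row id i (\<pi> i)) = 0" if p: "\<pi> permutes S" "\<pi> \<noteq> id" for \<pi>
  proof -
    obtain i where "\<pi> i \<noteq> i" using p(2) by (auto simp: fun_eq_iff)
    moreover have "i \<in> S" using permutes_not_in[OF p(1)] calculation by blast
    ultimately show ?thesis using assms(1) by (auto simp: char_row_def unit_row_def)
  qed
  then have "char_det S id = (\<Sum>\<pi>\<in>{id}. of_int (sign \<pi>) * (\<Prod>i\<in>S. char_row id i (\<pi> i)))"
    unfolding char_det_def ldet_def
    by (intro sum.mono_neutral_right) (use assms in \<open>auto simp: finite_permutations permutes_id\<close>)
  also have "\<dots> = [:1, -1:] ^ card S"
    by (simp add: char_row_def unit_row_def one_pCons)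
  finally have "[:1, -1:] * red_det S id = [:1, -1:] * [:1, -1:] ^ (card S - 1)"
    using red_det[OF assms(1) permutes_id assms(2)] assms by (simp flip: power_Suc add: card_gt_0_iff)
  then show ?thesis using mult_left_cancel[of "[:1, -1:] :: real poly"] by simp
qed

section \<open>Averaging over lists of transpositions and evaluating at 1\<close>

definition transp_lists :: "nat set \<Rightarrow> nat \<Rightarrow> (nat \<Rightarrow> nat) list set" where
  "transp_lists S m = {ts. set ts \<subseteq> transp_on S \<and> length ts = m}"

lemma finite_transp_lists [simp]: "finite S \<Longrightarrow> finite (transp_lists S m)"
  unfolding transp_lists_def by (rule finite_lists_length_eq) simp

text \<open>Factors are added at the front because \<open>perm_prod (t # ts)\<close> is
  \<open>perm_prod ts \<circ> t\<close>, the product treated in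
  \<open>sum_red_det_swap\<close>.\<close>

lemma sum_transp_lists_Suc:
  "(\<Sum>ts\<in>transp_lists S (Suc m). f ts) = (\<Sum>ts\<in>transp_lists S m. \<Sum>t\<in>transp_on S. f (t # ts))"
proof -
  have "(\<Sum>ts\<in>transp_lists S (Suc m). f ts) = (\<Sum>(ts, t)\<in>transp_lists S m \<times> transp_on S. f (t # ts))"
    by (rule sum.reindex_bij_witness[of _ "\<lambda>(ts, t). t # ts" "\<lambda>ts. (tl ts, hd ts)"])
      (auto simp: transp_lists_def length_Suc_conv)
  then show ?thesis by (simp add: sum.cartesian_product)
qed

text \<open>Up to sign the coefficients of \<open>red_det\<close> are the characters of the exterior
  powers of the standard representation, that is, of hooks; the eigenvalue is the content sum of the
  hook (N - k, 1^k). The last factor is the starting value at the identity.\<close>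

lemma coeff_sum_red_det:
  assumes S: "finite S" "S \<noteq> {}"
  defines "N \<equiv> real (card S)"
  shows "(\<Sum>ts\<in>transp_lists S m. coeff (red_det S (perm_prod ts)) k) =
    ((N^2 - N) / 2 - N * real k) ^ m * coeff ([:1, -1:] ^ (card S - 1)) k"
proof (induction m)
  case 0
  have "transp_lists S 0 = {[]}" by (auto simp: transp_lists_def)
  then show ?case using red_det_id[OF S] by (simp add: id_def)
next
  case (Suc m)
  let ?c = "(N^2 - N) / 2 - N * real k"
  have step: "(\<Sum>t\<in>transp_on S. coeff (red_det S (perm_prod ts \<circ> t)) k) = ?c * coeff (red_det S (perm_prod ts)) k"
    if "ts \<in> transp_lists S m" for ts
  proof -
    have p: "perm_prod ts permutes S" using that perm_prod_permutes by (auto simp: transp_lists_def)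
    let ?P = "red_det S (perm_prod ts)"
    have N: "of_nat (card S) = [:N:]" by (simp add: of_nat_poly N_def)
    have "coeff (2 * (\<Sum>t\<in>transp_on S. red_det S (perm_prod ts \<circ> t))) k =
        coeff (([:N:]^2 - [:N:]) * ?P - 2 * [:N:] * [:0, 1:] * pderiv ?P) k"
      unfolding sum_red_det_swap[OF S p] N ..
    also have "([:N:]^2 - [:N:]) * ?P - 2 * [:N:] * [:0, 1:] * pderiv ?P =
        smult (N^2 - N) ?P - smult (2 * N) (pCons 0 (pderiv ?P))"
      by (simp add: power2_eq_square numeral_poly mult.commute)
    also have "coeff \<dots> k = 2 * (?c * coeff ?P k)"
      by (cases k) (simp_all add: coeff_pderiv field_simps)
    finally show ?thesis by (simp add: coeff_sum numeral_poly o_def)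
  qed
  have "(\<Sum>ts\<in>transp_lists S (Suc m). coeff (red_det S (perm_prod ts)) k) =
      (\<Sum>ts\<in>transp_lists S m. \<Sum>t\<in>transp_on S. coeff (red_det S (perm_prod ts \<circ> t)) k)"
    by (simp add: sum_transp_lists_Suc)
  also have "\<dots> = (\<Sum>ts\<in>transp_lists S m. ?c * coeff (red_det S (perm_prod ts)) k)"
    using step by (rule sum.cong[OF refl])
  also have "\<dots> = ?c ^ Suc m * coeff ([:1, -1:] ^ (card S - 1)) k"
    by (simp only: sum_distrib_left[symmetric] Suc.IH power_Suc mult.assoc)
  finally show ?case .
qed

lemma coeff_one_minus_power:
  "coeff ([:1, -1:] ^ M :: real poly) k = (-1) ^ k * real (M choose k)"
proof (induction M arbitrary: k)
  case 0
  then show ?case by (cases k) auto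
next
  case (Suc M)
  then show ?case by (cases k) (simp_all add: field_simps)
qed

lemma sign_perm_prod:
  assumes "finite S" "set ts \<subseteq> transp_on S"
  shows "sign (perm_prod ts) = (-1) ^ length ts"
  using assms(2)
proof (induction ts)
  case (Cons t ts)
  then obtain i j where t: "i \<noteq> j" "t = tr i j" by (auto elim: transp_onE)
  have "permutation (perm_prod ts)" using perm_prod_permutes[of ts S] Cons assms(1) permutes_imp_permutation by auto
  then have "sign (perm_prod (t # ts)) = sign (perm_prod ts) * sign t"
    unfolding perm_prod.simps(2) t(2) by (rule sign_compose[OF _ permutation_swap_id])
  also have "\<dots> = (-1) ^ length (t # ts)" using Cons t by (simp add: sign_swap_id)
  finally show ?case .
qed simp

lemma is_full_cycleI_closed:
  assumes "\<sigma> permutes {1..n}" "1 \<le> n"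
    and cyc: "\<And>B. B \<subseteq> {1..n} \<Longrightarrow> B \<noteq> {} \<Longrightarrow> \<sigma> ` B \<subseteq> B \<Longrightarrow> B = {1..n}"
  shows "is_full_cycle n \<sigma>"
proof -
  have p: "permutation \<sigma>" using assms(1) permutes_imp_permutation by blast
  let ?cs = "support \<sigma> 1"
  have d: "distinct ?cs" using cycle_of_permutation[OF p] .
  have sup: "set ?cs = range (\<lambda>i. (\<sigma> ^^ i) 1)" using support_set[OF p] .
  have sub: "set ?cs \<subseteq> {1..n}"
  proof -
    have "(\<sigma> ^^ i) 1 \<in> {1..n}" for i
      using permutes_in_image[OF permutes_funpow[OF assms(1), of i], of 1] assms(2) by simp
    then show ?thesis unfolding sup by blast
  qed
  have cl: "\<sigma> ` set ?cs \<subseteq> set ?cs"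
  proof -
    have "\<sigma> ((\<sigma> ^^ i) 1) = (\<sigma> ^^ Suc i) 1" for i by simp
    then show ?thesis unfolding sup by blast
  qed
  have "set ?cs \<noteq> {}" unfolding sup by simp
  then have eq: "set ?cs = {1..n}" by (rule cyc[OF sub _ cl])
  have "\<sigma> y = cycle_of_list ?cs y" for y
  proof (cases "y \<in> set ?cs")
    case True
    then show ?thesis using cycle_restrict[OF p] by blast
  next
    case False
    then show ?thesis using id_outside_supp[OF False] permutes_not_in[OF assms(1)] eq by simp
  qed
  then show ?thesis unfolding is_full_cycle_def using d eq by blast
qed

text \<open>A product of n - 1 + 2h transpositions has the sign of an n-cycle, as
  \<open>red_det_1_cycle\<close> requires.\<close>

lemma red_det_1_full_cycle:
  assumes n: "2 \<le> n" and ts: "ts \<in> transp_lists {1..n} (n - 1 + 2 * h)"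
  shows "poly (red_det {1..n} (perm_prod ts)) 1 = (if is_full_cycle n (perm_prod ts) then real n else 0)"
proof -
  have t: "set ts \<subseteq> transp_on {1..n}" "length ts = n - 1 + 2 * h" using ts by (auto simp: transp_lists_def)
  have p: "perm_prod ts permutes {1..n}" using perm_prod_permutes[OF t(1)] .
  show ?thesis
  proof (cases "is_full_cycle n (perm_prod ts)")
    case True
    have "poly (red_det {1..n} (perm_prod ts)) 1 = real (card {1..n})"
    proof (rule red_det_1_cycle[OF _ p])
      show "B = {1..n}" if "B \<subseteq> {1..n}" "B \<noteq> {}" "perm_prod ts ` B \<subseteq> B" for B
        using is_full_cycle_closed[OF True _ that(1,2)] that(3) n by auto
      show "sign (perm_prod ts) = (-1) ^ (card {1..n} - 1)"
        using sign_perm_prod[OF _ t(1)] t(2) by (simp add: power_add)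
    qed (use n in auto)
    then show ?thesis using True by simp
  next
    case False
    have "\<exists>B. B \<subseteq> {1..n} \<and> B \<noteq> {} \<and> perm_prod ts ` B \<subseteq> B \<and> B \<noteq> {1..n}"
    proof (rule ccontr)
      assume "\<not> ?thesis"
      then have "B = {1..n}" if "B \<subseteq> {1..n}" "B \<noteq> {}" "perm_prod ts ` B \<subseteq> B" for B
        using that by blast
      moreover have "1 \<le> n" using n by simp
      ultimately show False using is_full_cycleI_closed[OF p] False by metis
    qed
    then obtain B where B: "B \<subseteq> {1..n}" "B \<noteq> {}" "B \<noteq> {1..n}" "perm_prod ts ` B \<subseteq> B" by metis
    have "poly (red_det {1..n} (perm_prod ts)) 1 = 0" by (rule red_det_1_closed[OF _ p B]) simp
    then show ?thesis using False by simp
  qed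
qed

lemma card_full_cycle_lists:
  assumes n: "2 \<le> n"
  shows "real n * real (card {ts \<in> transp_lists {1..n} (n - 1 + 2 * h). is_full_cycle n (perm_prod ts)}) =
    (\<Sum>k\<le>n - 1. (-1) ^ k * real (n - 1 choose k) * ((real n ^ 2 - real n) / 2 - real n * real k) ^ (n - 1 + 2 * h))"
proof -
  let ?m = "n - 1 + 2 * h" and ?S = "{1..n}"
  let ?Q = "\<Sum>ts\<in>transp_lists ?S ?m. red_det ?S (perm_prod ts)"
  have S: "finite ?S" "?S \<noteq> {}" using n by auto
  have c: "\<And>k. coeff ?Q k = ((real n ^ 2 - real n) / 2 - real n * real k) ^ ?m * ((-1) ^ k * real (n - 1 choose k))"
    using coeff_sum_red_det[OF S, where m = ?m] by (simp add: coeff_sum coeff_one_minus_power)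
  have "degree ?Q \<le> n - 1" by (rule degree_le) (simp only: c, simp)
  then have "poly ?Q 1 = (\<Sum>k\<le>n - 1. coeff ?Q k)"
    unfolding poly_altdef by (simp, intro sum.mono_neutral_left) (auto simp: coeff_eq_0)
  then have "poly ?Q 1 = (\<Sum>k\<le>n - 1. ((real n ^ 2 - real n) / 2 - real n * real k) ^ ?m * ((-1) ^ k * real (n - 1 choose k)))"
    by (simp only: c)
  moreover have "poly ?Q 1 = (\<Sum>ts\<in>transp_lists ?S ?m. if is_full_cycle n (perm_prod ts) then real n else 0)"
    unfolding poly_sum by (intro sum.cong refl red_det_1_full_cycle n)
  moreover have "\<dots> = real n * real (card {ts \<in> transp_lists ?S ?m. is_full_cycle n (perm_prod ts)})"
    by (simp add: sum.If_cases Int_def)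
  moreover have "(\<Sum>k\<le>n - 1. ((real n ^ 2 - real n) / 2 - real n * real k) ^ ?m * ((-1) ^ k * real (n - 1 choose k))) =
    (\<Sum>k\<le>n - 1. (-1) ^ k * real (n - 1 choose k) * ((real n ^ 2 - real n) / 2 - real n * real k) ^ ?m)"
    by (intro sum.cong refl) (rule mult.commute)
  ultimately show ?thesis by metis
qed

section \<open>Asymptotic number of factorizations\<close>

unbundle no vec_syntax
unbundle fps_syntax

lemma factorizations_transp_lists:
  "factorizations n h = {ts \<in> transp_lists {1..n} (n - 1 + 2 * h). perm_prod ts = full_cycle n}"
  by (auto simp: factorizations_def transp_lists_def transpositions_eq)

lemma map_conj_transp_lists:
  assumes "\<sigma> permutes S" "ts \<in> transp_lists S m"
  shows "map (conj_by \<sigma>) ts \<in> transp_lists S m"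
  using assms conj_by_transp_on[OF permutes_bij[OF assms(1)], of _ S] permutes_image[OF assms(1)]
  by (auto simp: transp_lists_def)

text \<open>Each n-cycle is conjugate to the standard one by exactly one permutation fixing 1, and
  there are (n - 1)! of those.\<close>

lemma card_full_cycle_lists_eq:
  assumes n: "1 \<le> n"
  shows "card {ts \<in> transp_lists {1..n} m. is_full_cycle n (perm_prod ts)} =
    card {ts \<in> transp_lists {1..n} m. perm_prod ts = full_cycle n} * fact (n - 1)"
proof -
  let ?A = "{ts \<in> transp_lists {1..n} m. is_full_cycle n (perm_prod ts)}"
  let ?F = "{ts \<in> transp_lists {1..n} m. perm_prod ts = full_cycle n}"
  let ?P = "{\<sigma>. \<sigma> permutes {2..n}}"
  have P: "\<sigma> \<in> ?P \<longleftrightarrow> \<sigma> permutes {1..n} \<and> \<sigma> 1 = 1" for \<sigma>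
  proof
    assume "\<sigma> \<in> ?P"
    then show "\<sigma> permutes {1..n} \<and> \<sigma> 1 = 1"
      using permutes_subset[of \<sigma> "{2..n}" "{1..n}"] permutes_not_in[of \<sigma> "{2..n}" 1] by auto
  next
    assume a: "\<sigma> permutes {1..n} \<and> \<sigma> 1 = 1"
    have "x = 1" if "x \<in> {1..n} - {2..n}" for x using that by auto
    then show "\<sigma> \<in> ?P" using permutes_superset[of \<sigma> "{1..n}" "{2..n}"] a by blast
  qed
  have "bij_betw (\<lambda>(ts, \<sigma>). map (conj_by \<sigma>) ts) (?F \<times> ?P) ?A"
  proof (rule bij_betw_byWitness[where f' = "\<lambda>ts. (relabel n ts, inv (relabelling n (perm_prod ts)))"])
    have rel: "relabelling n (perm_prod (map (conj_by \<sigma>) ts)) = inv \<sigma>"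
      "is_full_cycle n (perm_prod (map (conj_by \<sigma>) ts))"
      if "ts \<in> ?F" "\<sigma> \<in> ?P" for ts \<sigma>
    proof -
      have s: "\<sigma> permutes {1..n}" "\<sigma> 1 = 1" using that(2) P by auto
      have c: "conj_by (inv \<sigma>) (perm_prod (map (conj_by \<sigma>) ts)) = full_cycle n"
        using that(1) by (simp add: perm_prod_conj[OF permutes_bij[OF s(1)]] conj_by_inv_cancel[OF permutes_bij[OF s(1)]])
      have i: "inv \<sigma> permutes {1..n}" "inv \<sigma> 1 = 1"
        using permutes_inv[OF s(1)] s(2) permutes_inv_eq[OF s(1)] by auto
      show "relabelling n (perm_prod (map (conj_by \<sigma>) ts)) = inv \<sigma>"
        by (rule relabelling_eq[OF n i c])
      show "is_full_cycle n (perm_prod (map (conj_by \<sigma>) ts))" by (rule is_full_cycleI[OF i(1) c])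
    qed
    show "\<forall>q\<in>?F \<times> ?P. (\<lambda>ts. (relabel n ts, inv (relabelling n (perm_prod ts)))) ((\<lambda>(ts, \<sigma>). map (conj_by \<sigma>) ts) q) = q"
    proof
      fix q assume "q \<in> ?F \<times> ?P"
      then obtain ts \<sigma> where q: "ts \<in> ?F" "\<sigma> \<in> ?P" "q = (ts, \<sigma>)" by blast
      have s: "bij \<sigma>" using q(2) permutes_bij by blast
      have "(relabel n (map (conj_by \<sigma>) ts), inv (relabelling n (perm_prod (map (conj_by \<sigma>) ts)))) = (ts, \<sigma>)"
        unfolding relabel_eq rel(1)[OF q(1,2)] map_conj_inv_cancel[OF s] inv_inv_eq[OF s] ..
      then show "(\<lambda>ts. (relabel n ts, inv (relabelling n (perm_prod ts)))) ((\<lambda>(ts, \<sigma>). map (conj_by \<sigma>) ts) q) = q"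
        by (simp only: q(3) prod.case)
    qed
    show "(\<lambda>(ts, \<sigma>). map (conj_by \<sigma>) ts) ` (?F \<times> ?P) \<subseteq> ?A"
    proof
      fix t assume "t \<in> (\<lambda>(ts, \<sigma>). map (conj_by \<sigma>) ts) ` (?F \<times> ?P)"
      then obtain q' where q': "q' \<in> ?F \<times> ?P" "t = (\<lambda>(ts, \<sigma>). map (conj_by \<sigma>) ts) q'" by (rule imageE)
      obtain ts \<sigma> where "q' = (ts, \<sigma>)" by (cases q')
      then have q: "ts \<in> ?F" "\<sigma> \<in> ?P" "t = map (conj_by \<sigma>) ts" using q' by simp_all
      then show "t \<in> ?A"
        using rel(2)[OF q(1,2)] map_conj_transp_lists[of \<sigma> "{1..n}" ts m] P by blast
    qed
    show "\<forall>ts\<in>?A. (\<lambda>(ts, \<sigma>). map (conj_by \<sigma>) ts) (relabel n ts, inv (relabelling n (perm_prod ts))) = ts"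
    proof
      fix ts assume "ts \<in> ?A"
      then have "bij (relabelling n (perm_prod ts))"
        using is_full_cycle_relabelling(1)[OF _ n] permutes_bij by blast
      then show "(\<lambda>(ts, \<sigma>). map (conj_by \<sigma>) ts) (relabel n ts, inv (relabelling n (perm_prod ts))) = ts"
        unfolding relabel_eq by (simp add: conj_by_inv_cancel o_def)
    qed
    show "(\<lambda>ts. (relabel n ts, inv (relabelling n (perm_prod ts)))) ` ?A \<subseteq> ?F \<times> ?P"
    proof
      fix q assume "q \<in> (\<lambda>ts. (relabel n ts, inv (relabelling n (perm_prod ts)))) ` ?A"
      then obtain ts where ts: "ts \<in> ?A" and q: "q = (relabel n ts, inv (relabelling n (perm_prod ts)))" by blast
      let ?r = "relabelling n (perm_prod ts)"
      have r: "?r permutes {1..n}" "?r 1 = 1" "conj_by ?r (perm_prod ts) = full_cycle n"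
        using is_full_cycle_relabelling[OF _ n] ts by auto
      have "relabel n ts \<in> ?F"
        unfolding relabel_eq using map_conj_transp_lists[OF r(1)] ts perm_prod_conj[OF permutes_bij[OF r(1)]] r(3) by simp
      moreover have "inv ?r \<in> ?P" unfolding P using permutes_inv[OF r(1)] permutes_inv_eq[OF r(1)] r(2) by blast
      ultimately show "q \<in> ?F \<times> ?P" using q by blast
    qed
  qed
  then have "card ?A = card (?F \<times> ?P)" by (simp add: bij_betw_same_card)
  also have "\<dots> = card ?F * fact (n - 1)"
    by (simp add: card_cartesian_product card_permutations[of "{2..n}" "n - 1"])
  finally show ?thesis .
qed

text \<open>\<open>sinhc_series (z\<^sup>2) = sinh (z / 2) / (z / 2)\<close>\<close>

definition sinhc_series :: "real fps" where
  "sinhc_series = Abs_fps (\<lambda>j. 1 / (4 ^ j * fact (2 * j + 1)))"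

lemma sinhc_series_nth: "sinhc_series $ j = 1 / (4 ^ j * fact (2 * j + 1))"
  by (simp add: sinhc_series_def)

lemma nth_compose_X2: "(f oo fps_X ^ 2) $ n = (if even n then f $ (n div 2) else (0::real))"
proof -
  have "(f oo fps_X ^ 2) $ n = (\<Sum>i=0..n. f $ i * (if n = 2 * i then 1 else 0))"
    by (simp add: fps_compose_nth fps_X_power_nth flip: power_mult)
  also have "\<dots> = (\<Sum>i\<in>{i. i \<le> n \<and> n = 2 * i}. f $ i)"
    by (rule sum.mono_neutral_cong_right) auto
  also have "{i. i \<le> n \<and> n = 2 * i} = (if even n then {n div 2} else {})" by auto
  finally show ?thesis by simp
qed

lemma fps_exp_diff_sinhc: "fps_exp (1/2) - fps_exp (-1/2) = fps_X * (sinhc_series oo fps_X ^ 2)"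
proof (rule fps_ext)
  fix m
  show "(fps_exp (1/2) - fps_exp (-1/2)) $ m = (fps_X * (sinhc_series oo fps_X ^ 2)) $ m"
  proof (cases "even m")
    case True
    then show ?thesis by (cases m) (auto simp: nth_compose_X2)
  next
    case False
    then obtain j where j: "m = 2 * j + 1" by (auto elim: oddE)
    have rhs: "(fps_X * (sinhc_series oo fps_X ^ 2)) $ m = 1 / (4 ^ j * fact m)"
      unfolding j by (simp add: nth_compose_X2 sinhc_series_nth del: fact_Suc)
    have "(- (1/2) :: real) ^ m = - ((1/2) ^ m)" using power_minus_odd[of m "1/2 :: real"] False by simp
    moreover have "(1/2 :: real) ^ m = 1 / (2 * 4 ^ j)" unfolding j by (simp add: power_mult power_divide)
    ultimately show ?thesis unfolding rhs by (simp add: divide_simps)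
  qed
qed

text \<open>Both sides are n! times a coefficient of (e^(z/2) - e^(-z/2))^N, with n = N + 2h:
  expanded by the binomial theorem on the left, written as z^N times the N-th power of the sinhc
  series in z^2 on the right.\<close>

lemma alternating_power_sum:
  "(\<Sum>k\<le>N. (-1) ^ k * real (N choose k) * (real N / 2 - real k) ^ (N + 2 * h)) =
    fact (N + 2 * h) * (sinhc_series ^ N) $ h"
proof -
  let ?m = "N + 2 * h"
  have "(fps_exp (1/2) - fps_exp (-1/2)) ^ N =
      (\<Sum>k\<le>N. of_nat (N choose k) * (- fps_exp (-1/2)) ^ k * fps_exp (1/2) ^ (N - k) :: real fps)"
    using binomial_ring[of "- fps_exp (-1/2)" "fps_exp (1/2) :: real fps" N] by simp
  also have "\<dots> = (\<Sum>k\<le>N. fps_const ((-1) ^ k * real (N choose k)) * fps_exp (real N / 2 - real k))"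
  proof (rule sum.cong[OF refl])
    fix k assume k: "k \<in> {..N}"
    have "(- fps_exp (-1/2)) ^ k * fps_exp (1/2) ^ (N - k) = fps_const ((-1) ^ k) * (fps_exp (-1/2) ^ k * fps_exp (1/2 :: real) ^ (N - k))"
    proof -
      have c: "(-1 :: real fps) ^ k = fps_const ((-1) ^ k)"
        by (cases "even k") (simp_all flip: fps_const_neg)
      show ?thesis unfolding power_minus[of "fps_exp (-1/2)" k] c by (simp only: mult.assoc)
    qed
    also have "fps_exp (-1/2) ^ k * fps_exp (1/2) ^ (N - k) = fps_exp (real N / 2 - real k)"
      using k by (simp add: fps_exp_power_mult fps_exp_add_mult[symmetric] of_nat_diff field_simps)
    finally show "of_nat (N choose k) * (- fps_exp (-1/2)) ^ k * fps_exp (1/2) ^ (N - k) =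
        fps_const ((-1) ^ k * real (N choose k)) * fps_exp (real N / 2 - real k)"
      by (simp add: mult.assoc fps_of_nat[symmetric] fps_const_mult[symmetric] mult.commute mult.left_commute del: fps_const_mult)
  qed
  finally have "((fps_exp (1/2) - fps_exp (-1/2)) ^ N) $ ?m =
      (\<Sum>k\<le>N. (-1) ^ k * real (N choose k) * ((real N / 2 - real k) ^ ?m / fact ?m))"
    by (simp add: fps_sum_nth)
  also have "(fps_exp (1/2) - fps_exp (-1/2)) ^ N = fps_X ^ N * (sinhc_series ^ N oo fps_X ^ 2)"
    unfolding fps_exp_diff_sinhc power_mult_distrib by (simp add: fps_compose_power)
  also have "(fps_X ^ N * (sinhc_series ^ N oo fps_X ^ 2)) $ ?m = (sinhc_series ^ N) $ h"
    by (simp add: fps_X_power_mult_nth nth_compose_X2)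
  finally show ?thesis by (simp add: sum_divide_distrib[symmetric] field_simps)
qed

theorem card_factorizations:
  assumes n: "2 \<le> n"
  shows "real (card (factorizations n h)) * real n * fact (n - 1) =
    real n ^ (n - 1 + 2 * h) * fact (n - 1 + 2 * h) * (sinhc_series ^ (n - 1)) $ h"
proof -
  let ?m = "n - 1 + 2 * h"
  have "real (card (factorizations n h)) * real n * fact (n - 1) =
      real n * real (card {ts \<in> transp_lists {1..n} ?m. is_full_cycle n (perm_prod ts)})"
    using card_full_cycle_lists_eq[of n ?m] n by (simp add: factorizations_transp_lists)
  also have "\<dots> = (\<Sum>k\<le>n - 1. (-1) ^ k * real (n - 1 choose k) * ((real n ^ 2 - real n) / 2 - real n * real k) ^ ?m)"
    by (rule card_full_cycle_lists[OF n])
  also have "\<dots> = (\<Sum>k\<le>n - 1. real n ^ ?m * ((-1) ^ k * real (n - 1 choose k) * (real (n - 1) / 2 - real k) ^ ?m))"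
  proof (intro sum.cong refl)
    fix k
    \<comment> \<open>Taking n out of each eigenvalue centres it at (n - 1) / 2, the form required
      by \<open>alternating_power_sum\<close>.\<close>
    have "(real n ^ 2 - real n) / 2 - real n * real k = real n * (real (n - 1) / 2 - real k)"
      using n by (simp add: of_nat_diff power2_eq_square field_simps)
    then show "(-1) ^ k * real (n - 1 choose k) * ((real n ^ 2 - real n) / 2 - real n * real k) ^ ?m =
        real n ^ ?m * ((-1) ^ k * real (n - 1 choose k) * (real (n - 1) / 2 - real k) ^ ?m)"
      by (simp add: power_mult_distrib)
  qed
  also have "\<dots> = real n ^ ?m * (fact ?m * (sinhc_series ^ (n - 1)) $ h)"
    unfolding sum_distrib_left[symmetric] alternating_power_sum ..
  finally show ?thesis by simp
qed

lemma card_factorizations_0: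
  assumes n: "2 \<le> n"
  shows "card (factorizations n 0) = n ^ (n - 2)"
proof -
  have "(sinhc_series ^ N) $ 0 = 1" for N by (simp add: fps_power_zeroth sinhc_series_nth)
  then have "real (card (factorizations n 0)) * real n = real n ^ (n - 1)"
    using card_factorizations[OF n, of 0] by simp
  also have "\<dots> = real n ^ (n - 2) * real n" using n by (simp flip: power_Suc2 add: Suc_diff_Suc numeral_2_eq_2)
  finally have "real (card (factorizations n 0)) = real (n ^ (n - 2))" using n by simp
  then show ?thesis by (simp only: of_nat_eq_iff)
qed

text \<open>Compare coefficients of z^(h-1) in R (R^N)' = N R' R^N. The recurrence makes the
  dependence on N explicit for fixed h.\<close>

lemma power_coeff_rec:
  fixes R :: "real fps"
  assumes "R $ 0 = 1" "1 \<le> h"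
  shows "real h * (R ^ N) $ h = (\<Sum>k=1..h. R $ k * (real N * real k - real (h - k)) * (R ^ N) $ (h - k))"
proof (cases N)
  case 0
  then show ?thesis using assms(2) by (auto intro!: sum.neutral)
next
  case (Suc M)
  obtain g where g: "h = Suc g" using assms(2) by (cases h) auto
  let ?r = "\<lambda>j. (R ^ N) $ j"
  have "R * fps_deriv (R ^ N) = fps_const (real N) * fps_deriv R * R ^ N"
    unfolding Suc fps_deriv_power by (simp only: diff_Suc_1 power_Suc mult_ac)
  then have eq: "(R * fps_deriv (R ^ N)) $ g = (fps_const (real N) * (fps_deriv R * R ^ N)) $ g"
    by (simp add: mult.assoc)
  have "(R * fps_deriv (R ^ N)) $ g = (\<Sum>k=0..g. R $ k * (real (h - k) * ?r (h - k)))"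
    by (simp add: fps_mult_nth g Suc_diff_le cong: sum.cong) (intro sum.cong, auto simp: Suc_diff_le)
  also have "\<dots> = (\<Sum>k=0..h. R $ k * (real (h - k) * ?r (h - k)))" by (simp add: g)
  also have "\<dots> = real h * ?r h + (\<Sum>k=1..h. R $ k * (real (h - k) * ?r (h - k)))"
    using assms(1) by (simp add: sum.atLeast_Suc_atMost)
  finally have 1: "(R * fps_deriv (R ^ N)) $ g = real h * ?r h + (\<Sum>k=1..h. R $ k * (real (h - k) * ?r (h - k)))" .
  have "(fps_const (real N) * (fps_deriv R * R ^ N)) $ g = real N * (\<Sum>i=0..g. real (Suc i) * R $ Suc i * ?r (g - i))"
    unfolding fps_mult_left_const_nth by (simp add: fps_mult_nth)
  also have "(\<Sum>i=0..g. real (Suc i) * R $ Suc i * ?r (g - i)) = (\<Sum>k=1..h. real k * R $ k * ?r (h - k))"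
    unfolding g using sum.shift_bounds_cl_Suc_ivl[of "\<lambda>k. real k * R $ k * ?r (Suc g - k)" 0 g] by simp
  finally have 2: "(fps_const (real N) * (fps_deriv R * R ^ N)) $ g = real N * (\<Sum>k=1..h. real k * R $ k * ?r (h - k))" .
  have "real h * ?r h = real N * (\<Sum>k=1..h. real k * R $ k * ?r (h - k)) - (\<Sum>k=1..h. R $ k * (real (h - k) * ?r (h - k)))"
    using eq unfolding 1 2 by simp
  then show ?thesis by (simp add: sum_distrib_left algebra_simps flip: sum_subtractf)
qed

text \<open>After division by N^h the k-th term of the recurrence carries a factor N^(1-k), so only
  k = 1 survives in the limit, with coefficient 1/24.\<close>

lemma sinhc_power_asymp:
  "(\<lambda>N. (sinhc_series ^ N) $ h / real N ^ h) \<longlonglongrightarrow> 1 / (24 ^ h * fact h)"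
proof (induction h rule: less_induct)
  case (less h)
  show ?case
  proof (cases h)
    case 0
    have "(sinhc_series ^ N) $ 0 = 1" for N by (simp add: fps_power_zeroth sinhc_series_nth)
    then show ?thesis using 0 by simp
  next
    case (Suc g)
    let ?R = sinhc_series
    let ?r = "\<lambda>j N. (?R ^ N) $ j"
    have inv: "(\<lambda>N. 1 / real N) \<longlonglongrightarrow> 0" by (rule lim_1_over_n)
    let ?t = "\<lambda>k N. ?R $ k * (real k - real (h - k) * (1 / real N)) * (?r (h - k) N / real N ^ (h - k)) * (1 / real N) ^ (k - 1)"
    have lim: "(\<lambda>N. ?t k N) \<longlonglongrightarrow> (if k = 1 then 1 / (24 ^ h * fact g) else 0)" if k: "k \<in> {1..h}" for k
    proof -
      have "(\<lambda>N. ?t k N) \<longlonglongrightarrow> ?R $ k * (real k - real (h - k) * 0) * (1 / (24 ^ (h - k) * fact (h - k))) * 0 ^ (k - 1)"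
        by (intro tendsto_intros inv less) (use k Suc in auto)
      moreover have "?R $ k * (real k - real (h - k) * 0) * (1 / (24 ^ (h - k) * fact (h - k))) * 0 ^ (k - 1) =
          (if k = 1 then 1 / (24 ^ h * fact g) else 0)"
      proof (cases "k = 1")
        case True
        then show ?thesis using Suc by (simp add: sinhc_series_nth fact_numeral)
      qed (use k in \<open>auto simp: power_0_left\<close>)
      ultimately show ?thesis by simp
    qed
    have "(\<lambda>N. (\<Sum>k=1..h. ?t k N) / real h) \<longlonglongrightarrow> (\<Sum>k=1..h. if k = 1 then 1 / (24 ^ h * fact g) else 0) / real h"
      by (intro tendsto_divide tendsto_sum lim tendsto_const) (use Suc in auto)
    moreover have "(\<Sum>k=1..h. if k = 1 then 1 / (24 ^ h * fact g) else 0) / real h = (1 / (24 ^ h * fact h) :: real)"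
      using Suc by simp
    moreover have "eventually (\<lambda>N. (\<Sum>k=1..h. ?t k N) / real h = ?r h N / real N ^ h) sequentially"
    proof (rule eventually_sequentiallyI[of 1])
      fix N :: nat assume N: "1 \<le> N"
      have "real h * ?r h N = (\<Sum>k=1..h. ?R $ k * (real N * real k - real (h - k)) * ?r (h - k) N)"
        by (rule power_coeff_rec) (use Suc in \<open>auto simp: sinhc_series_nth\<close>)
      moreover have "?R $ k * (real N * real k - real (h - k)) * ?r (h - k) N = ?t k N * real N ^ h"
        if k: "k \<in> {1..h}" for k
      proof -
        have "real N ^ h = real N ^ (h - k) * real N ^ (k - 1) * real N"
          using k by (simp flip: power_add power_Suc2)
        then show ?thesis using N by (simp add: field_simps)
      qed
      ultimately have "real h * ?r h N = (\<Sum>k=1..h. ?t k N) * real N ^ h"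
        by (simp add: sum_distrib_right)
      moreover have "T / real h = r / real N ^ h" if "real h * r = T * real N ^ h" for T r :: real
      proof -
        have "real h > 0" "real N ^ h > 0" using N Suc by simp_all
        then show ?thesis using that by (simp add: frac_eq_eq mult.commute)
      qed
      ultimately show "(\<Sum>k=1..h. ?t k N) / real h = ?r h N / real N ^ h" by blast
    qed
    ultimately show ?thesis using Lim_transform_eventually by fastforce
  qed
qed

section \<open>Numbers of random choices and the ratio of inputs to outputs\<close>

lemma finite_pairs [simp]: "finite (pairs m)"
  by (rule finite_subset[of _ "{..m} \<times> {..m}"]) (auto simp: pairs_def)

lemma finite_triples [simp]: "finite (triples n)"
  by (rule finite_subset[of _ "{..n} \<times> {..n} \<times> {..n}"]) (auto simp: triples_def)

lemma card_pairs: "2 * real (card (pairs m)) = real m * (real m - 1)"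
proof (induction m)
  case 0
  have "pairs 0 = {}" by (auto simp: pairs_def)
  then show ?case by simp
next
  case (Suc m)
  have "pairs (Suc m) = pairs m \<union> (\<lambda>v. (v, Suc m)) ` {1..m}"
    by (auto simp: pairs_def le_Suc_eq)
  moreover have "pairs m \<inter> (\<lambda>v. (v, Suc m)) ` {1..m} = {}" by (auto simp: pairs_def)
  ultimately have "card (pairs (Suc m)) = card (pairs m) + m"
    by (simp add: card_Un_disjoint card_image inj_on_def)
  then show ?case using Suc by (simp add: algebra_simps)
qed

lemma card_triples: "6 * real (card (triples n)) = real n * (real n - 1) * (real n - 2)"
proof (induction n)
  case 0
  have "triples 0 = {}" by (auto simp: triples_def)
  then show ?case by simp
next
  case (Suc n)
  have "triples (Suc n) = triples n \<union> (\<lambda>(a, b). (a, b, Suc n)) ` pairs n"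
    by (auto simp: triples_def pairs_def le_Suc_eq image_iff)
  moreover have "triples n \<inter> (\<lambda>(a, b). (a, b, Suc n)) ` pairs n = {}" by (auto simp: triples_def)
  moreover have "inj_on (\<lambda>(a, b). (a, b, Suc n)) (pairs n)" by (auto simp: inj_on_def)
  ultimately have "card (triples (Suc n)) = card (triples n) + card (pairs n)"
    by (simp add: card_Un_disjoint card_image)
  then show ?case using Suc card_pairs[of n] by (simp add: algebra_simps)
qed

lemma factorizations_nonempty_eventually:
  "eventually (\<lambda>n. factorizations n h \<noteq> {}) sequentially"
proof -
  have "(\<lambda>n. (sinhc_series ^ (n - 1)) $ h / real (n - 1) ^ h) \<longlonglongrightarrow> 1 / (24 ^ h * fact h)"
    using sinhc_power_asymp[of h] by (rule filterlim_compose) (rule filterlim_minus_const_nat_at_top)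
  then have "eventually (\<lambda>n. 0 < (sinhc_series ^ (n - 1)) $ h / real (n - 1) ^ h) sequentially"
    by (rule order_tendstoD) simp
  then show ?thesis using eventually_ge_at_top[of 2]
  proof eventually_elim
    case (elim n)
    then have "0 < real n ^ (n - 1 + 2 * h) * fact (n - 1 + 2 * h) * (sinhc_series ^ (n - 1)) $ h"
      by (simp add: zero_less_divide_iff)
    then show ?case using card_factorizations[of n h] elim(2) by auto
  qed
qed

text \<open>With m = n - 1 + 2h, raising the genus multiplies the count by about n^2 (m + 1) (m + 2)
  n / (24 (h + 1)), while the random choices number about (m + 1) (m + 2) n^3 / 12. The quotient 2
  (h + 1) is the bound on special vertices in genus h + 1.\<close>

lemma factorizations_ratio:
  "(\<lambda>n. 2 * real (Suc h) * real (card (factorizations n (Suc h))) /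
     (real (card (factorizations n h)) * real (card (pairs (n - 1 + 2 * Suc h))) * real (card (triples n)))) \<longlonglongrightarrow> 1"
proof -
  let ?r = "\<lambda>j n. (sinhc_series ^ (n - 1)) $ j / real (n - 1) ^ j"
  have lim: "?r j \<longlonglongrightarrow> 1 / (24 ^ j * fact j)" for j
    using sinhc_power_asymp[of j] by (rule filterlim_compose) (rule filterlim_minus_const_nat_at_top)
  have "(\<lambda>n::nat. real n / (real n - 2)) \<longlonglongrightarrow> 1" by real_asymp
  then have "(\<lambda>n. 24 * real (Suc h) * (?r (Suc h) n / ?r h n) * (real n / (real n - 2)))
      \<longlonglongrightarrow> 24 * real (Suc h) * ((1 / (24 ^ Suc h * fact (Suc h))) / (1 / (24 ^ h * fact h))) * 1"
    by (intro tendsto_mult tendsto_divide tendsto_const lim) auto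
  moreover have "24 * real (Suc h) * ((1 / (24 ^ Suc h * fact (Suc h))) / (1 / (24 ^ h * fact h))) * 1 = (1::real)"
    by (simp add: divide_simps)
  moreover have "eventually (\<lambda>n. 24 * real (Suc h) * (?r (Suc h) n / ?r h n) * (real n / (real n - 2)) =
     2 * real (Suc h) * real (card (factorizations n (Suc h))) /
     (real (card (factorizations n h)) * real (card (pairs (n - 1 + 2 * Suc h))) * real (card (triples n)))) sequentially"
    using eventually_ge_at_top[of 3] factorizations_nonempty_eventually[of h]
  proof eventually_elim
    case (elim n)
    define m where "m = n - 1 + 2 * h"
    have mm: "n - 1 + 2 * Suc h = Suc (Suc m)" by (simp add: m_def)
    define s s' where "s = (sinhc_series ^ (n - 1)) $ h" and "s' = (sinhc_series ^ (n - 1)) $ Suc h"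
    define f f' where "f = real (card (factorizations n h))" and "f' = real (card (factorizations n (Suc h)))"
    have n: "real n > 2" using elim by simp
    have f: "f * (real n * fact (n - 1)) = real n ^ m * fact m * s"
      using card_factorizations[of n h] elim by (simp add: f_def s_def m_def)
    have f': "f' * (real n * fact (n - 1)) = real n ^ m * (real n)^2 * (fact m * (real m + 1) * (real m + 2)) * s'"
      using card_factorizations[of n "Suc h"] elim unfolding mm by (simp add: f'_def s'_def power2_eq_square algebra_simps)
    have fpos: "f > 0" using elim(2) by (simp add: f_def card_gt_0_iff)
    have spos: "s \<noteq> 0" using f fpos n by auto
    have K: "real n * fact (n - 1) > 0" "real n ^ m * fact m > 0" using n by auto
    have ratio: "f' / f = (real n)^2 * (real m + 1) * (real m + 2) * s' / s"
    proof -
      have "f' / f = (f' * (real n * fact (n - 1))) / (f * (real n * fact (n - 1)))"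
        by (rule mult_divide_mult_cancel_right[symmetric]) (rule less_imp_neq[OF K(1), symmetric])
      also have "\<dots> = (real n ^ m * fact m) * ((real n)^2 * (real m + 1) * (real m + 2) * s') / ((real n ^ m * fact m) * s)"
        unfolding f f' by (simp add: mult_ac)
      also have "\<dots> = (real n)^2 * (real m + 1) * (real m + 2) * s' / s" using K by simp
      finally show ?thesis .
    qed
    have P: "real (card (pairs (Suc (Suc m)))) = (real m + 2) * (real m + 1) / 2"
      using card_pairs[of "Suc (Suc m)"] by (simp add: algebra_simps)
    have T: "real (card (triples n)) = real n * (real n - 1) * (real n - 2) / 6" using card_triples[of n] by simp
    have r: "?r (Suc h) n / ?r h n = s' / s / (real n - 1)"
      using n elim(1) by (simp add: s_def s'_def of_nat_diff)
    have "2 * real (Suc h) * f' / (f * ((real m + 2) * (real m + 1) / 2) * (real n * (real n - 1) * (real n - 2) / 6)) =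
      24 * real (Suc h) * (f' / f) / ((real m + 2) * (real m + 1) * (real n * (real n - 1) * (real n - 2)))"
      by (simp add: field_simps)
    also have "\<dots> = 24 * real (Suc h) * (s' / s / (real n - 1)) * (real n / (real n - 2))"
      unfolding ratio using n spos by (simp add: divide_simps power2_eq_square)
    finally show ?case unfolding mm P T r f_def[symmetric] f'_def[symmetric] by simp
  qed
  ultimately show ?thesis using Lim_transform_eventually by fastforce
qed

section \<open>Minimal factorizations\<close>

lemma transp_on_mono: "S \<subseteq> T \<Longrightarrow> transp_on S \<subseteq> transp_on T"
  by (auto elim!: transp_onE intro: transp_onI)

lemma full_cycle_funpow_apply:
  assumes "1 \<le> n" "k < n" "1 \<le> i" "i \<le> n"
  shows "(full_cycle n ^^ k) i = (if i + k \<le> n then i + k else i + k - n)"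
  using assms(2)
proof (induction k)
  case (Suc k)
  then have IH: "(full_cycle n ^^ k) i = (if i + k \<le> n then i + k else i + k - n)" by simp
  show ?case
  proof (cases "i + k \<le> n")
    case True
    then show ?thesis using IH full_cycle_simps(1)[OF assms(1), of "i + k"] full_cycle_simps(2)[OF assms(1)] assms Suc.prems
      by (cases "i + k = n") auto
  next
    case False
    then show ?thesis using IH full_cycle_simps(1)[OF assms(1), of "i + k - n"] assms Suc.prems by auto
  qed
qed (use assms in auto)

definition visits :: "nat \<Rightarrow> nat \<Rightarrow> nat \<Rightarrow> (nat \<Rightarrow> nat) list set" where
  "visits n x j = {ts \<in> factorizations n 0. \<exists>s\<le>length ts. pos ts s x = j}"

lemma finite_visits [simp]: "finite (visits n x j)"
  by (simp add: visits_def)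

text \<open>Conjugation by a power of the full cycle preserves factorizations of it and moves x to
  1, so only the trajectory of vertex 1 has to be studied.\<close>

lemma card_visits_rotate:
  assumes x: "1 \<le> x" "x \<le> n" and d: "1 \<le> d" "d \<le> n" and j: "j = (if d + (x - 1) \<le> n then d + (x - 1) else d + (x - 1) - n)"
  shows "card (visits n x j) \<le> card (visits n 1 d)"
proof -
  have n: "1 \<le> n" using x by simp
  define \<rho> where "\<rho> = full_cycle n ^^ (x - 1)"
  have rp: "\<rho> permutes {1..n}" unfolding \<rho>_def using permutes_funpow[OF full_cycle_permutes] .
  have r: "\<rho> 1 = x" "\<rho> d = j"
    using full_cycle_funpow_apply[OF n, of "x - 1" 1] full_cycle_funpow_apply[OF n, of "x - 1" d] x d j
    by (auto simp: \<rho>_def)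
  have b: "bij \<rho>" and bi: "bij (inv \<rho>)" using rp permutes_bij bij_imp_bij_inv by blast+
  have ri: "inv \<rho> x = 1" "inv \<rho> j = d" using r permutes_inv_eq[OF rp] by auto
  have "conj_by \<rho> (full_cycle n) = full_cycle n"
    using conj_by_eqI[OF b, of "full_cycle n" "full_cycle n"] by (simp add: \<rho>_def funpow_swap1)
  then have rc: "conj_by (inv \<rho>) (full_cycle n) = full_cycle n" using conj_by_inv_cancel[OF b] by metis
  show ?thesis
  proof (rule card_inj_on_le[of "map (conj_by (inv \<rho>))"])
    show "inj_on (map (conj_by (inv \<rho>))) (visits n x j)"
      by (rule inj_on_inverseI[of _ "map (conj_by \<rho>)"]) (rule map_conj_inv_cancel'[OF b])
    show "map (conj_by (inv \<rho>)) ` visits n x j \<subseteq> visits n 1 d"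
    proof
      fix u assume "u \<in> map (conj_by (inv \<rho>)) ` visits n x j"
      then obtain ts s where ts: "ts \<in> factorizations n 0" "s \<le> length ts" "pos ts s x = j"
        and u: "u = map (conj_by (inv \<rho>)) ts" by (auto simp: visits_def)
      have "u \<in> factorizations n 0"
        using ts(1) map_conj_transp_lists[OF permutes_inv[OF rp]] rc
        unfolding u factorizations_transp_lists by (auto simp: perm_prod_conj[OF bi])
      moreover have "pos u s 1 = d" using pos_conj[OF bi, of ts s x] ts(3) ri by (simp add: u)
      ultimately show "u \<in> visits n 1 d" using ts(2) by (auto simp: visits_def u)
    qed
  qed simp
qed

text \<open>c labels the connected components of the graph whose edges are the factors; each edge
  merges at most two labels.\<close>

lemma component_function:
  assumes "finite Z" "set ts \<subseteq> transp_on Z"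
  shows "\<exists>c :: nat \<Rightarrow> nat. (\<forall>t\<in>set ts. \<forall>x. c (t x) = c x) \<and> card Z \<le> card (c ` Z) + length ts"
  using assms(2)
proof (induction ts)
  case Nil
  show ?case by (rule exI[of _ id]) simp
next
  case (Cons t ts)
  then obtain c :: "nat \<Rightarrow> nat" where c: "\<forall>t\<in>set ts. \<forall>x. c (t x) = c x" "card Z \<le> card (c ` Z) + length ts" by auto
  from Cons obtain i j where ij: "i \<in> Z" "j \<in> Z" "t = tr i j" by (auto elim: transp_onE)
  define c' where "c' x = (if c x = c j then c i else c x)" for x
  have "c ` Z - {c j} \<subseteq> c' ` Z" by (auto simp: c'_def)
  then have "card (c ` Z) - 1 \<le> card (c' ` Z)"
    using card_mono[of "c' ` Z" "c ` Z - {c j}"] assms(1) card_Diff1_le[of "c ` Z" "c j"]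
      diff_card_le_card_Diff[of "{c j}" "c ` Z"] by simp
  then show ?case
    by (intro exI[of _ c']) (use c ij in \<open>auto simp: c'_def Transposition.transpose_def\<close>)
qed

lemma const_on_interval:
  fixes c :: "nat \<Rightarrow> 'a"
  assumes "\<And>k. l \<le> k \<Longrightarrow> k < u \<Longrightarrow> c (Suc k) = c k" "x \<in> {l..u}"
  shows "c x = c l"
proof -
  have "l \<le> x" "x \<le> u" using assms(2) by auto
  then show ?thesis by (induction x rule: dec_induct) (use assms(1) in auto)
qed

lemma component_perm_prod: "(\<forall>t\<in>set ts. \<forall>x. c (t x) = c x) \<Longrightarrow> c (perm_prod ts x) = c x"
  by (induction ts arbitrary: x) auto

lemma list_eq_by_filters:
  assumes "length xs = length ys" "{i. i < length xs \<and> P (xs ! i)} = {i. i < length ys \<and> P (ys ! i)}"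
    "filter P xs = filter P ys" "filter (\<lambda>x. \<not> P x) xs = filter (\<lambda>x. \<not> P x) ys"
  shows "xs = ys"
  using assms
proof (induction xs ys rule: list_induct2)
  case (Cons x xs y ys)
  have "P ((x # xs) ! i) = P ((y # ys) ! i)" if "i < Suc (length xs)" for i
    using Cons.prems(1) Cons.hyps that by auto
  then have "P x = P y" "\<And>i. i < length xs \<Longrightarrow> P (xs ! i) = P (ys ! i)" by force+
  then show ?case using Cons by (auto split: if_splits)
qed simp

lemma perm_prod_filter:
  assumes "set ts \<subseteq> transp_on X \<union> transp_on Y" "x \<in> X"
    and P: "\<And>t. t \<in> transp_on X \<Longrightarrow> P t" "\<And>t. t \<in> transp_on Y \<Longrightarrow> \<not> P t" "X \<inter> Y = {}"
  shows "perm_prod ts x = perm_prod (filter P ts) x"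
  using assms(1,2)
proof (induction ts arbitrary: x)
  case (Cons t ts)
  show ?case
  proof (cases "t \<in> transp_on X")
    case True
    then have "t x \<in> X" using permutes_in_image[OF transp_on_permutes] Cons.prems by blast
    then show ?thesis using Cons P(1)[OF True] by simp
  next
    case False
    then have t: "t \<in> transp_on Y" using Cons.prems by simp
    have "x \<notin> Y" using P(3) Cons.prems(2) by blast
    then have "t x = x" using permutes_not_in[OF transp_on_permutes[OF t]] by blast
    then show ?thesis using Cons P(2)[OF t] by simp
  qed
qed simp

text \<open>Splitting the vertex 1 at time \<open>s\<close>, the later factors being attached to the new vertex
  \<open>n + 1\<close>, cuts a minimal factorization into minimal factorizations of the cycles
  \<open>(1 \<dots> d)\<close> and \<open>(d+1 \<dots> n+1)\<close>.\<close>

lemma card_visits_1: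
  assumes d: "2 \<le> d" "d < n"
  shows "card (visits n 1 d) \<le> (n - 1 choose (d - 1)) * (card (factorizations d 0) * card (factorizations (n + 1 - d) 0))"
proof -
  let ?z = "Suc n"
  let ?\<tau> = "tr 1 ?z"
  let ?X = "{1..d}" and ?Y = "{Suc d..?z}" and ?Z = "{1..?z}"
  have n: "1 \<le> n" using d by simp
  note fc = full_cycle_simps[OF n]
  define P :: "(nat \<Rightarrow> nat) \<Rightarrow> bool" where "P t \<longleftrightarrow> (\<exists>x\<in>?X. t x \<noteq> x)" for t
  \<comment> \<open>Undoes the splitting: a factor moving n + 1 comes from a later factor moving
    1.\<close>
  define \<psi> where "\<psi> t = (if t ?z \<noteq> ?z then conj_by ?\<tau> t else t)" for t
  define cut where "cut ts = (SOME s. s \<le> length ts \<and> pos ts s 1 = d)" for ts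
  define sp where "sp ts = take (cut ts) ts @ map (conj_by ?\<tau>) (drop (cut ts) ts)" for ts
  \<comment> \<open>Carries {1..n+1-d} increasingly onto {d+1..n+1}, which turns the second piece
    into a factorization of a standard cycle.\<close>
  define \<gamma> where "\<gamma> = full_cycle ?z ^^ d"
  have gp: "\<gamma> permutes ?Z" unfolding \<gamma>_def using permutes_funpow[OF full_cycle_permutes] .
  have gb: "bij \<gamma>" using gp permutes_bij by blast
  have gapp: "\<gamma> i = i + d" if "1 \<le> i" "i \<le> n + 1 - d" for i
    using full_cycle_funpow_apply[of ?z d i] that d by (simp add: \<gamma>_def)
  have gim: "\<gamma> ` {1..n + 1 - d} = ?Y"
  proof -
    have "\<gamma> ` {1..n + 1 - d} = (\<lambda>i. i + d) ` {1..n + 1 - d}" by (rule image_cong) (auto simp: gapp)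
    also have "\<dots> = ?Y" using d by (simp add: image_add_atLeastAtMost')
    finally show ?thesis .
  qed
  have tb: "bij ?\<tau>" by simp
  have tc: "conj_by ?\<tau> (conj_by ?\<tau> t) = t" for t
    using conj_by_inv_cancel[OF tb] by simp
  have PX: "P t" if tX: "t \<in> transp_on ?X" for t 
  proof -
    obtain i j where "i \<in> ?X" "i \<noteq> j" "t = tr i j" using transp_onE[OF tX] by blast
    then have "t i \<noteq> i" "i \<in> ?X" by auto
    then show ?thesis unfolding P_def by blast
  qed
  have PY: "\<not> P t" if "t \<in> transp_on ?Y" for t
    using permutes_not_in[OF transp_on_permutes[OF that]] by (auto simp: P_def)
  have sp: "map \<psi> (sp ts) = ts \<and> length (sp ts) = n - 1 \<and> set (sp ts) \<subseteq> transp_on ?X \<union> transp_on ?Y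
      \<and> filter P (sp ts) \<in> factorizations d 0
      \<and> map (conj_by (inv \<gamma>)) (filter (\<lambda>t. \<not> P t) (sp ts)) \<in> factorizations (n + 1 - d) 0"
    if "ts \<in> visits n 1 d" for ts
  proof -
    have F: "set ts \<subseteq> transp_on {1..n}" "length ts = n - 1" "perm_prod ts = full_cycle n"
      using that by (auto simp: visits_def factorizations_def transpositions_eq)
    have "\<exists>s. s \<le> length ts \<and> pos ts s 1 = d" using that by (auto simp: visits_def)
    then have s: "cut ts \<le> length ts" "pos ts (cut ts) 1 = d"
      unfolding cut_def by (metis (mono_tags, lifting) someI_ex)+
    define Q R where "Q = perm_prod (take (cut ts) ts)" "R = perm_prod (drop (cut ts) ts)"
    have sub: "set (take (cut ts) ts) \<subseteq> transp_on {1..n}" "set (drop (cut ts) ts) \<subseteq> transp_on {1..n}"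
      using F(1) set_take_subset set_drop_subset by (metis order_trans)+
    have Qp: "Q permutes {1..n}" and Rp: "R permutes {1..n}"
      unfolding Q_R_def using sub perm_prod_permutes by blast+
    have Qd: "Q d = 1" using perm_prod_inv_prod[OF sub(1), of 1] s(2) by (simp add: Q_R_def pos_def)
    have RQ: "R (Q x) = full_cycle n x" for x
      using perm_prod_append[of "take (cut ts) ts" "drop (cut ts) ts"] F(3) by (simp add: Q_R_def fun_eq_iff)
    have zf: "t ?z = ?z" if "t permutes {1..n}" for t using permutes_not_in[OF that] by simp
    have psi1: "\<psi> t = t" if "t \<in> transp_on {1..n}" for t
      using zf[OF transp_on_permutes[OF that]] by (simp add: \<psi>_def)
    have psi2: "\<psi> (conj_by ?\<tau> t) = t" if tn: "t \<in> transp_on {1..n}" for t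
    proof -
      obtain i j where ij: "i \<in> {1..n}" "j \<in> {1..n}" "i \<noteq> j" "t = tr i j"
        using transp_onE[OF tn] by blast
      have c: "conj_by ?\<tau> t = tr (?\<tau> i) (?\<tau> j)"
        unfolding ij(4) by (rule conj_by_transpose[OF tb])
      show ?thesis
      proof (cases "i = 1 \<or> j = 1")
        case True
        then have "conj_by ?\<tau> t ?z \<noteq> ?z" unfolding c using ij by (auto simp: Transposition.transpose_def)
        then show ?thesis unfolding \<psi>_def tc by (simp only: if_True not_False_eq_True)
      next
        case False
        then have "?\<tau> i = i" "?\<tau> j = j" using ij by (auto simp: Transposition.transpose_def)
        then have "conj_by ?\<tau> t = t" using c ij by simp
        then show ?thesis using psi1[OF tn] by simp
      qed
    qed
    have m: "map \<psi> (sp ts) = ts"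
    proof -
      have "map \<psi> (take (cut ts) ts) = take (cut ts) ts"
        using sub(1) psi1 by (intro map_idI) blast
      moreover have "map \<psi> (map (conj_by ?\<tau>) (drop (cut ts) ts)) = drop (cut ts) ts"
        unfolding map_map o_def using sub(2) psi2 by (intro map_idI) blast
      ultimately show ?thesis unfolding sp_def map_append by simp
    qed
    have len: "length (sp ts) = n - 1" using F(2) s(1) by (simp add: sp_def)
    have mono: "transp_on {1..n} \<subseteq> transp_on ?Z" by (rule transp_on_mono) auto
    have tim: "?\<tau> ` ?Z = ?Z" by (rule transpose_image_eq) (use n in auto)
    have setZ: "set (sp ts) \<subseteq> transp_on ?Z"
    proof -
      have "conj_by ?\<tau> t \<in> transp_on ?Z" if "t \<in> transp_on {1..n}" for t
        using conj_by_transp_on[OF tb, of t ?Z] that mono tim by auto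
      then show ?thesis using sub mono by (auto simp: sp_def)
    qed
    define \<pi> where "\<pi> = perm_prod (sp ts)"
    have pi: "\<pi> x = ?\<tau> (R (?\<tau> (Q x)))" for x
      unfolding \<pi>_def sp_def perm_prod_append perm_prod_conj[OF tb] Q_R_def conj_by_def inv_transpose_eq comp_apply ..
    have pi_d: "\<pi> d = 1" using Qd zf[OF Rp] by (simp add: pi)
    have pi_z: "\<pi> ?z = Suc d"
    proof -
      have "R 1 = Suc d" using RQ[of d] Qd fc(1)[of d] d by simp
      then show ?thesis using zf[OF Qp] d by (auto simp: pi Transposition.transpose_def)
    qed
    have pi_i: "\<pi> i = (if i = n then ?z else Suc i)" if i: "1 \<le> i" "i \<le> n" "i \<noteq> d" for i
    proof -
      have q: "Q i \<in> {1..n}" using permutes_in_image[OF Qp] i by simp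
      have "Q i \<noteq> 1" using Qd i permutes_inj[OF Qp] by (metis injD)
      then have "?\<tau> (Q i) = Q i" using q by (auto simp: Transposition.transpose_def)
      then have "\<pi> i = ?\<tau> (full_cycle n i)" using RQ by (simp add: pi)
      then show ?thesis using fc(1)[of i] fc(2) i by (auto simp: Transposition.transpose_def)
    qed
    have up: "\<pi> i = Suc i" if "1 \<le> i" "i \<le> n" "i \<noteq> d" for i using pi_i[OF that] by simp
    obtain c :: "nat \<Rightarrow> nat" where c: "\<forall>t\<in>set (sp ts). \<forall>x. c (t x) = c x" "card ?Z \<le> card (c ` ?Z) + length (sp ts)"
      using component_function[OF _ setZ] by auto
    have cpi: "c (\<pi> x) = c x" for x unfolding \<pi>_def by (rule component_perm_prod[OF c(1)])
    have cX: "c x = c 1" if "x \<in> ?X" for x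
    proof (rule const_on_interval[OF _ that])
      show "c (Suc k) = c k" if "1 \<le> k" "k < d" for k using cpi[of k] up[of k] d that by auto
    qed
    have cY: "c x = c (Suc d)" if "x \<in> ?Y" for x
    proof (rule const_on_interval[OF _ that])
      show "c (Suc k) = c k" if "Suc d \<le> k" "k < ?z" for k using cpi[of k] up[of k] d that by auto
    qed
    have ZXY: "?Z = ?X \<union> ?Y" using d by auto
    \<comment> \<open>A graph with n - 1 edges on n + 1 vertices is disconnected, while \<pi>
      connects the points within each interval. So the two intervals are the components.\<close>
    have cne: "c 1 \<noteq> c (Suc d)"
    proof
      assume eq: "c 1 = c (Suc d)"
      have "c x = c 1" if "x \<in> ?Z" for x using that cX[of x] cY[of x] eq unfolding ZXY by auto
      then have "c ` ?Z \<subseteq> {c 1}" by blast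
      then have "card (c ` ?Z) \<le> 1" using card_mono[of "{c 1}" "c ` ?Z"] by simp
      then show False using c(2) len n by simp
    qed
    have sXY: "set (sp ts) \<subseteq> transp_on ?X \<union> transp_on ?Y"
    proof
      fix t assume t: "t \<in> set (sp ts)"
      then obtain i j where ij: "i \<in> ?Z" "j \<in> ?Z" "i \<noteq> j" "t = tr i j"
        using setZ by (meson subsetD transp_onE)
      have "c j = c i" using c(1) t ij(4) by (metis transpose_apply_first)
      then have "(i \<in> ?X \<and> j \<in> ?X) \<or> (i \<in> ?Y \<and> j \<in> ?Y)"
        using ij(1,2) cX[of i] cX[of j] cY[of i] cY[of j] cne unfolding ZXY by (metis UnE)
      then show "t \<in> transp_on ?X \<union> transp_on ?Y" using ij transp_onI by blast
    qed
    define A B where "A = filter P (sp ts)" "B = filter (\<lambda>t. \<not> P t) (sp ts)"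
    have disj: "?X \<inter> ?Y = {}" by auto
    have setA: "set A \<subseteq> transp_on ?X" and setB: "set B \<subseteq> transp_on ?Y"
      unfolding A_B_def using sXY PX PY by auto
    have prodA: "perm_prod A x = \<pi> x" if "x \<in> ?X" for x
      unfolding A_B_def \<pi>_def using perm_prod_filter[OF sXY that, of P] PX PY disj by auto
    have prodB: "perm_prod B x = \<pi> x" if "x \<in> ?Y" for x
      unfolding A_B_def \<pi>_def using perm_prod_filter[OF sXY[unfolded Un_commute[of "transp_on ?X"]] that, of "\<lambda>t. \<not> P t"] PX PY disj by auto
    \<comment> \<open>Connecting the intervals takes at least d - 1 and n - d factors. There are n -
      1 altogether, so both pieces are minimal.\<close>
    have lenA: "d \<le> length A + 1"
    proof -
      obtain c :: "nat \<Rightarrow> nat" where c: "\<forall>t\<in>set A. \<forall>x. c (t x) = c x" "card ?X \<le> card (c ` ?X) + length A"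
        using component_function[OF _ setA] by auto
      have cp: "c (\<pi> x) = c x" if "x \<in> ?X" for x using component_perm_prod[OF c(1)] prodA[OF that] by metis
      have "c x = c 1" if "x \<in> ?X" for x
      proof (rule const_on_interval[OF _ that])
        show "c (Suc k) = c k" if "1 \<le> k" "k < d" for k using cp[of k] up[of k] d that by auto
      qed
      then have "c ` ?X \<subseteq> {c 1}" by blast
      then have "card (c ` ?X) \<le> 1" using card_mono[of "{c 1}" "c ` ?X"] by simp
      then show ?thesis using c(2) by simp
    qed
    have lenB: "n + 1 - d \<le> length B + 1"
    proof -
      obtain c :: "nat \<Rightarrow> nat" where c: "\<forall>t\<in>set B. \<forall>x. c (t x) = c x" "card ?Y \<le> card (c ` ?Y) + length B"
        using component_function[OF _ setB] by auto
      have cp: "c (\<pi> x) = c x" if "x \<in> ?Y" for x using component_perm_prod[OF c(1)] prodB[OF that] by metis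
      have "c x = c (Suc d)" if "x \<in> ?Y" for x
      proof (rule const_on_interval[OF _ that])
        show "c (Suc k) = c k" if "Suc d \<le> k" "k < ?z" for k using cp[of k] up[of k] d that by auto
      qed
      then have "c ` ?Y \<subseteq> {c (Suc d)}" by blast
      then have "card (c ` ?Y) \<le> 1" using card_mono[of "{c (Suc d)}" "c ` ?Y"] by simp
      then show ?thesis using c(2) by simp
    qed
    have "length A + length B = n - 1"
      using sum_length_filter_compl[of P "sp ts"] len by (simp add: A_B_def)
    then have lens: "length A = d - 1" "length B = n + 1 - d - 1" using lenA lenB d by auto
    have "perm_prod A x = full_cycle d x" for x
    proof (cases "x \<in> ?X")
      case True
      then show ?thesis using prodA[OF True] pi_d up[of x] full_cycle_simps(1)[of d x] full_cycle_simps(2)[of d] d by (cases "x = d") auto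
    next
      case False
      then show ?thesis using permutes_not_in[OF perm_prod_permutes[OF setA] False]
          permutes_not_in[OF full_cycle_permutes False] by simp
    qed
    then have fA: "A \<in> factorizations d 0"
      using lens(1) setA by (auto simp: factorizations_def transpositions_eq)
    have "conj_by \<gamma> (full_cycle (n + 1 - d)) = perm_prod B"
    proof (rule conj_by_eqI[OF gb])
      fix i
      show "perm_prod B (\<gamma> i) = \<gamma> (full_cycle (n + 1 - d) i)"
      proof (cases "i \<in> {1..n + 1 - d}")
        case True
        then have g: "\<gamma> i = i + d" "\<gamma> i \<in> ?Y" using gapp[of i] d by auto
        show ?thesis
        proof (cases "i = n + 1 - d")
          case True
          then have "\<gamma> i = ?z" using g d by simp
          then show ?thesis using prodB[OF g(2)] pi_z full_cycle_simps(2)[of "n + 1 - d"] gapp[of 1] d True by simp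
        next
          case False
          then show ?thesis using prodB[OF g(2)] up[of "i + d"] full_cycle_simps(1)[of "n + 1 - d" i] gapp[of "Suc i"] d True g by auto
        qed
      next
        case False
        then have "\<gamma> i \<notin> ?Y" using gim gb by (metis bij_is_inj inj_image_mem_iff)
        then show ?thesis using permutes_not_in[OF perm_prod_permutes[OF setB]]
          permutes_not_in[OF full_cycle_permutes False] by simp
      qed
    qed
    then have pB: "perm_prod (map (conj_by (inv \<gamma>)) B) = full_cycle (n + 1 - d)"
      using perm_prod_conj[OF bij_imp_bij_inv[OF gb], of B] conj_by_inv_cancel[OF gb] by metis
    have "inv \<gamma> ` ?Y = {1..n + 1 - d}" unfolding gim[symmetric] using gb by (simp add: bij_is_inj image_inv_f_f)
    then have "set (map (conj_by (inv \<gamma>)) B) \<subseteq> transp_on {1..n + 1 - d}"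
      using conj_by_transp_on[OF bij_imp_bij_inv[OF gb], of _ ?Y] setB by auto
    then have fB: "map (conj_by (inv \<gamma>)) B \<in> factorizations (n + 1 - d) 0"
      using lens(2) pB by (auto simp: factorizations_def transpositions_eq)
    show ?thesis using m len sXY fA fB unfolding A_B_def by blast
  qed
  note spm = sp[THEN conjunct1] and spl = sp[THEN conjunct2, THEN conjunct1]
    and spf = sp[THEN conjunct2, THEN conjunct2, THEN conjunct2]
  \<comment> \<open>The split list is a shuffle of its two pieces; the times of the first piece form
    the subset counted by the binomial coefficient.\<close>
  define enc where "enc ts = ({i. i < length (sp ts) \<and> P (sp ts ! i)}, filter P (sp ts),
      map (conj_by (inv \<gamma>)) (filter (\<lambda>t. \<not> P t) (sp ts)))" for ts
  have inj: "inj_on enc (visits n 1 d)"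
  proof (rule inj_onI)
    fix ts us assume v: "ts \<in> visits n 1 d" "us \<in> visits n 1 d" and e: "enc ts = enc us"
    have "map (conj_by (inv \<gamma>)) (filter (\<lambda>t. \<not> P t) (sp ts)) = map (conj_by (inv \<gamma>)) (filter (\<lambda>t. \<not> P t) (sp us))"
      using e unfolding enc_def prod.inject by (elim conjE)
    from arg_cong[OF this, of "map (conj_by \<gamma>)"]
    have "filter (\<lambda>t. \<not> P t) (sp ts) = filter (\<lambda>t. \<not> P t) (sp us)"
      unfolding map_conj_inv_cancel'[OF gb] .
    moreover have "{i. i < length (sp ts) \<and> P (sp ts ! i)} = {i. i < length (sp us) \<and> P (sp us ! i)}"
      and "filter P (sp ts) = filter P (sp us)"
      using e unfolding enc_def prod.inject by blast+
    moreover have "length (sp ts) = length (sp us)" using spl[OF v(1)] spl[OF v(2)] by simp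
    ultimately have "sp ts = sp us" by (rule_tac list_eq_by_filters[of _ _ P])
    then have "map \<psi> (sp ts) = map \<psi> (sp us)" by (rule arg_cong)
    then show "ts = us" unfolding spm[OF v(1)] spm[OF v(2)] .
  qed
  let ?T = "{I. I \<subseteq> {..<n - 1} \<and> card I = d - 1} \<times> (factorizations d 0 \<times> factorizations (n + 1 - d) 0)"
  have "enc ` visits n 1 d \<subseteq> ?T"
  proof
    fix q assume "q \<in> enc ` visits n 1 d"
    then obtain ts where v: "ts \<in> visits n 1 d" and q: "q = enc ts" by blast
    have "card {i. i < length (sp ts) \<and> P (sp ts ! i)} = d - 1"
      using spf[OF v] length_filter_conv_card[of P "sp ts"] by (simp add: factorizations_def)
    moreover have "{i. i < length (sp ts) \<and> P (sp ts ! i)} \<subseteq> {..<n - 1}" using spl[OF v] by auto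
    ultimately show "q \<in> ?T" using spf[OF v] unfolding q enc_def by blast
  qed
  moreover have "finite ?T" by (simp add: finite_subset[of _ "Pow {..<n - 1}"] subset_iff)
  ultimately have "card (visits n 1 d) \<le> card ?T" using card_inj_on_le[OF inj] by blast
  also have "\<dots> = (n - 1 choose (d - 1)) * (card (factorizations d 0) * card (factorizations (n + 1 - d) 0))"
    by (simp add: card_cartesian_product n_subsets)
  finally show ?thesis .
qed

text \<open>At a mode of the binomial distribution the weights vary slowly, so \<open>J\<close> of them are at
  least half of the maximal one.\<close>

lemma binomial_mode_bound:
  fixes d e J :: nat
  assumes J: "1 \<le> J" and de: "4 * J * (J + 1) \<le> d" "4 * J * (J + 1) \<le> e"
  shows "real ((d + e - 2) choose (d - 1)) * (real d / real (d + e)) ^ (d - 1) * (real e / real (d + e)) ^ (e - 1) \<le> 2 / real J"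
proof -
  define N p q where "N = d + e - 2" "p = real d / real (d + e)" "q = real e / real (d + e)"
  note Npq = N_p_q_def
  have J8: "2 * (J + 1) \<le> 4 * J * (J + 1)" "J < 4 * J * (J + 1)" using J by (simp_all add: algebra_simps)
  have de1: "1 \<le> d" "1 \<le> e" "J + 1 \<le> d" "J + 1 \<le> e" using de J8 by linarith+
  have pq: "p > 0" "q > 0" "p + q = 1" using de1 by (simp_all add: Npq add_divide_distrib[symmetric])
  define w where "w k = real (N choose k) * p ^ k * q ^ (N - k)" for k
  define B where "B t = w (d - 1 + t)" for t
  have w0: "0 \<le> w k" for k using pq by (simp add: w_def)
  have sum: "(\<Sum>t<J. B t) \<le> 1"
  proof -
    have "(\<Sum>t<J. B t) = (\<Sum>k\<in>(\<lambda>t. d - 1 + t) ` {..<J}. w k)"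
      unfolding B_def by (subst sum.reindex) (auto simp: inj_on_def)
    also have "\<dots> \<le> (\<Sum>k\<le>N. w k)"
      by (rule sum_mono2) (use w0 de1 in \<open>auto simp: Npq\<close>)
    also have "\<dots> = (p + q) ^ N" unfolding w_def by (rule binomial_ring[symmetric])
    finally show ?thesis using pq by simp
  qed
  \<comment> \<open>Chosen so that (1 - \<epsilon>)^t is at least 1/2 for t < J, by Bernoulli's
    inequality.\<close>
  define \<epsilon> where "\<epsilon> = 1 / (2 * real J)"
  have e0: "0 < \<epsilon>" "\<epsilon> \<le> 1" using J by (auto simp: \<epsilon>_def field_simps)
  \<comment> \<open>The quotient of successive weights at k = d - 1 + t is (e - 1 - t) d / ((d + t)
    e); the lower bounds on d and e keep it at or above 1 - \<epsilon>.\<close>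
  have step: "(1 - \<epsilon>) * B t \<le> B (Suc t)" if t: "t < J" for t
  proof -
    define k where "k = d - 1 + t"
    have kN: "k < N" "Suc k = d + t" "N - k = e - 1 - t" using t de1 by (auto simp: k_def Npq)
    have "real (Suc k) * real (N choose Suc k) = real (N - k) * real (N choose k)"
      using binomial_absorption[of k "N"] binomial_absorb_comp[of N k] by (metis of_nat_mult)
    then have "(real (Suc k) * q) * w (Suc k) = (real (N - k) * p) * w k"
    proof -
      assume a: "real (Suc k) * real (N choose Suc k) = real (N - k) * real (N choose k)"
      have qq: "q ^ (N - k) = q * q ^ (N - Suc k)" using kN(1) by (metis Suc_diff_Suc power_Suc)
      have "(real (Suc k) * q) * w (Suc k) = (real (Suc k) * real (N choose Suc k)) * (p * p ^ k * (q * q ^ (N - Suc k)))"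
        by (simp add: w_def mult_ac)
      also have "\<dots> = (real (N - k) * p) * w k" unfolding a by (simp add: w_def mult_ac qq)
      finally show ?thesis .
    qed
    then have eq: "real (d + t) * real e * B (Suc t) = real (e - 1 - t) * real d * B t"
      using de1 unfolding kN k_def[symmetric] by (simp add: B_def k_def Npq(2,3) kN field_simps)
    have er: "real (e - 1 - t) = real e - 1 - real t" using t de1 by simp
    have J0: "real J > 0" using J by simp
    have "4 * real J * (real t + 1) \<le> 4 * real J * (real J + 1)" by (intro mult_left_mono) (use t in auto)
    moreover have "4 * real J * (real J + 1) \<le> real e" "4 * real J * (real J + 1) \<le> real d"
      using of_nat_mono[OF de(2), where 'a = real] of_nat_mono[OF de(1), where 'a = real] by (simp_all add: algebra_simps)
    ultimately have "4 * real J * (real t + 1) \<le> real e" "4 * real J * (real t + 1) \<le> real d" by linarith+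
    then have ee: "2 * (real t + 1) \<le> \<epsilon> * real e" "2 * (real t + 1) \<le> \<epsilon> * real d"
      using J0 by (simp_all add: \<epsilon>_def field_simps)
    have "2 * (real t + 1) * real d \<le> \<epsilon> * real e * real d" "2 * (real t + 1) * real e \<le> \<epsilon> * real d * real e"
      using ee by (intro mult_right_mono; simp)+
    moreover have "0 \<le> \<epsilon> * real t * real e" using e0 by simp
    ultimately have "(1 - \<epsilon>) * (real (d + t) * real e) \<le> real (e - 1 - t) * real d"
      unfolding er by (simp add: algebra_simps) 
    then have "(1 - \<epsilon>) * (real (d + t) * real e) * B t \<le> real (e - 1 - t) * real d * B t"
      by (rule mult_right_mono) (simp add: B_def w0)
    also have "\<dots> = real (d + t) * real e * B (Suc t)" using eq by simp
    finally have "(real (d + t) * real e) * ((1 - \<epsilon>) * B t) \<le> (real (d + t) * real e) * B (Suc t)"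
      by (simp add: mult_ac)
    moreover have "real (d + t) * real e > 0" using de1 by simp
    ultimately show ?thesis by (rule mult_left_le_imp_le)
  qed
  have half: "B 0 / 2 \<le> B t" if "t < J" for t
  proof -
    have pw: "(1 - \<epsilon>) ^ t * B 0 \<le> B t" if "t \<le> J" for t
      using that
    proof (induction t)
      case (Suc t)
      have "(1 - \<epsilon>) ^ Suc t * B 0 = (1 - \<epsilon>) * ((1 - \<epsilon>) ^ t * B 0)" by simp
      also have "\<dots> \<le> (1 - \<epsilon>) * B t" using Suc e0 by (intro mult_left_mono) auto
      also have "\<dots> \<le> B (Suc t)" using step[of t] Suc.prems by simp
      finally show ?case .
    qed simp
    have "1 / 2 \<le> (1 - \<epsilon>) ^ t"
    proof -
      have "1 + real t * (- \<epsilon>) \<le> (1 + (- \<epsilon>)) ^ t" by (rule Bernoulli_inequality) (use e0 in simp)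
      moreover have "real t * \<epsilon> \<le> 1 / 2" using that J by (simp add: \<epsilon>_def field_simps)
      ultimately show ?thesis by simp
    qed
    then have "1 / 2 * B 0 \<le> (1 - \<epsilon>) ^ t * B 0" by (rule mult_right_mono) (simp add: B_def w0)
    then show ?thesis using pw[of t] that by simp
  qed
  have "real J * (B 0 / 2) = (\<Sum>t<J. B 0 / 2)" by simp
  also have "\<dots> \<le> (\<Sum>t<J. B t)" by (rule sum_mono) (use half in simp)
  finally have "B 0 \<le> 2 / real J" using sum J by (simp add: field_simps)
  moreover have "N - (d - 1) = e - 1" using de1 by (simp add: Npq)
  ultimately show ?thesis by (simp add: B_def w_def Npq)
qed

text \<open>With e = n + 1 - d, the product of the counts d^(d-2) and e^(e-2) with the binomial
  coefficient is (n + 1)^(n-1) / (d e) times a binomial weight, itself at most 2/J. Replacing (n +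
  1)^(n-1) by n^(n-1) costs a factor 3, and d e is at least n^2 / k^2.\<close>

lemma card_visits_bound:
  fixes n d k J :: nat
  assumes k: "1 \<le> k" and J: "1 \<le> J" and nk: "4 * J * (J + 1) \<le> n div k" and d: "n div k < d" "d \<le> n - n div k"
  shows "real (card (visits n 1 d)) * real n ^ 2 \<le> 6 * real k ^ 2 / real J * (real n * real (card (factorizations n 0)))"
proof -
  have big: "8 \<le> n div k"
  proof -
    have "4 * 1 * (1 + 1) \<le> 4 * J * (J + 1)" using J by (intro mult_le_mono) auto
    then have "8 \<le> 4 * J * (J + 1)" by simp
    then show ?thesis using nk by (rule order_trans)
  qed
  have "n div k \<le> n" by simp
  then have n3: "8 \<le> n" using big by linarith
  define e where "e = n + 1 - d"
  have dn: "d < n" using d big by linarith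
  have e: "n div k < e" "d + e = n + 1" "2 \<le> e" "2 \<le> d" using d dn big by (auto simp: e_def)
  have lb: "real n / real k \<le> real m" if "n div k < m" for m
  proof -
    have "n < m * k" using that k by (simp add: div_less_iff_less_mult)
    then have "real n \<le> real m * real k" by (metis less_imp_le of_nat_le_iff of_nat_mult)
    then show ?thesis using k by (simp add: field_simps)
  qed
  let ?b = "real ((d + e - 2) choose (d - 1)) * (real d / real (d + e)) ^ (d - 1) * (real e / real (d + e)) ^ (e - 1)"
  have b: "?b \<le> 2 / real J" by (rule binomial_mode_bound[OF J]) (use nk d(1) e(1) in linarith)+
  have de2: "d + e - 2 = n - 1" using e by simp
  define Q where "Q = real n + 1"
  have b': "?b = real (n - 1 choose (d - 1)) * real d ^ (d - 1) * real e ^ (e - 1) / Q ^ (n - 1)"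
  proof -
    have "Q ^ (n - 1) = Q ^ (d - 1) * Q ^ (e - 1)" using e by (simp flip: power_add)
    then show ?thesis unfolding de2 e(2) by (simp add: power_divide Q_def add.commute)
  qed
  have "real (card (visits n 1 d)) \<le> real ((n - 1 choose (d - 1)) * (card (factorizations d 0) * card (factorizations (n + 1 - d) 0)))"
    using card_visits_1[OF e(4) dn] by (simp only: of_nat_le_iff)
  also have "\<dots> = real (n - 1 choose (d - 1)) * (real d ^ (d - 2) * real e ^ (e - 2))"
    using card_factorizations_0[OF e(4)] card_factorizations_0[OF e(3)] by (simp add: e_def)
  finally have v: "real (card (visits n 1 d)) \<le> real (n - 1 choose (d - 1)) * (real d ^ (d - 2) * real e ^ (e - 2))" .
  have pw: "real d ^ (d - 1) = real d * real d ^ (d - 2)" "real e ^ (e - 1) = real e * real e ^ (e - 2)"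
    using e(3,4) by (simp_all flip: power_Suc add: Suc_diff_Suc numeral_2_eq_2)
  have Qe: "Q ^ (n - 1) \<le> 3 * real n ^ (n - 1)"
  proof -
    have "(1 + 1 / real n) ^ (n - 1) \<le> (1 + 1 / real n) ^ n" by (rule power_increasing) auto
    also have "\<dots> \<le> exp (1 / real n) ^ n" by (rule power_mono) auto
    also have "\<dots> = exp 1" using n3 by (simp flip: exp_of_nat_mult)
    also have "\<dots> \<le> 3" by (rule exp_le)
    finally have "(1 + 1 / real n) ^ (n - 1) * real n ^ (n - 1) \<le> 3 * real n ^ (n - 1)" by (rule mult_right_mono) simp
    moreover have "(1 + 1 / real n) * real n = Q" using n3 by (simp add: Q_def field_simps)
    ultimately show ?thesis by (simp flip: power_mult_distrib)
  qed
  have "real (card (visits n 1 d)) * (real d * real e) \<le>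
      real (n - 1 choose (d - 1)) * (real d ^ (d - 2) * real e ^ (e - 2)) * (real d * real e)"
    by (rule mult_right_mono[OF v]) simp
  also have "\<dots> = ?b * Q ^ (n - 1)" unfolding b' pw by (simp add: Q_def mult_ac)
  also have "\<dots> \<le> 2 / real J * (3 * real n ^ (n - 1))"
    by (rule mult_mono[OF b Qe]) (simp_all add: Q_def)
  finally have m: "real (card (visits n 1 d)) * (real d * real e) \<le> 6 / real J * real n ^ (n - 1)" by simp
  have "real n ^ 2 / real k ^ 2 = (real n / real k) * (real n / real k)" by (simp add: power2_eq_square)
  also have "\<dots> \<le> real d * real e" by (intro mult_mono lb d(1) e(1)) auto
  finally have "real (card (visits n 1 d)) * (real n ^ 2 / real k ^ 2) \<le> real (card (visits n 1 d)) * (real d * real e)"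
    by (rule mult_left_mono) simp
  with m have "real (card (visits n 1 d)) * (real n ^ 2 / real k ^ 2) \<le> 6 / real J * real n ^ (n - 1)" by linarith
  moreover have "real n ^ (n - 1) = real n * real (card (factorizations n 0))"
    using card_factorizations_0[of n] n3 by (simp flip: power_Suc add: Suc_diff_Suc numeral_2_eq_2)
  ultimately show ?thesis using k by (simp add: field_simps)
qed

text \<open>A first moment bound. The term 2/k pays for the vertices within n/k of the ends; for the
  others each of at most n distant positions is visited with probability at most 6 k^2 / (J
  n).\<close>

lemma sum_card_bad:
  fixes n k l J :: nat
  assumes k: "1 \<le> k" and l: "1 \<le> l" "l \<le> k" and J: "1 \<le> J" and nk: "4 * J * (J + 1) \<le> n div k"
  shows "(\<Sum>ts\<in>factorizations n 0. real (card (bad n (n div l) ts))) \<le>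
    (2 / real k + 6 * real k ^ 2 / real J) * (real n * real (card (factorizations n 0)))"
proof -
  let ?F = "factorizations n 0" and ?L = "n div l" and ?L' = "n div k"
  define \<beta> where "\<beta> = 6 * real k ^ 2 / real J * (real n * real (card ?F))"
  have LL: "?L' \<le> ?L" using l by (simp add: div_le_mono2)
  have "?L' \<le> n" "1 \<le> 4 * J * (J + 1)" using J by auto
  then have n: "1 \<le> n" "1 \<le> ?L'" using nk by linarith+
  have "(\<Sum>ts\<in>?F. real (card (bad n ?L ts))) = (\<Sum>ts\<in>?F. \<Sum>x\<in>{1..n}. if x \<in> bad n ?L ts then 1 else 0)"
    by (intro sum.cong refl) (auto simp: sum.If_cases bad_def intro!: arg_cong[of _ _ card])
  also have "\<dots> = (\<Sum>x\<in>{1..n}. \<Sum>ts\<in>?F. if x \<in> bad n ?L ts then 1 else 0)" by (rule sum.swap)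
  also have "\<dots> = (\<Sum>x\<in>{1..n}. real (card {ts \<in> ?F. x \<in> bad n ?L ts}))"
    by (intro sum.cong refl) (simp add: sum.If_cases Int_def)
  also have "\<dots> \<le> (\<Sum>x\<in>{1..n}. (if x \<le> ?L' \<or> n - ?L' < x then real (card ?F) else 0) + \<beta> / real n)"
  proof (rule sum_mono)
    fix x assume x: "x \<in> {1..n}"
    have b0: "0 \<le> \<beta> / real n" by (simp add: \<beta>_def)
    show "real (card {ts \<in> ?F. x \<in> bad n ?L ts}) \<le> (if x \<le> ?L' \<or> n - ?L' < x then real (card ?F) else 0) + \<beta> / real n"
    proof (cases "x \<le> ?L' \<or> n - ?L' < x")
      case True
      have "card {ts \<in> ?F. x \<in> bad n ?L ts} \<le> card ?F" by (rule card_mono) auto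
      then show ?thesis using True b0 by simp
    next
      case False
      let ?Js = "{j \<in> {1..n}. x + ?L < j \<or> j + ?L < x}"
      have "{ts \<in> ?F. x \<in> bad n ?L ts} \<subseteq> (\<Union>j\<in>?Js. visits n x j)"
      proof
        fix ts assume ts: "ts \<in> {ts \<in> ?F. x \<in> bad n ?L ts}"
        then obtain s where s: "s \<le> length ts" "pos ts s x > x + ?L \<or> x > pos ts s x + ?L" by (auto simp: bad_def)
        have "set ts \<subseteq> transp_on {1..n}" using ts by (auto simp: factorizations_def transpositions_eq)
        then have "pos ts s x \<in> {1..n}" using permutes_in_image[OF pos_permutes] x by blast
        then show "ts \<in> (\<Union>j\<in>?Js. visits n x j)" using s ts by (auto simp: visits_def)
      qed
      then have "card {ts \<in> ?F. x \<in> bad n ?L ts} \<le> card (\<Union>j\<in>?Js. visits n x j)" by (intro card_mono) auto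
      also have "\<dots> \<le> (\<Sum>j\<in>?Js. card (visits n x j))" by (rule card_UN_le) simp
      finally have "real (card {ts \<in> ?F. x \<in> bad n ?L ts}) \<le> (\<Sum>j\<in>?Js. real (card (visits n x j)))"
        by (simp only: of_nat_sum[symmetric] of_nat_le_iff)
      also have "\<dots> \<le> (\<Sum>j\<in>?Js. \<beta> / real n ^ 2)"
      proof (rule sum_mono)
        fix j assume j: "j \<in> ?Js"
        define d where "d = (if x \<le> j then j - (x - 1) else j + n - (x - 1))"
        \<comment> \<open>As x is away from both ends, a long displacement on the line remains long
          after wrapping around the cycle, in either direction.\<close>
        have d: "?L' < d" "d \<le> n - ?L'" using j x False LL by (auto simp: d_def)
        have "real (card (visits n 1 d)) * real n ^ 2 \<le> \<beta>"
          unfolding \<beta>_def by (rule card_visits_bound[OF k J nk d])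
        then have "real (card (visits n 1 d)) \<le> \<beta> / real n ^ 2" using n by (simp add: field_simps)
        moreover have "card (visits n x j) \<le> card (visits n 1 d)"
          by (rule card_visits_rotate) (use j x d in \<open>auto simp: d_def\<close>)
        ultimately show "real (card (visits n x j)) \<le> \<beta> / real n ^ 2" by linarith
      qed
      also have "\<dots> = real (card ?Js) * (\<beta> / real n ^ 2)" by simp
      also have "\<dots> \<le> real n * (\<beta> / real n ^ 2)"
      proof (rule mult_right_mono)
        have "?Js \<subseteq> {1..n}" by blast
        then have "card ?Js \<le> card {1..n}" by (rule card_mono[OF finite_atLeastAtMost])
        then show "real (card ?Js) \<le> real n" by simp
      qed (simp add: \<beta>_def)
      also have "\<dots> = \<beta> / real n" using n by (simp add: power2_eq_square)
      finally show ?thesis using False by simp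
    qed
  qed
  also have "\<dots> = real (card {x \<in> {1..n}. x \<le> ?L' \<or> n - ?L' < x}) * real (card ?F) + \<beta>"
    using n by (simp add: sum.distrib sum.If_cases Int_def)
  also have "\<dots> \<le> (2 * real n / real k) * real (card ?F) + \<beta>"
  proof -
    have "{x \<in> {1..n}. x \<le> ?L' \<or> n - ?L' < x} \<subseteq> {1..?L'} \<union> {Suc (n - ?L')..n}" by auto
    then have "card {x \<in> {1..n}. x \<le> ?L' \<or> n - ?L' < x} \<le> card ({1..?L'} \<union> {Suc (n - ?L')..n})"
      by (intro card_mono) auto
    also have "\<dots> \<le> ?L' + (n - (n - ?L'))" using card_Un_le[of "{1..?L'}" "{Suc (n - ?L')..n}"] by simp
    also have "\<dots> = 2 * ?L'" using \<open>?L' \<le> n\<close> by simp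
    finally have "real (card {x \<in> {1..n}. x \<le> ?L' \<or> n - ?L' < x}) \<le> 2 * real ?L'"
      by (metis of_nat_le_iff of_nat_mult of_nat_numeral)
    also have "\<dots> \<le> 2 * (real n / real k)" using of_nat_div_le_of_nat[of n k, where 'a = real] by simp
    finally have "real (card {x \<in> {1..n}. x \<le> ?L' \<or> n - ?L' < x}) \<le> 2 * real n / real k" by simp
    then have "real (card {x \<in> {1..n}. x \<le> ?L' \<or> n - ?L' < x}) * real (card ?F) \<le> 2 * real n / real k * real (card ?F)"
      by (rule mult_right_mono) simp
    then show ?thesis by simp
  qed
  also have "\<dots> = (2 / real k + 6 * real k ^ 2 / real J) * (real n * real (card ?F))"
    by (simp add: \<beta>_def algebra_simps)
  finally show ?thesis .
qed

text \<open>\<eta> bounds both the proportion of bad vertices and the proportion of exceptional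
  factorizations; k fixes the scale n/k of displacements.\<close>

definition typical_at :: "nat \<Rightarrow> nat \<Rightarrow> nat \<Rightarrow> real \<Rightarrow> bool" where
  "typical_at n h k \<eta> \<longleftrightarrow>
     real (card {ts \<in> factorizations n h. real (card (bad n (n div k) ts)) > \<eta> * real n})
       \<le> \<eta> * real (card (factorizations n h))"

definition typical :: "nat \<Rightarrow> bool" where
  "typical h \<longleftrightarrow> (\<forall>\<eta>>0. \<forall>k\<ge>1. eventually (\<lambda>n. typical_at n h k \<eta>) sequentially)"

text \<open>Markov's inequality on \<open>sum_card_bad\<close>. First k and then, depending on k, J
  is taken so large that each error term is at most \<eta>^2 / 2.\<close>

lemma typical_0: "typical 0"
  unfolding typical_def
proof (intro allI impI)
  fix \<eta> :: real and l :: nat assume \<eta>: "0 < \<eta>" and l: "1 \<le> l"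
  define k where "k = max l (nat \<lceil>4 / \<eta>^2\<rceil>)"
  have k: "1 \<le> k" "l \<le> k" using l by (auto simp: k_def)
  have "4 / \<eta>^2 \<le> real k" unfolding k_def by (rule order_trans[OF real_nat_ceiling_ge]) simp
  then have k2: "2 / real k \<le> \<eta>^2 / 2" using \<eta> k by (simp add: field_simps)
  define J where "J = max 1 (nat \<lceil>12 * real k ^ 2 / \<eta>^2\<rceil>)"
  have J: "1 \<le> J" by (simp add: J_def)
  have "12 * real k ^ 2 / \<eta>^2 \<le> real J" unfolding J_def by (rule order_trans[OF real_nat_ceiling_ge]) simp
  then have J2: "6 * real k ^ 2 / real J \<le> \<eta>^2 / 2" using \<eta> J by (simp add: field_simps)
  show "eventually (\<lambda>n. typical_at n 0 l \<eta>) sequentially"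
  proof (rule eventually_sequentiallyI[of "4 * J * (J + 1) * k + 1"])
    fix n assume n: "4 * J * (J + 1) * k + 1 \<le> n"
    have nk: "4 * J * (J + 1) \<le> n div k" using n k by (subst less_eq_div_iff_mult_less_eq) auto
    have n0: "0 < real n" using n by simp
    let ?F = "factorizations n 0"
    let ?B = "{ts \<in> ?F. real (card (bad n (n div l) ts)) > \<eta> * real n}"
    have "real (card ?B) * (\<eta> * real n) = (\<Sum>ts\<in>?B. \<eta> * real n)" by simp
    also have "\<dots> \<le> (\<Sum>ts\<in>?B. real (card (bad n (n div l) ts)))" by (rule sum_mono) simp
    also have "\<dots> \<le> (\<Sum>ts\<in>?F. real (card (bad n (n div l) ts)))" by (rule sum_mono2) auto
    also have "\<dots> \<le> (2 / real k + 6 * real k ^ 2 / real J) * (real n * real (card ?F))"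
      by (rule sum_card_bad[OF k(1) l k(2) J nk])
    also have "\<dots> \<le> \<eta>^2 * (real n * real (card ?F))" by (rule mult_right_mono) (use k2 J2 in simp_all)
    finally have "(\<eta> * real n) * real (card ?B) \<le> (\<eta> * real n) * (\<eta> * real (card ?F))"
      by (simp add: power2_eq_square mult_ac)
    then show "typical_at n 0 l \<eta>" unfolding typical_at_def by (rule mult_left_le_imp_le) (use \<eta> n0 in simp)
  qed
qed

section \<open>Total variation distance\<close>

definition step_inputs :: "nat \<Rightarrow> nat \<Rightarrow> ((nat \<Rightarrow> nat) list \<times> (nat \<times> nat) \<times> (nat \<times> nat \<times> nat)) set" where
  "step_inputs n h = factorizations n h \<times> pairs (n - 1 + 2 * Suc h) \<times> triples n"

definition step_map :: "nat \<Rightarrow> (nat \<Rightarrow> nat) list \<times> (nat \<times> nat) \<times> (nat \<times> nat \<times> nat) \<Rightarrow> (nat \<Rightarrow> nat) list option" where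
  "step_map n = (\<lambda>(ts, vw, abc). map_option (relabel n) (add_transpositions n vw abc ts))"

definition clean_triples :: "nat \<Rightarrow> nat \<Rightarrow> (nat \<Rightarrow> nat) list \<Rightarrow> (nat \<times> nat \<times> nat) set" where
  "clean_triples n L ts = {(a, b, c) \<in> triples n. a \<notin> bad n L ts \<and> b \<notin> bad n L ts \<and> c \<notin> bad n L ts
     \<and> a \<notin> special n ts \<and> a + 2 * L < b \<and> b + 2 * L < c}"

text \<open>The bound \<beta> on the number of bad vertices of the input is what limits those of the
  output, and so lets typicality pass to the next genus.\<close>

definition clean_inputs :: "nat \<Rightarrow> nat \<Rightarrow> nat \<Rightarrow> real \<Rightarrow> ((nat \<Rightarrow> nat) list \<times> (nat \<times> nat) \<times> (nat \<times> nat \<times> nat)) set" where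
  "clean_inputs n h L \<beta> = {(ts, vw, abc) \<in> step_inputs n h. real (card (bad n L ts)) \<le> \<beta> \<and> abc \<in> clean_triples n L ts}"

lemma finite_step_inputs [simp]: "finite (step_inputs n h)"
  by (simp add: step_inputs_def)

lemma clean_inputs_subset: "clean_inputs n h L \<beta> \<subseteq> step_inputs n h"
  by (auto simp: clean_inputs_def)

lemma clean_inputs_insertion:
  assumes "(ts, (v, w), (a, b, c)) \<in> clean_inputs n h L \<beta>"
  shows "clean_insertion n h L (v - 1) (w - 2) a b c ts" "v = Suc (v - 1)" "w = (w - 2) + 2"
    "real (card (bad n L ts)) \<le> \<beta>"
proof -
  have ts: "ts \<in> factorizations n h" and vw: "1 \<le> v" "v < w" "w \<le> n - 1 + 2 * Suc h"
    and abc: "1 \<le> a" "a + 2 * L < b" "b + 2 * L < c" "c \<le> n"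
      "a \<notin> bad n L ts" "b \<notin> bad n L ts" "c \<notin> bad n L ts" "a \<notin> special n ts"
    using assms by (auto simp: clean_inputs_def clean_triples_def step_inputs_def pairs_def triples_def)
  have "length ts = n - 1 + 2 * h" using ts by (auto simp: factorizations_def)
  then show "clean_insertion n h L (v - 1) (w - 2) a b c ts"
    using ts vw abc by unfold_locales auto
  show "v = Suc (v - 1)" "w = (w - 2) + 2" using vw by auto
  show "real (card (bad n L ts)) \<le> \<beta>" using assms by (auto simp: clean_inputs_def)
qed

lemma step_map_clean:
  assumes q: "(ts, (v, w), (a, b, c)) \<in> clean_inputs n h L \<beta>"
  defines "G \<equiv> clean_insertion.res (v - 1) (w - 2) a b c ts"
  shows "step_map n (ts, (v, w), (a, b, c)) = Some G" "G \<in> factorizations n (Suc h)"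
    "real (card (bad n L G)) \<le> \<beta> + 8 * real L + 4"
proof -
  interpret clean_insertion n h L "v - 1" "w - 2" a b c ts by (rule clean_inputs_insertion[OF q])
  have "add_transpositions n (v, w) (a, b, c) ts = Some ins"
    using add_transpositions_eq clean_inputs_insertion(2,3)[OF q] by metis
  then show "step_map n (ts, (v, w), (a, b, c)) = Some G"
    unfolding step_map_def G_def by (simp only: prod.case option.map relabel_ins)
  show "G \<in> factorizations n (Suc h)" unfolding G_def by (rule res_factorization)
  have "real (card (bad n L G)) \<le> real (card (bad n L ts) + 4 * (2 * L + 1))"
    unfolding G_def using card_bad_res by (simp only: of_nat_le_iff)
  then show "real (card (bad n L G)) \<le> \<beta> + 8 * real L + 4"
    using clean_inputs_insertion(4)[OF q] by simp
qed

lemma card_clean_fibre: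
  assumes G: "G \<in> factorizations n (Suc h)" and n: "1 \<le> n"
  shows "card {q \<in> clean_inputs n h L \<beta>. step_map n q = Some G} \<le> 2 * Suc h"
proof -
  let ?Q = "{q \<in> clean_inputs n h L \<beta>. step_map n q = Some G}"
  define f where "f = (\<lambda>(ts, (v, w), (a, b, c)). clean_insertion.sg (v - 1) (w - 2) a b c ts a)"
  have "inj_on f ?Q"
  proof (rule inj_onI)
    fix q q' assume q: "q \<in> ?Q" "q' \<in> ?Q" "f q = f q'"
    obtain ts v w a b c where e: "q = (ts, (v, w), (a, b, c))" by (metis prod_cases3 surj_pair)
    obtain ts' v' w' a' b' c' where e': "q' = (ts', (v', w'), (a', b', c'))" by (metis prod_cases3 surj_pair)
    have c: "(ts, (v, w), (a, b, c)) \<in> clean_inputs n h L \<beta>" "(ts', (v', w'), (a', b', c')) \<in> clean_inputs n h L \<beta>"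
      using q by (auto simp: e e')
    have "clean_insertion.res (v - 1) (w - 2) a b c ts = clean_insertion.res (v' - 1) (w' - 2) a' b' c' ts'"
      using q step_map_clean(1)[OF c(1)] step_map_clean(1)[OF c(2)] by (simp add: e e')
    then have "v - 1 = v' - 1 \<and> w - 2 = w' - 2 \<and> a = a' \<and> b = b' \<and> c = c' \<and> ts = ts'"
      using clean_insertion_inj[OF clean_inputs_insertion(1)[OF c(1)] clean_inputs_insertion(1)[OF c(2)]] q(3)
      by (simp add: f_def e e')
    then show "q = q'" using clean_inputs_insertion(2,3)[OF c(1)] clean_inputs_insertion(2,3)[OF c(2)]
      unfolding e e' by metis
  qed
  moreover have "f ` ?Q \<subseteq> special n G"
  proof
    fix y assume "y \<in> f ` ?Q"
    then obtain q where q: "q \<in> ?Q" "y = f q" by blast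
    obtain ts v w a b c where e: "q = (ts, (v, w), (a, b, c))" by (metis prod_cases3 surj_pair)
    have c: "(ts, (v, w), (a, b, c)) \<in> clean_inputs n h L \<beta>" using q by (auto simp: e)
    have "clean_insertion.res (v - 1) (w - 2) a b c ts = G"
      using q step_map_clean(1)[OF c] by (simp add: e)
    then show "y \<in> special n G"
      using clean_insertion.special_res[OF clean_inputs_insertion(1)[OF c]] q(2) by (simp add: f_def e)
  qed
  moreover have "finite (special n G)" by (simp add: special_def)
  ultimately have "card ?Q \<le> card (special n G)" by (rule card_inj_on_le)
  then show ?thesis using card_special[OF G n] by simp
qed

lemma card_unclean_triples:
  "card (triples n - clean_triples n L ts) \<le> (3 * (card (bad n L ts) + card (special n ts)) + 4 * L) * n ^ 2"
proof -
  let ?U = "bad n L ts \<union> special n ts"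
  let ?N = "{1..n}"
  let ?R1 = "?U \<times> ?N \<times> ?N" and ?R2 = "?N \<times> ?U \<times> ?N" and ?R3 = "?N \<times> ?N \<times> ?U"
  let ?f = "\<lambda>(a, \<delta>, c). (a, a + \<delta>, c) :: nat \<times> nat \<times> nat" and ?g = "\<lambda>(a, b, \<delta>). (a, b, b + \<delta>) :: nat \<times> nat \<times> nat"
  let ?R4 = "?f ` (?N \<times> {1..2 * L} \<times> ?N)" and ?R5 = "?g ` (?N \<times> ?N \<times> {1..2 * L})"
  have fU: "finite ?U" by (simp add: bad_def special_def)
  have "triples n - clean_triples n L ts \<subseteq> ?R1 \<union> ?R2 \<union> ?R3 \<union> ?R4 \<union> ?R5"
  proof
    fix q assume q: "q \<in> triples n - clean_triples n L ts"
    obtain a b c where e: "q = (a, b, c)" by (metis prod_cases3)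
    have abc: "1 \<le> a" "a < b" "b < c" "c \<le> n" using q by (auto simp: e triples_def)
    have "a \<in> ?U \<or> b \<in> ?U \<or> c \<in> ?U \<or> b \<le> a + 2 * L \<or> c \<le> b + 2 * L"
      using q by (auto simp: e clean_triples_def)
    moreover have "q \<in> ?R4" if "b \<le> a + 2 * L"
      using that abc unfolding e by (intro image_eqI[of _ _ "(a, b - a, c)"]) auto
    moreover have "q \<in> ?R5" if "c \<le> b + 2 * L"
      using that abc unfolding e by (intro image_eqI[of _ _ "(a, b, c - b)"]) auto
    ultimately show "q \<in> ?R1 \<union> ?R2 \<union> ?R3 \<union> ?R4 \<union> ?R5" using abc unfolding e by auto
  qed
  then have "card (triples n - clean_triples n L ts) \<le> card (?R1 \<union> ?R2 \<union> ?R3 \<union> ?R4 \<union> ?R5)"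
    using fU by (intro card_mono) auto
  also have "\<dots> \<le> card ?R1 + card ?R2 + card ?R3 + card ?R4 + card ?R5"
    by (meson card_Un_le add_le_mono1 order_trans)
  also have "\<dots> \<le> card ?U * n^2 + card ?U * n^2 + card ?U * n^2 + 2 * L * n^2 + 2 * L * n^2"
  proof -
    have "card ?R4 \<le> card (?N \<times> {1..2 * L} \<times> ?N)" "card ?R5 \<le> card (?N \<times> ?N \<times> {1..2 * L})"
      by (rule card_image_le; simp)+
    then show ?thesis by (simp add: card_cartesian_product power2_eq_square mult_ac)
  qed
  also have "\<dots> = (3 * card ?U + 4 * L) * n^2" by (simp add: algebra_simps)
  also have "\<dots> \<le> (3 * (card (bad n L ts) + card (special n ts)) + 4 * L) * n ^ 2"
    by (intro mult_right_mono add_right_mono mult_left_mono card_Un_le) auto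
  finally show ?thesis .
qed

lemma card_triples_ge: "6 \<le> n \<Longrightarrow> real n ^ 3 / 12 \<le> real (card (triples n))"
proof -
  assume n: "6 \<le> n"
  have "0 \<le> (real n - 6) * real n + 4" using n by simp
  then have "real n ^ 2 \<le> 2 * ((real n - 1) * (real n - 2))" by (simp add: power2_eq_square algebra_simps)
  then have "real n * real n ^ 2 \<le> real n * (2 * ((real n - 1) * (real n - 2)))" by (rule mult_left_mono) simp
  then show ?thesis using card_triples[of n] by (simp add: power3_eq_cube power2_eq_square mult_ac)
qed

lemma card_unclean_inputs:
  fixes \<eta> :: real and k :: nat
  assumes n: "6 \<le> n" and \<eta>: "0 < \<eta>" and k: "1 \<le> k"
    and unif: "typical_at n h k \<eta>"
  shows "real (card (step_inputs n h - clean_inputs n h (n div k) (\<eta> * real n)))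
    \<le> (37 * \<eta> + 72 * real h / real n + 48 / real k) * real (card (step_inputs n h))"
proof -
  let ?F = "factorizations n h" and ?P = "pairs (n - 1 + 2 * Suc h)" and ?T = "triples n" and ?L = "n div k"
  let ?B = "{ts \<in> ?F. real (card (bad n ?L ts)) > \<eta> * real n}"
  \<comment> \<open>A factorization outside \<open>?B\<close> has at most (3 (\<eta> n + 2 h) + 4 n
    / k) n^2 unclean triples, compared with at least n^3 / 12 triples in all; hence the factor 12.
    The exceptional factorizations add one more \<eta>.\<close>
  define \<gamma> where "\<gamma> = 36 * \<eta> + 72 * real h / real n + 48 / real k"
  have n0: "0 < real n" using n by simp
  have tr: "real (card (?T - clean_triples n ?L ts)) \<le> \<gamma> * real (card ?T)" if ts: "ts \<in> ?F - ?B" for ts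
  proof -
    have sp: "card (special n ts) \<le> 2 * h" using card_special[of ts n h] ts n by auto
    have L: "real ?L \<le> real n / real k" by (rule of_nat_div_le_of_nat)
    have "real (card (?T - clean_triples n ?L ts)) \<le> real ((3 * (card (bad n ?L ts) + card (special n ts)) + 4 * ?L) * n ^ 2)"
      using card_unclean_triples by (simp only: of_nat_le_iff)
    also have "\<dots> = (3 * (real (card (bad n ?L ts)) + real (card (special n ts))) + 4 * real ?L) * real n ^ 2" by simp
    also have "\<dots> \<le> (3 * (\<eta> * real n + 2 * real h) + 4 * (real n / real k)) * real n ^ 2"
      using ts sp L by (intro mult_right_mono add_mono mult_left_mono) auto
    also have "\<dots> = \<gamma> * (real n ^ 3 / 12)"
      using n0 by (simp add: \<gamma>_def power3_eq_cube power2_eq_square field_simps)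
    also have "\<dots> \<le> \<gamma> * real (card ?T)"
      by (rule mult_left_mono[OF card_triples_ge[OF n]]) (use \<eta> in \<open>simp add: \<gamma>_def\<close>)
    finally show ?thesis .
  qed
  have g0: "0 \<le> \<gamma>" using \<eta> by (simp add: \<gamma>_def)
  have "step_inputs n h - clean_inputs n h ?L (\<eta> * real n) \<subseteq> ?B \<times> (?P \<times> ?T) \<union>
      (SIGMA ts:?F - ?B. ?P \<times> (?T - clean_triples n ?L ts))"
    by (auto simp: step_inputs_def clean_inputs_def)
  then have "card (step_inputs n h - clean_inputs n h ?L (\<eta> * real n)) \<le> card (?B \<times> (?P \<times> ?T) \<union>
      (SIGMA ts:?F - ?B. ?P \<times> (?T - clean_triples n ?L ts)))"
    by (intro card_mono) (auto intro!: finite_SigmaI)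
  also have "\<dots> \<le> card (?B \<times> (?P \<times> ?T)) + card (SIGMA ts:?F - ?B. ?P \<times> (?T - clean_triples n ?L ts))"
    by (rule card_Un_le)
  also have "\<dots> = card ?B * (card ?P * card ?T) + (\<Sum>ts\<in>?F - ?B. card ?P * card (?T - clean_triples n ?L ts))"
    by (simp add: card_cartesian_product card_SigmaI)
  finally have "real (card (step_inputs n h - clean_inputs n h ?L (\<eta> * real n))) \<le>
      real (card ?B * (card ?P * card ?T) + (\<Sum>ts\<in>?F - ?B. card ?P * card (?T - clean_triples n ?L ts)))"
    by (simp only: of_nat_le_iff)
  also have "\<dots> = real (card ?B) * (real (card ?P) * real (card ?T)) + (\<Sum>ts\<in>?F - ?B. real (card ?P) * real (card (?T - clean_triples n ?L ts)))"
    by simp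
  also have "\<dots> \<le> (\<eta> * real (card ?F)) * (real (card ?P) * real (card ?T)) + (\<Sum>ts\<in>?F - ?B. real (card ?P) * (\<gamma> * real (card ?T)))"
    by (intro add_mono mult_right_mono unif[unfolded typical_at_def] sum_mono mult_left_mono tr) auto
  also have "(\<Sum>ts\<in>?F - ?B. real (card ?P) * (\<gamma> * real (card ?T))) = real (card (?F - ?B)) * (real (card ?P) * (\<gamma> * real (card ?T)))"
    by simp
  also have "\<dots> \<le> real (card ?F) * (real (card ?P) * (\<gamma> * real (card ?T)))"
    by (intro mult_right_mono) (auto intro!: card_mono simp: g0)
  finally show ?thesis
    by (simp add: step_inputs_def card_cartesian_product \<gamma>_def algebra_simps)
qed

text \<open>The second conjunct leaves room for the bad vertices created by an insertion, at most 8
  L + 4 by \<open>card_bad_res\<close>.\<close>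

definition mostly_clean :: "nat \<Rightarrow> nat \<Rightarrow> nat \<Rightarrow> real \<Rightarrow> bool" where
  "mostly_clean n h k \<epsilon> \<longleftrightarrow>
     real (card (step_inputs n h - clean_inputs n h (n div k) (\<epsilon> / 4 * real n))) \<le> \<epsilon> * real (card (step_inputs n h))
     \<and> \<epsilon> / 4 * real n + 8 * real (n div k) + 4 \<le> \<epsilon> * real n"

lemma typical_clean:
  assumes unif: "typical h" and \<epsilon>: "0 < \<epsilon>" and l: "1 \<le> l"
  obtains k where "l \<le> k" "eventually (\<lambda>n. mostly_clean n h k \<epsilon>) sequentially"
proof -
  \<comment> \<open>148 is 4 times 37 and 192 below is 4 times 48, so that these error terms of
    \<open>card_unclean_inputs\<close> are at most \<epsilon> / 4 each.\<close>
  define \<eta> where "\<eta> = \<epsilon> / 148"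
  have \<eta>: "0 < \<eta>" using \<epsilon> by (simp add: \<eta>_def)
  define k where "k = max l (nat \<lceil>192 / \<epsilon>\<rceil>)"
  have k: "1 \<le> k" "l \<le> k" using l by (auto simp: k_def)
  have "192 / \<epsilon> \<le> real k" unfolding k_def by (rule order_trans[OF real_nat_ceiling_ge]) simp
  then have k2: "48 / real k \<le> \<epsilon> / 4" using \<epsilon> k by (simp add: field_simps)
  have "(\<lambda>n. 72 * real h / real n) \<longlonglongrightarrow> 0" by real_asymp
  then have "eventually (\<lambda>n. 72 * real h / real n < \<epsilon> / 4) sequentially"
    by (rule order_tendstoD) (use \<epsilon> in simp)
  moreover have "(\<lambda>n. 4 / real n) \<longlonglongrightarrow> 0" by real_asymp
  then have "eventually (\<lambda>n. 4 / real n < \<epsilon> / 4) sequentially"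
    by (rule order_tendstoD) (use \<epsilon> in simp)
  moreover have "eventually (\<lambda>n. typical_at n h k \<eta>) sequentially"
    using unif \<eta> k(1) unfolding typical_def by blast
  ultimately have "eventually (\<lambda>n. mostly_clean n h k \<epsilon>) sequentially"
    using eventually_ge_at_top[of 6]
  proof eventually_elim
    case (elim n)
    have n0: "0 < real n" using elim(4) by simp
    have "clean_inputs n h (n div k) (\<eta> * real n) \<subseteq> clean_inputs n h (n div k) (\<epsilon> / 4 * real n)"
    proof -
      have "\<eta> * real n \<le> \<epsilon> / 4 * real n" using \<epsilon> by (simp add: \<eta>_def)
      then show ?thesis by (auto simp: clean_inputs_def)
    qed
    then have "card (step_inputs n h - clean_inputs n h (n div k) (\<epsilon> / 4 * real n))
        \<le> card (step_inputs n h - clean_inputs n h (n div k) (\<eta> * real n))"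
      by (intro card_mono) auto
    then have "real (card (step_inputs n h - clean_inputs n h (n div k) (\<epsilon> / 4 * real n)))
        \<le> (37 * \<eta> + 72 * real h / real n + 48 / real k) * real (card (step_inputs n h))"
      using card_unclean_inputs[OF elim(4) \<eta> k(1) elim(3)] by linarith
    also have "\<dots> \<le> \<epsilon> * real (card (step_inputs n h))"
    proof (rule mult_right_mono)
      show "37 * \<eta> + 72 * real h / real n + 48 / real k \<le> \<epsilon>"
        using elim(1) k2 \<epsilon> by (simp add: \<eta>_def)
    qed simp
    finally have small: "real (card (step_inputs n h - clean_inputs n h (n div k) (\<epsilon> / 4 * real n))) \<le> \<epsilon> * real (card (step_inputs n h))" .
    have "\<epsilon> / 4 * real n + 8 * real (n div k) + 4 \<le> \<epsilon> * real n"
    proof -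
      have "real (n div k) \<le> real n / real k" by (rule of_nat_div_le_of_nat)
      also have "\<dots> = real n * (48 / real k) / 48" by simp
      also have "\<dots> \<le> real n * (\<epsilon> / 4) / 48" using k2 by (intro divide_right_mono mult_left_mono) auto
      finally have "8 * real (n div k) \<le> \<epsilon> / 4 * real n" using \<epsilon> n0 by (simp add: field_simps)
      moreover have "4 \<le> \<epsilon> / 4 * real n" using elim(2) n0 by (simp add: field_simps)
      ultimately show ?thesis by linarith
    qed
    with small show ?case unfolding mostly_clean_def by blast
  qed
  then show ?thesis using that k(2) by blast
qed

section \<open>Inequalities for the total variation distance\<close>

lemma d_TV_bdd: "bdd_above (range (\<lambda>A. \<bar>measure_pmf.prob p A - measure_pmf.prob q A\<bar>))"
proof (rule bdd_aboveI)
  fix x assume "x \<in> range (\<lambda>A. \<bar>measure_pmf.prob p A - measure_pmf.prob q A\<bar>)"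
  then show "x \<le> 1"
    using measure_pmf.prob_le_1 measure_nonneg by (smt (verit) rangeE)
qed

lemma d_TV_upper: "\<bar>measure_pmf.prob p A - measure_pmf.prob q A\<bar> \<le> d_TV p q"
  unfolding d_TV_def by (rule cSUP_upper[OF _ d_TV_bdd]) simp

text \<open>The one-sided bound on the complement of A is the missing bound on A.\<close>

lemma d_TV_leI: "(\<And>A. measure_pmf.prob p A \<le> measure_pmf.prob q A + e) \<Longrightarrow> d_TV p q \<le> e"
proof -
  assume le: "\<And>A. measure_pmf.prob p A \<le> measure_pmf.prob q A + e"
  have "\<bar>measure_pmf.prob p A - measure_pmf.prob q A\<bar> \<le> e" for A
  proof -
    have "1 - measure_pmf.prob p A \<le> 1 - measure_pmf.prob q A + e"
      using le[of "- A"] measure_pmf.prob_compl[of A p] measure_pmf.prob_compl[of A q] by (simp add: Compl_eq_Diff_UNIV)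
    then show ?thesis using le[of A] by linarith
  qed
  then show ?thesis unfolding d_TV_def by (intro cSUP_least) auto
qed

lemma d_TV_nonneg: "0 \<le> d_TV p q"
  using d_TV_upper[of p "{}" q] by simp

lemma d_TV_refl: "d_TV p p = 0"
  by (simp add: d_TV_def)

lemma d_TV_triangle: "d_TV p r \<le> d_TV p q + d_TV q r"
  by (rule d_TV_leI) (use d_TV_upper[of p _ q] d_TV_upper[of q _ r] in \<open>smt (verit)\<close>)

lemma prob_bind_pmf: "measure_pmf.prob (bind_pmf p K) A = (\<integral>x. measure_pmf.prob (K x) A \<partial>measure_pmf p)"
proof -
  have "ennreal (measure_pmf.prob (bind_pmf p K) A) = (\<integral>\<^sup>+x. ennreal (measure_pmf.prob (K x) A) \<partial>measure_pmf p)"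
    using emeasure_bind_pmf[of p K A] by (simp add: measure_pmf.emeasure_eq_measure)
  also have "\<dots> = ennreal (\<integral>x. measure_pmf.prob (K x) A \<partial>measure_pmf p)"
    by (rule nn_integral_eq_integral) (auto intro!: measure_pmf.integrable_const_bound[of _ 1])
  finally show ?thesis by (simp add: integral_nonneg_AE)
qed

text \<open>A Markov kernel is a contraction: the difference of the two probabilities is a sum of (p
  - q) f with f between 0 and 1, largest when f is the indicator of the points where p is at least
  q.\<close>

lemma d_TV_bind:
  assumes fin: "finite (set_pmf p)" "finite (set_pmf q)"
  shows "d_TV (bind_pmf p K) (bind_pmf q K) \<le> d_TV p q"
proof (rule d_TV_leI)
  fix A
  let ?S = "set_pmf p \<union> set_pmf q"
  define f where "f x = measure_pmf.prob (K x) A" for x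
  have f: "0 \<le> f x" "f x \<le> 1" for x by (simp_all add: f_def)
  let ?A = "{x \<in> ?S. pmf q x \<le> pmf p x}"
  have S: "finite ?S" using fin by simp
  have I: "measure_pmf.prob (bind_pmf r K) A = (\<Sum>x\<in>?S. pmf r x * f x)" if "set_pmf r \<subseteq> ?S" for r
    unfolding prob_bind_pmf f_def[symmetric]
    using integral_measure_pmf[OF S, of r f] that by (auto simp: real_scaleR_def)
  have "measure_pmf.prob (bind_pmf p K) A - measure_pmf.prob (bind_pmf q K) A = (\<Sum>x\<in>?S. (pmf p x - pmf q x) * f x)"
    using I[of p] I[of q] by (simp add: sum_subtractf algebra_simps)
  also have "\<dots> \<le> (\<Sum>x\<in>?S. if pmf q x \<le> pmf p x then pmf p x - pmf q x else 0)"
  proof (rule sum_mono)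
    fix x
    show "(pmf p x - pmf q x) * f x \<le> (if pmf q x \<le> pmf p x then pmf p x - pmf q x else 0)"
      using f[of x] mult_left_mono[of "f x" 1 "pmf p x - pmf q x"] mult_nonpos_nonneg[of "pmf p x - pmf q x" "f x"] by auto
  qed
  also have "\<dots> = (\<Sum>x\<in>?A. pmf p x - pmf q x)" by (rule sum.inter_filter[OF S, symmetric])
  also have "\<dots> = measure_pmf.prob p ?A - measure_pmf.prob q ?A"
    using S by (simp add: measure_measure_pmf_finite sum_subtractf)
  also have "\<dots> \<le> d_TV p q" using d_TV_upper[of p ?A q] by linarith
  finally show "measure_pmf.prob (bind_pmf p K) A \<le> measure_pmf.prob (bind_pmf q K) A + d_TV p q" by linarith
qed

text \<open>An event A receives at most m |V \<inter> A| clean inputs and \<epsilon> |X| others. By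
  the bound on m |V| this is at most (1 + \<epsilon>) times its uniform mass plus \<epsilon>, hence
  the mass plus 2 \<epsilon>.\<close>

lemma d_TV_image_le:
  fixes \<Phi> :: "'a \<Rightarrow> 'b"
  assumes X: "finite X" "X \<noteq> {}" and V: "finite V" "V \<noteq> {}" and C: "C \<subseteq> X" "\<Phi> ` C \<subseteq> V"
    and fib: "\<And>y. y \<in> V \<Longrightarrow> card {x \<in> C. \<Phi> x = y} \<le> m"
    and small: "real (card (X - C)) \<le> \<epsilon> * real (card X)"
    and ratio: "real m * real (card V) \<le> (1 + \<epsilon>) * real (card X)"
  shows "d_TV (map_pmf \<Phi> (pmf_of_set X)) (pmf_of_set V) \<le> 2 * \<epsilon>"
proof (rule d_TV_leI)
  fix A
  have e0: "0 \<le> \<epsilon>"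
  proof -
    have "0 \<le> \<epsilon> * real (card X)" using small by (smt (verit) of_nat_0_le_iff)
    then show ?thesis using X by (simp add: zero_le_mult_iff card_gt_0_iff)
  qed
  have cX: "0 < real (card X)" and cV: "0 < real (card V)" using X V by (simp_all add: card_gt_0_iff)
  let ?Y = "X \<inter> \<Phi> -` A"
  have fin: "finite C" using C X finite_subset by blast
  have "?Y \<subseteq> (X - C) \<union> (\<Union>y\<in>V \<inter> A. {x \<in> C. \<Phi> x = y})" using C by auto
  then have "card ?Y \<le> card ((X - C) \<union> (\<Union>y\<in>V \<inter> A. {x \<in> C. \<Phi> x = y}))"
    using X V fin by (intro card_mono) auto
  also have "\<dots> \<le> card (X - C) + card (\<Union>y\<in>V \<inter> A. {x \<in> C. \<Phi> x = y})" by (rule card_Un_le)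
  also have "card (\<Union>y\<in>V \<inter> A. {x \<in> C. \<Phi> x = y}) \<le> (\<Sum>y\<in>V \<inter> A. card {x \<in> C. \<Phi> x = y})"
    by (rule card_UN_le) (use V in simp)
  also have "\<dots> \<le> (\<Sum>y\<in>V \<inter> A. m)" by (rule sum_mono) (use fib in simp)
  finally have "card ?Y \<le> card (X - C) + card (V \<inter> A) * m" by simp
  then have "real (card ?Y) \<le> real (card (X - C)) + real (card (V \<inter> A)) * real m"
    by (metis of_nat_le_iff of_nat_add of_nat_mult)
  also have "\<dots> \<le> \<epsilon> * real (card X) + real (card (V \<inter> A)) * ((1 + \<epsilon>) * real (card X) / real (card V))"
    using small ratio cV by (intro add_mono mult_left_mono) (auto simp: field_simps)
  finally have le: "real (card ?Y) / real (card X) \<le> \<epsilon> + (1 + \<epsilon>) * (real (card (V \<inter> A)) / real (card V))"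
    using cX cV by (simp add: field_simps)
  define u where "u = real (card (V \<inter> A)) / real (card V)"
  have "real (card (V \<inter> A)) / real (card V) \<le> 1"
    using cV card_mono[OF V(1), of "V \<inter> A"] by simp
  then have "\<epsilon> * u \<le> \<epsilon>" unfolding u_def[symmetric] using e0 mult_left_le by blast
  then have "real (card ?Y) / real (card X) \<le> real (card (V \<inter> A)) / real (card V) + 2 * \<epsilon>"
    using le unfolding u_def[symmetric] by (simp add: distrib_right)
  then show "measure_pmf.prob (map_pmf \<Phi> (pmf_of_set X)) A \<le> measure_pmf.prob (pmf_of_set V) A + 2 * \<epsilon>"
    using X V by (simp add: measure_pmf_of_set)
qed

section \<open>One step from the uniform law, and the iteration\<close>

lemma pair_pmf_of_set:
  assumes "finite A" "A \<noteq> {}" "finite B" "B \<noteq> {}"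
  shows "pair_pmf (pmf_of_set A) (pmf_of_set B) = pmf_of_set (A \<times> B)"
proof (rule pmf_eqI)
  fix x :: "'a \<times> 'b"
  obtain a b where x: "x = (a, b)" by (cases x)
  show "pmf (pair_pmf (pmf_of_set A) (pmf_of_set B)) x = pmf (pmf_of_set (A \<times> B)) x"
    using assms by (simp add: x pmf_pair card_cartesian_product indicator_def)
qed

lemma uniform_factorization_eq:
  assumes "factorizations n h \<noteq> {}"
  shows "uniform_factorization n h = pmf_of_set (Some ` factorizations n h)"
  unfolding uniform_factorization_def using assms by (simp add: map_pmf_of_set_inj)

lemma bind_uniform_factorization:
  assumes "factorizations n h \<noteq> {}" "pairs (n - 1 + 2 * Suc h) \<noteq> {}" "triples n \<noteq> {}"
  shows "bind_pmf (uniform_factorization n h) (\<Lambda> n (Suc h)) = map_pmf (step_map n) (pmf_of_set (step_inputs n h))"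
proof -
  let ?F = "factorizations n h" and ?P = "pairs (n - 1 + 2 * Suc h)" and ?T = "triples n"
  have "pmf_of_set (step_inputs n h) = pair_pmf (pmf_of_set ?F) (pair_pmf (pmf_of_set ?P) (pmf_of_set ?T))"
    unfolding step_inputs_def using assms by (simp add: pair_pmf_of_set)
  moreover have "bind_pmf (uniform_factorization n h) (\<Lambda> n (Suc h)) =
      bind_pmf (pmf_of_set ?F) (\<lambda>ts. map_pmf (\<lambda>q. step_map n (ts, q)) (pair_pmf (pmf_of_set ?P) (pmf_of_set ?T)))"
    by (simp add: uniform_factorization_def bind_map_pmf \<Lambda>_def step_map_def case_prod_unfold)
  moreover have "bind_pmf p (\<lambda>ts. map_pmf (\<lambda>q. f (ts, q)) r) = map_pmf f (pair_pmf p r)"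
    for p :: "'x pmf" and r :: "'y pmf" and f :: "'x \<times> 'y \<Rightarrow> 'z"
    by (simp add: pair_pmf_def map_pmf_def bind_assoc_pmf bind_return_pmf)
  ultimately show ?thesis by simp
qed

lemma pairs_triples_nonempty: "3 \<le> n \<Longrightarrow> pairs (n - 1 + 2 * h) \<noteq> {} \<and> triples n \<noteq> {}"
proof -
  assume n: "3 \<le> n"
  have "(1, 2) \<in> pairs (n - 1 + 2 * h)" "(1, 2, 3) \<in> triples n" using n by (auto simp: pairs_def triples_def)
  then show ?thesis by blast
qed

lemma d_TV_step_eventually:
  assumes unif: "typical h" and \<epsilon>: "0 < \<epsilon>"
  shows "eventually (\<lambda>n. d_TV (bind_pmf (uniform_factorization n h) (\<Lambda> n (Suc h))) (uniform_factorization n (Suc h)) \<le> 2 * \<epsilon>) sequentially"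
proof -
  obtain k where ev: "eventually (\<lambda>n. mostly_clean n h k \<epsilon>) sequentially"
    using typical_clean[OF unif \<epsilon>, of 1] by auto
  have "eventually (\<lambda>n. 2 * real (Suc h) * real (card (factorizations n (Suc h))) /
     (real (card (factorizations n h)) * real (card (pairs (n - 1 + 2 * Suc h))) * real (card (triples n))) < 1 + \<epsilon>) sequentially"
    by (rule order_tendstoD(2)[OF factorizations_ratio]) (use \<epsilon> in simp)
  with ev show ?thesis
    using factorizations_nonempty_eventually[of h] factorizations_nonempty_eventually[of "Suc h"] eventually_ge_at_top[of 3]
  proof eventually_elim
    case (elim n)
    let ?C = "clean_inputs n h (n div k) (\<epsilon> / 4 * real n)"
    note ne = pairs_triples_nonempty[OF elim(5), of "Suc h"]
    have X: "step_inputs n h \<noteq> {}" using ne elim(3) by (simp add: step_inputs_def)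
    have img: "step_map n q \<in> Some ` factorizations n (Suc h)" if "q \<in> ?C" for q
    proof -
      obtain ts v w a b c where e: "q = (ts, (v, w), (a, b, c))" by (metis prod_cases3 surj_pair)
      show ?thesis using step_map_clean(1,2)[of ts v w a b c] that unfolding e by blast
    qed
    have "d_TV (map_pmf (step_map n) (pmf_of_set (step_inputs n h))) (pmf_of_set (Some ` factorizations n (Suc h))) \<le> 2 * \<epsilon>"
    proof (rule d_TV_image_le[where C = ?C and m = "2 * Suc h"])
      show "step_map n ` ?C \<subseteq> Some ` factorizations n (Suc h)" using img by blast
      show "card {x \<in> ?C. step_map n x = y} \<le> 2 * Suc h" if "y \<in> Some ` factorizations n (Suc h)" for y
        using that card_clean_fibre[of _ n h] elim(5) by auto
      show "real (2 * Suc h) * real (card (Some ` factorizations n (Suc h))) \<le> (1 + \<epsilon>) * real (card (step_inputs n h))"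
      proof -
        have "0 < real (card (step_inputs n h))" using X by (simp add: card_gt_0_iff)
        moreover have "real (card (step_inputs n h)) = real (card (factorizations n h)) * real (card (pairs (n - 1 + 2 * Suc h))) * real (card (triples n))"
          by (simp add: step_inputs_def card_cartesian_product)
        moreover have "real (card (Some ` factorizations n (Suc h))) = real (card (factorizations n (Suc h)))"
          by (simp add: card_image)
        ultimately show ?thesis using elim(2) by (simp add: divide_less_eq less_imp_le)
      qed
    qed (use X elim clean_inputs_subset in \<open>auto simp: mostly_clean_def\<close>)
    then show ?case
      using bind_uniform_factorization[OF elim(3)] ne uniform_factorization_eq[OF elim(4)] by simp
  qed
qed

lemma bad_antimono: "L' \<le> L \<Longrightarrow> bad n L ts \<subseteq> bad n L' ts"
  unfolding bad_def by (smt (verit) Collect_mono add_left_mono le_trans not_le)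

text \<open>Clean inputs have outputs with few bad vertices, so exceptional outputs have probability
  at most \<epsilon> after one step; by closeness of the two laws their uniform probability is at
  most 3 \<epsilon>.\<close>

lemma typical_Suc:
  assumes unif: "typical h"
  shows "typical (Suc h)"
  unfolding typical_def
proof (intro allI impI)
  fix \<eta> :: real and l :: nat assume \<eta>: "0 < \<eta>" and l: "1 \<le> l"
  define \<epsilon> where "\<epsilon> = \<eta> / 3"
  have \<epsilon>: "0 < \<epsilon>" using \<eta> by (simp add: \<epsilon>_def)
  obtain k where k: "l \<le> k" and ev: "eventually (\<lambda>n. mostly_clean n h k \<epsilon>) sequentially"
    using typical_clean[OF unif \<epsilon> l] by blast
  from ev d_TV_step_eventually[OF unif \<epsilon>]
  show "eventually (\<lambda>n. typical_at n (Suc h) l \<eta>) sequentially"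
    using factorizations_nonempty_eventually[of h] factorizations_nonempty_eventually[of "Suc h"] eventually_ge_at_top[of 3]
  proof eventually_elim
    case (elim n)
    let ?C = "clean_inputs n h (n div k) (\<epsilon> / 4 * real n)" and ?X = "step_inputs n h"
    let ?F = "factorizations n (Suc h)"
    let ?B = "{ts \<in> ?F. real (card (bad n (n div l) ts)) > \<eta> * real n}"
    note ne = pairs_triples_nonempty[OF elim(5), of "Suc h"]
    have X: "?X \<noteq> {}" using ne elim(3) by (simp add: step_inputs_def)
    have "?X \<inter> step_map n -` (Some ` ?B) \<subseteq> ?X - ?C"
    proof
      fix q assume q: "q \<in> ?X \<inter> step_map n -` (Some ` ?B)"
      have "q \<notin> ?C"
      proof
        assume c: "q \<in> ?C"
        obtain ts v w a b c where e: "q = (ts, (v, w), (a, b, c))" by (metis prod_cases3 surj_pair)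
        obtain G where G: "step_map n q = Some G" "real (card (bad n (n div k) G)) \<le> \<epsilon> / 4 * real n + 8 * real (n div k) + 4"
          using step_map_clean(1,3)[of ts v w a b c] \<open>q \<in> ?C\<close> unfolding e by blast
        have "card (bad n (n div l) G) \<le> card (bad n (n div k) G)"
          \<comment> \<open>Cleanness was arranged at the finer scale n/k with l \<le> k, where more
            vertices count as bad.\<close>
          using bad_antimono[OF div_le_mono2[of l k n]] k l by (intro card_mono) (auto simp: bad_def)
        then have "real (card (bad n (n div l) G)) \<le> \<epsilon> * real n" using G(2) elim(1) unfolding mostly_clean_def by linarith
        also have "\<dots> \<le> \<eta> * real n" using \<eta> by (simp add: \<epsilon>_def mult_right_mono)
        finally show False using q G(1) by auto
      qed
      then show "q \<in> ?X - ?C" using q by blast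
    qed
    then have "real (card (?X \<inter> step_map n -` (Some ` ?B))) \<le> real (card (?X - ?C))"
      by (simp add: card_mono)
    also have "\<dots> \<le> \<epsilon> * real (card ?X)" using elim(1) unfolding mostly_clean_def by blast
    finally have "measure_pmf.prob (map_pmf (step_map n) (pmf_of_set ?X)) (Some ` ?B) \<le> \<epsilon>"
      using X by (simp add: measure_pmf_of_set divide_le_eq card_gt_0_iff)
    then have "measure_pmf.prob (uniform_factorization n (Suc h)) (Some ` ?B) \<le> 3 * \<epsilon>"
      using d_TV_upper[of "bind_pmf (uniform_factorization n h) (\<Lambda> n (Suc h))" "Some ` ?B" "uniform_factorization n (Suc h)"]
        elim(2) bind_uniform_factorization[OF elim(3)] ne by simp
    moreover have "measure_pmf.prob (uniform_factorization n (Suc h)) (Some ` ?B) = real (card ?B) / real (card ?F)"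
    proof -
      have "Some ` ?F \<inter> Some ` ?B = Some ` ?B" by blast
      then show ?thesis unfolding uniform_factorization_eq[OF elim(4)] using elim(4)
        by (subst measure_pmf_of_set) (simp_all add: card_image)
    qed
    ultimately show ?case unfolding typical_at_def using elim(4) by (simp add: divide_le_eq card_gt_0_iff \<epsilon>_def)
  qed
qed

lemma typical: "typical h"
  by (induction h) (use typical_0 typical_Suc in auto)

lemma finite_set_\<Lambda>: "3 \<le> n \<Longrightarrow> finite (set_pmf (\<Lambda> n h F))"
  using pairs_triples_nonempty[of n h] by (auto simp: \<Lambda>_def set_pair_pmf split: option.split)

lemma finite_set_\<Lambda>_iter:
  "3 \<le> n \<Longrightarrow> finite (set_pmf p) \<Longrightarrow> finite (set_pmf (\<Lambda>_iter n g p))"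
  by (induction g) (auto simp: finite_set_\<Lambda>)

lemma finite_set_uniform_factorization:
  "factorizations n h \<noteq> {} \<Longrightarrow> finite (set_pmf (uniform_factorization n h))"
  by (simp add: uniform_factorization_eq)

lemma d_TV_step_tendsto:
  "(\<lambda>n. d_TV (bind_pmf (uniform_factorization n h) (\<Lambda> n (Suc h))) (uniform_factorization n (Suc h))) \<longlonglongrightarrow> 0"
proof (rule tendstoI)
  fix e :: real assume e: "0 < e"
  show "eventually (\<lambda>n. dist (d_TV (bind_pmf (uniform_factorization n h) (\<Lambda> n (Suc h))) (uniform_factorization n (Suc h))) 0 < e) sequentially"
    using d_TV_step_eventually[OF typical, of "e / 4" h] e
    by (auto elim!: eventually_mono simp: dist_real_def d_TV_nonneg)
qed

text \<open>Triangle inequality through the law obtained by one step from the exactly uniform law of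
  genus g: the accumulated error does not grow under the kernel, and the new error is that of a
  single step.\<close>

lemma d_TV_iter_tendsto:
  "(\<lambda>n. d_TV (\<Lambda>_iter n g (uniform_factorization n 0)) (uniform_factorization n g)) \<longlonglongrightarrow> 0"
proof (induction g)
  case 0
  then show ?case by (simp add: d_TV_refl)
next
  case (Suc g)
  let ?I = "\<lambda>n. \<Lambda>_iter n g (uniform_factorization n 0)" and ?U = "\<lambda>n. uniform_factorization n g"
  have "(\<lambda>n. d_TV (?I n) (?U n) + d_TV (bind_pmf (?U n) (\<Lambda> n (Suc g))) (uniform_factorization n (Suc g))) \<longlonglongrightarrow> 0 + 0"
    by (intro tendsto_add Suc d_TV_step_tendsto)
  then have lim: "(\<lambda>n. d_TV (?I n) (?U n) + d_TV (bind_pmf (?U n) (\<Lambda> n (Suc g))) (uniform_factorization n (Suc g))) \<longlonglongrightarrow> 0"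
    by simp
  have "eventually (\<lambda>n. d_TV (\<Lambda>_iter n (Suc g) (uniform_factorization n 0)) (uniform_factorization n (Suc g)) \<le>
      d_TV (?I n) (?U n) + d_TV (bind_pmf (?U n) (\<Lambda> n (Suc g))) (uniform_factorization n (Suc g))) sequentially"
    using factorizations_nonempty_eventually[of 0] factorizations_nonempty_eventually[of g] eventually_ge_at_top[of 3]
  proof eventually_elim
    case (elim n)
    have "d_TV (bind_pmf (?I n) (\<Lambda> n (Suc g))) (bind_pmf (?U n) (\<Lambda> n (Suc g))) \<le> d_TV (?I n) (?U n)"
      using elim by (intro d_TV_bind finite_set_\<Lambda>_iter finite_set_uniform_factorization)
    then show ?case
      using d_TV_triangle[of "bind_pmf (?I n) (\<Lambda> n (Suc g))" "uniform_factorization n (Suc g)" "bind_pmf (?U n) (\<Lambda> n (Suc g))"]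
      by simp
  qed
  then show ?case
    by (rule real_tendsto_sandwich[OF always_eventually[OF allI[OF d_TV_nonneg]] _ tendsto_const lim])
qed

theorem corollary1p2:
  fixes g :: nat
  assumes "g \<ge> 1"
  shows "(\<lambda>n. d_TV (\<Lambda>_iter n g (uniform_factorization n 0)) (uniform_factorization n g))
           \<longlonglongrightarrow> 0"
  by (rule d_TV_iter_tendsto)

end
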